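(* For $n=3,4,5$, the union of the cones $C(\mathcal S)$ over all seeds $\mathcal S$ of $\mathcal P(n)$ coincides with $\mathbf D(n)$.
   Context: Notation. $[n]=\{1,\dots,n\}$. $N\subset GL_n(\mathbb C)$ is the group of unipotent upper-triangular matrices. $\mathbb C[x_{ij}]$ is the polynomial ring in the entries of a generic $n\times n$ matrix $x=(x_{ij})_{i,j\in[n]}$ ($i$ is the row index, $j$ the column index), and $\mathbb C[x_{ij}]^N$ (identified with $\mathbb C[GL_n/N]$) is the subring of polynomials $f$ with $f(xu)=f(x)$ for all $u\in N$. For nonempty $I\subset[n]$, the flag minor $\Delta_I\in\mathbb C[x_{ij}]^N$ is the minor of $x$ on the rows $I$ and the first $|I|$ columns. Seeds and mutations. A seed is a quiver with vertex set $V=V_1\sqcup V_2$ ($V_1$ frozen, $V_2$ mutable), with integer skew-symmetric edge multiplicities $w(u,v)=-w(v,u)$ ($w(u,v)>0$ means $w(u,v)$ edges from $u$ to $v$), together with algebraically independent elements $x_v$, $v\in V$, of the field $\mathbb C(x_{ij})$. For $v\in V$, $In(v)=\{v': w(v',v)>0\}$ and $Out(v)=\{v'': w(v,v'')>0\}$. The mutation $\mu_v$ at $v\in V_2$ gives a new seed with the same frozen/mutable vertices: (i) all edges incident to $v$ are reversed; (ii) for each $v'\in In(v)$, $v''\in Out(v)$ the multiplicity $w(v',v'')$ is replaced by $w(v',v'')+w(v',v)\,w(v,v'')$ (and skew-symmetrically for $(v'',v')$); (iii) all other multiplicities are unchanged; the variables $x_u$, $u\ne v$, are unchanged and $x_v$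 is replaced by $x_v^{new}$ with $$x_v^{new}\,x_v=\prod_{v'\in In(v)}x_{v'}^{w(v',v)}+\prod_{v''\in Out(v)}x_{v''}^{w(v,v'')}.$$ The cluster algebra $\mathcal P(n)$. The initial seed has quiver $Q(n)$ with vertices $(i,j)$, $i,j\ge1$, $i+j\le n+1$, and edges (of multiplicity one, whenever both endpoints are vertices) $(i,j)\to(i+1,j)$, $(i,j)\to(i,j-1)$, $(i,j)\to(i-1,j+1)$. The frozen vertices are $(1,j)$, $1\le j\le n$, and $(i,j)$ with $i+j=n+1$; all other vertices are mutable. The variable at $(i,j)$ is the interval flag minor $\Delta_{\{i,i+1,\dots,i+j-1\}}$. The seeds of $\mathcal P(n)$ are all seeds obtained from the initial one by finite sequences of mutations at mutable vertices (seeds with the same set of variables are identified); the cluster variables of $\mathcal P(n)$ are all the elements $x_v\in\mathbb C(x_{ij})$ (including those at frozen vertices) occurring in these seeds. Tableaux. A semi-standard Young tableau in the alphabet $[n]$ is a filling of the boxes of a Young diagram (rows numbered from bottom to top, left-justified, of weakly decreasing lengths $\lambda_1\ge\lambda_2\ge\dots$) by elements of $[n]$ that is non-decreasing along rows (left to right) and strictly increasing along columns (bottom to top). If $T_1,\dots,T_{\lambda_1}\subset[n]$ are the sets of entries of the columns of $T$, then $\Delta_T:=\Delta_{T_1}\cdots\Delta_{T_{\lambda_1}}$. The array $A(T)=(a_{ij}(T))_{1\le j\le i\le n}\in\mathbb R^{n(n+1)/2}$ is defined by: $a_{ij}(T)$ is the number of boxes in the $j$-th row of $T$ filled with $i$.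 The cone $\mathbf D(n)\subset\mathbb R^{n(n+1)/2}$ consists of all arrays $(a(i,j))_{1\le j\le i\le n}$ with non-negative real entries (set $a(i,j)=0$ for $i<j$) such that for all $j<n$ and $i\in[n]$ $$a(1,j+1)+\dots+a(i,j+1)\le a(1,j)+\dots+a(i-1,j).$$ Its integer points are exactly the arrays $A(T)$ of semi-standard Young tableaux $T$ in the alphabet $[n]$. Order and labels. Order the variables by $x_{ij}\succ x_{kl}$ if $i<k$, or $i=k$ and $j<l$, and let $\succ$ also denote the resulting lexicographic order on monomials; the leading monomial of $\Delta_T$ is $\prod_{i,j}x_{ij}^{a_{ij}(T)}$. Each cluster variable $P$ of $\mathcal P(n)$ can be written as $P=\Delta_T+P'$ with $T$ a semi-standard Young tableau and $P'\in\mathbb C[x_{ij}]^N$ either $0$ or with leading monomial strictly smaller than that of $\Delta_T$; $T$ is determined by $P$ and is called the label of $P$. The cones. For a seed $\mathcal S$ of $\mathcal P(n)$, $C(\mathcal S)$ is the cone (set of non-negative real linear combinations) spanned by the arrays $A(T)$, where $T$ runs over the labels of all $n(n+1)/2$ variables (mutable and frozen) of $\mathcal S$. The labels of the frozen variables are the one-column tableaux with entries $\{1,\dots,i\}$, $i=1,\dots,n$, and $\{i,\dots,n\}$, $i=2,\dots,n$. *)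

theory Defs
  imports
    Complex_Main
    "HOL-Library.Poly_Mapping"
    "HOL-Library.Product_Lexorder"
    "HOL-Computational_Algebra.Polynomial_Factorial"
    "Jordan_Normal_Form.Determinant"
begin

section \<open>Polynomials in the matrix entries\<close>

text \<open>
  The variable \<open>x_ij\<close> is the index pair \<open>(i, j)\<close>, row first, both starting at 1. Polynomials may
  involve any pair; those of size \<open>n\<close> are singled out by \<open>matrix_polys n\<close>, and all
  cluster variables of size \<open>n\<close> lie in the subfield generated by \<open>matrix_polys n\<close>.

  Pairs are ordered lexicographically, and the library order on
  \<open>monom = (nat \<times> nat \<Rightarrow>\<^sub>0 nat)\<close> compares two monomials by their exponents at the least pair
  where they differ. This is the lexicographic monomial order in which \<open>x_ij\<close> exceeds \<open>x_kl\<close> iff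
  \<open>i < k\<close>, or \<open>i = k\<close> and \<open>j < l\<close>.
\<close>

type_synonym monom = "nat \<times> nat \<Rightarrow>\<^sub>0 nat"
type_synonym mpoly = "monom \<Rightarrow>\<^sub>0 complex"
type_synonym ratfun = "mpoly fract"

definition Var :: "nat \<Rightarrow> nat \<Rightarrow> mpoly" where
  "Var i j = Poly_Mapping.single (Poly_Mapping.single (i, j) 1) 1"

definition matrix_polys :: "nat \<Rightarrow> mpoly set" where
  "matrix_polys n = {p. \<forall>m \<in> Poly_Mapping.keys p. Poly_Mapping.keys m \<subseteq> {1..n} \<times> {1..n}}"

text \<open>Matrix positions in \<open>Jordan_Normal_Form\<close> start at 0, hence the shift.\<close>

definition eval_mpoly :: "mpoly \<Rightarrow> complex mat \<Rightarrow> complex" where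
  "eval_mpoly p x =
     (\<Sum>m \<in> Poly_Mapping.keys p. Poly_Mapping.lookup p m *
        (\<Prod>(i, j) \<in> Poly_Mapping.keys m. x $$ (i - 1, j - 1) ^ Poly_Mapping.lookup m (i, j)))"

definition unipotent_upper :: "nat \<Rightarrow> complex mat set" where
  "unipotent_upper n = {u \<in> carrier_mat n n. upper_triangular u \<and> (\<forall>i<n. u $$ (i, i) = 1)}"

definition invariant_polys :: "nat \<Rightarrow> mpoly set" where
  "invariant_polys n =
     {f \<in> matrix_polys n. \<forall>x \<in> carrier_mat n n. \<forall>u \<in> unipotent_upper n.
        eval_mpoly f (x * u) = eval_mpoly f x}"

text \<open>Only meaningful for nonzero polynomials.\<close>

definition lead_monom :: "mpoly \<Rightarrow> monom" where
  "lead_monom p = Max (Poly_Mapping.keys p)"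

definition flag_minor :: "nat set \<Rightarrow> mpoly" where
  "flag_minor I =
     det (mat (card I) (card I) (\<lambda>(r, c). Var (sorted_list_of_set I ! r) (c + 1)))"


section \<open>Seeds and mutations\<close>

text \<open>\<open>weight S u v\<close> is the skew-symmetric multiplicity, positive for edges from \<open>u\<close> to \<open>v\<close>.\<close>

record 'v seed =
  frozen :: "'v set"
  mutables :: "'v set"
  weight :: "'v \<Rightarrow> 'v \<Rightarrow> int"
  variable :: "'v \<Rightarrow> ratfun"

definition vertices :: "'v seed \<Rightarrow> 'v set" where
  "vertices S = frozen S \<union> mutables S"

definition In :: "'v seed \<Rightarrow> 'v \<Rightarrow> 'v set" where
  "In S v = {u \<in> vertices S. weight S u v > 0}"

definition Out :: "'v seed \<Rightarrow> 'v \<Rightarrow> 'v set" where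
  "Out S v = {u \<in> vertices S. weight S v u > 0}"

definition mutate_weight :: "'v seed \<Rightarrow> 'v \<Rightarrow> 'v \<Rightarrow> 'v \<Rightarrow> int" where
  "mutate_weight S v a b =
    (if a = v \<or> b = v then - weight S a b
     else if a \<in> In S v \<and> b \<in> Out S v then weight S a b + weight S a v * weight S v b
     else if b \<in> In S v \<and> a \<in> Out S v then weight S a b - weight S b v * weight S v a
     else weight S a b)"

definition mutate_variable :: "'v seed \<Rightarrow> 'v \<Rightarrow> ratfun" where
  "mutate_variable S v =
     ((\<Prod>u \<in> In S v. variable S u ^ nat (weight S u v)) +
      (\<Prod>u \<in> Out S v. variable S u ^ nat (weight S v u))) / variable S v"

definition mutate :: "'v \<Rightarrow> 'v seed \<Rightarrow> 'v seed" where
  "mutate v S =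
     S\<lparr>weight := mutate_weight S v, variable := (variable S)(v := mutate_variable S v)\<rparr>"


section \<open>The cluster algebra \<open>P(n)\<close>\<close>

definition Q_vertices :: "nat \<Rightarrow> (nat \<times> nat) set" where
  "Q_vertices n = {(i, j). 1 \<le> i \<and> 1 \<le> j \<and> i + j \<le> n + 1}"

definition Q_frozen :: "nat \<Rightarrow> (nat \<times> nat) set" where
  "Q_frozen n = {(i, j) \<in> Q_vertices n. i = 1 \<or> i + j = n + 1}"

definition Q_edges :: "nat \<Rightarrow> ((nat \<times> nat) \<times> (nat \<times> nat)) set" where
  "Q_edges n =
     {((i, j), (k, l)). (i, j) \<in> Q_vertices n \<and> (k, l) \<in> Q_vertices n \<and>
        (k = i + 1 \<and> l = j \<or> k = i \<and> j = l + 1 \<or> i = k + 1 \<and> l = j + 1)}"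

definition initial_seed :: "nat \<Rightarrow> (nat \<times> nat) seed" where
  "initial_seed n =
     \<lparr>frozen = Q_frozen n,
      mutables = Q_vertices n - Q_frozen n,
      weight = (\<lambda>u v. of_bool ((u, v) \<in> Q_edges n) - of_bool ((v, u) \<in> Q_edges n)),
      variable = (\<lambda>(i, j). to_fract (flag_minor {i..<i + j}))\<rparr>"

inductive_set seeds :: "nat \<Rightarrow> (nat \<times> nat) seed set" for n :: nat where
  initial: "initial_seed n \<in> seeds n"
| mutation: "mutate v S \<in> seeds n" if "S \<in> seeds n" "v \<in> mutables S"


section \<open>Tableaux\<close>

text \<open>
  A tableau is the list of its nonempty rows, the longest (bottom) row first; \<open>T ! r ! c\<close> is the
  entry in row \<open>r + 1\<close> and column \<open>c + 1\<close>.
\<close>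

type_synonym tableau = "nat list list"

definition ssyt :: "nat \<Rightarrow> tableau \<Rightarrow> bool" where
  "ssyt n T \<longleftrightarrow>
     (\<forall>R \<in> set T. R \<noteq> [] \<and> set R \<subseteq> {1..n} \<and> sorted R) \<and>
     (\<forall>r. Suc r < length T \<longrightarrow>
        length (T ! Suc r) \<le> length (T ! r) \<and>
        (\<forall>c < length (T ! Suc r). T ! r ! c < T ! Suc r ! c))"

definition num_columns :: "tableau \<Rightarrow> nat" where
  "num_columns T = (if T = [] then 0 else length (hd T))"

definition column :: "tableau \<Rightarrow> nat \<Rightarrow> nat set" where
  "column T c = {T ! r ! c | r. r < length T \<and> c < length (T ! r)}"

definition tableau_minor :: "tableau \<Rightarrow> mpoly" where
  "tableau_minor T = (\<Prod>c<num_columns T. flag_minor (column T c))"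

text \<open>
  An array indexed by \<open>1 \<le> j \<le> i \<le> n\<close> is a function vanishing at all other
  indices; for a semi-standard tableau the following function does.
\<close>

type_synonym array = "nat \<Rightarrow> nat \<Rightarrow> real"

definition tableau_array :: "tableau \<Rightarrow> array" where
  "tableau_array T i j =
     (if 1 \<le> j \<and> j \<le> length T then real (count_list (T ! (j - 1)) i) else 0)"

definition D_cone :: "nat \<Rightarrow> array set" where
  "D_cone n =
     {a. (\<forall>i j. 0 \<le> a i j) \<and>
         (\<forall>i j. \<not> (1 \<le> j \<and> j \<le> i \<and> i \<le> n) \<longrightarrow> a i j = 0) \<and>
         (\<forall>j i. 1 \<le> j \<and> j < n \<and> i \<in> {1..n} \<longrightarrow>
            (\<Sum>k=1..i. a k (j + 1)) \<le> (\<Sum>k=1..<i. a k j))}"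


section \<open>Labels and the cones of seeds\<close>

definition is_label :: "nat \<Rightarrow> ratfun \<Rightarrow> tableau \<Rightarrow> bool" where
  "is_label n P T \<longleftrightarrow>
     ssyt n T \<and>
     (\<exists>P' \<in> invariant_polys n.
        P = to_fract (tableau_minor T + P') \<and>
        (P' = 0 \<or> lead_monom P' < lead_monom (tableau_minor T)))"

definition seed_cone :: "nat \<Rightarrow> (nat \<times> nat) seed \<Rightarrow> array set" where
  "seed_cone n S =
     {(\<lambda>i j. \<Sum>v \<in> vertices S. c v * tableau_array (T v) i j) | c T.
        \<forall>v \<in> vertices S. 0 \<le> c v \<and> is_label n (variable S v) (T v)}"

end

(*
  Let the labels of all cluster variables be the generators of a cone. Peeling off columns shows
  that D(n) lies in it. Whenever two cluster variables are incompatible, the sum of their labels'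
  arrays is a sum of arrays of pairwise compatible labels of smaller total potential, for a suitable
  convex potential. Hence a representation of a point of D(n) with minimal potential only involves
  pairwise compatible labels, and each such set of labels is part of a seed. Seeds are reached from
  the initial one along a spanning tree of the exchange graph (672 seeds for n = 5, of type D6), and
  each exchange relation used is a combination of Pluecker relations between flag minors.
*)
theory Submission
  imports Defs "Jordan_Normal_Form.DL_Rank"
begin

section \<open>The cone of arrays\<close>

text \<open>With real coefficients, straightening pair after pair could go on for ever. This is why
  a minimiser is taken: every label has an array entry at least 1, so the coefficients of a
  representation are bounded and compactness gives one of least potential. The opposite inclusion is
  elementary, since labels are semi-standard tableaux. One table serves all three values of n. The
  variables for n = 3 and n = 4 (types A1 and A3) are the entries whose labels use only [n]; some
  are frozen there but mutable for n = 5. As D(n) lies in D(5) and non-negative arrays cannot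
  cancel, a point of D(n) only involves labels in [n]. The lists of labels, straightening relations,
  exchange relations and mutations are certificates that the simplifier verifies. An exhaustive
  search then checks that each set of pairwise compatible mutable indices lies in a seed that the
  mutation tree has visited.\<close>

lemma sum_count_list_eq_length_filter:
  "finite K \<Longrightarrow> (\<Sum>k\<in>K. count_list R k) = length (filter (\<lambda>x. x \<in> K) R)"
proof (induction R)
  case (Cons x R)
  have "(\<Sum>k\<in>K. count_list (x # R) k) = (\<Sum>k\<in>K. count_list R k + (if k = x then 1 else 0))"
    by (intro sum.cong) auto
  also have "\<dots> = (\<Sum>k\<in>K. count_list R k) + (if x \<in> K then 1 else 0)"
    using Cons.prems by (simp add: sum.distrib)
  finally show ?case using Cons by simp
qed simp

text \<open>Columns increase strictly and start with an entry at least 1. Rows are numbered from 0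
  here.\<close>

lemma ssyt_entry_ge:
  "ssyt n T \<Longrightarrow> r < length T \<Longrightarrow> c < length (T ! r) \<Longrightarrow> Suc r \<le> T ! r ! c"
proof (induction r)
  case 0
  then have "T ! 0 \<in> set T" by simp
  then have "set (T ! 0) \<subseteq> {1..n}" using 0 by (auto simp: ssyt_def)
  then show ?case using nth_mem[OF 0(3)] by auto
next
  case (Suc r)
  then have "length (T ! Suc r) \<le> length (T ! r)" "T ! r ! c < T ! Suc r ! c"
    by (auto simp: ssyt_def)
  then show ?case using Suc by fastforce
qed

text \<open>The inequality counts columns: an entry at most \<open>i\<close> in row
  \<open>j + 1\<close> sits directly above an entry at most \<open>i - 1\<close> in row
  \<open>j\<close>.\<close>

lemma tableau_array_in_D_cone:
  assumes T: "ssyt n T"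
  shows "tableau_array T \<in> D_cone n"
  unfolding D_cone_def
proof (intro CollectI conjI allI impI)
  fix i j
  show "0 \<le> tableau_array T i j" by (simp add: tableau_array_def)
next
  fix i j assume ij: "\<not> (1 \<le> j \<and> j \<le> i \<and> i \<le> n)"
  show "tableau_array T i j = 0"
  proof (rule ccontr)
    assume "tableau_array T i j \<noteq> 0"
    then have j: "1 \<le> j" "j \<le> length T" and "count_list (T ! (j - 1)) i \<noteq> 0"
      by (auto simp: tableau_array_def split: if_splits)
    then have mem: "i \<in> set (T ! (j - 1))" by (simp add: count_list_0_iff)
    then obtain c where "c < length (T ! (j - 1))" "T ! (j - 1) ! c = i" by (auto simp: in_set_conv_nth)
    then have "j \<le> i" using ssyt_entry_ge[OF T, of "j - 1" c] j by simp
    moreover have "T ! (j - 1) \<in> set T" using j by simp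
    then have "set (T ! (j - 1)) \<subseteq> {1..n}" using T by (simp add: ssyt_def)
    then have "i \<le> n" using mem by auto
    ultimately show False using ij j by simp
  qed
next
  fix j i assume ji: "1 \<le> j \<and> j < n \<and> i \<in> {1..n}"
  \<comment> \<open>A partial row sum is the number of columns whose entry in row \<open>l\<close>
    lies in \<open>K\<close>.\<close>
  have sum_row: "(\<Sum>k\<in>K. tableau_array T k l) =
      real (card {c. c < length (T ! (l - 1)) \<and> T ! (l - 1) ! c \<in> K})"
    if "1 \<le> l" "l \<le> length T" "finite K" for l K
    using that sum_count_list_eq_length_filter[of K "T ! (l - 1)"]
    by (simp add: tableau_array_def length_filter_conv_card flip: of_nat_sum)
  show "(\<Sum>k = 1..i. tableau_array T k (j + 1)) \<le> (\<Sum>k = 1..<i. tableau_array T k j)"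
  \<comment> \<open>\<open>T ! j\<close> is row \<open>j + 1\<close>; if it is missing, the left
    side is 0.\<close>
  proof (cases "j < length T")
    case False
    then show ?thesis by (auto simp: tableau_array_def intro!: sum_nonneg)
  next
    case True
    have "{c. c < length (T ! j) \<and> T ! j ! c \<in> {1..i}} \<subseteq>
        {c. c < length (T ! (j - 1)) \<and> T ! (j - 1) ! c \<in> {1..<i}}"
    proof clarify
      fix c assume c: "c < length (T ! j)" "T ! j ! c \<in> {1..i}"
      have "\<forall>r. Suc r < length T \<longrightarrow> length (T ! Suc r) \<le> length (T ! r) \<and>
          (\<forall>c < length (T ! Suc r). T ! r ! c < T ! Suc r ! c)"
        using T by (simp add: ssyt_def)
      from this[rule_format, of "j - 1"]
      have "length (T ! j) \<le> length (T ! (j - 1))" "T ! (j - 1) ! c < T ! j ! c"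
        using True ji c by auto
      moreover have "Suc (j - 1) \<le> T ! (j - 1) ! c"
        using ssyt_entry_ge[OF T, of "j - 1" c] True ji c calculation by simp
      ultimately show "c < length (T ! (j - 1)) \<and> T ! (j - 1) ! c \<in> {1..<i}" using c by auto
    qed
    then have "card {c. c < length (T ! j) \<and> T ! j ! c \<in> {1..i}} \<le>
        card {c. c < length (T ! (j - 1)) \<and> T ! (j - 1) ! c \<in> {1..<i}}"
      by (intro card_mono) auto
    then show ?thesis using True ji sum_row[of "j + 1" "{1..i}"] sum_row[of j "{1..<i}"] by simp
  qed
qed

lemma D_cone_sum:
  assumes "\<And>v. v \<in> V \<Longrightarrow> 0 \<le> c v" and "\<And>v. v \<in> V \<Longrightarrow> A v \<in> D_cone n"
  shows "(\<lambda>i j. \<Sum>v\<in>V. c v * A v i j) \<in> D_cone n"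
proof -
  have "(\<Sum>k = 1..i. \<Sum>v\<in>V. c v * A v k (j + 1)) \<le> (\<Sum>k = 1..<i. \<Sum>v\<in>V. c v * A v k j)"
    if "1 \<le> j" "j < n" "i \<in> {1..n}" for i j
  proof -
    have "(\<Sum>v\<in>V. c v * (\<Sum>k = 1..i. A v k (j + 1))) \<le> (\<Sum>v\<in>V. c v * (\<Sum>k = 1..<i. A v k j))"
      using assms that by (intro sum_mono mult_left_mono) (auto simp: D_cone_def)
    then show ?thesis by (subst (1 2) sum.swap) (simp add: sum_distrib_left)
  qed
  then show ?thesis
    using assms by (auto simp: D_cone_def intro!: sum_nonneg sum.neutral mult_nonneg_nonneg)
qed

text \<open>This is the easy inclusion of the theorem: arrays of semi-standard tableaux lie in
  \<open>D_cone n\<close>, which is closed under non-negative combinations.\<close>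

lemma seed_cone_subset_D_cone: "seed_cone n S \<subseteq> D_cone n"
  unfolding seed_cone_def
  by (auto simp: is_label_def intro!: D_cone_sum tableau_array_in_D_cone)

text \<open>
  The column peeled off takes the least entry of every nonempty row.
\<close>

lemma D_cone_peel_column:
  assumes a: "a \<in> D_cone n" and ne: "a \<noteq> (\<lambda>i j. 0)"
  obtains xs e where "xs \<noteq> []" "sorted_wrt (<) xs" "set xs \<subseteq> {1..n}" "0 < e"
    "(\<lambda>i j. a i j - e * tableau_array (map (\<lambda>x. [x]) xs) i j) \<in> D_cone n"
    "{(i, j). a i j - e * tableau_array (map (\<lambda>x. [x]) xs) i j \<noteq> 0} \<subset> {(i, j). a i j \<noteq> 0}"
proof -
  have nn: "0 \<le> a i j" for i j using a by (simp add: D_cone_def)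
  have supp: "1 \<le> j \<and> j \<le> i \<and> i \<le> n" if "a i j \<noteq> 0" for i j
    using a that unfolding D_cone_def by auto
  have ineq: "(\<Sum>k=1..i. a k (j + 1)) \<le> (\<Sum>k=1..<i. a k j)" if "1 \<le> j" "j < n" "i \<in> {1..n}" for i j
    using a that by (auto simp: D_cone_def)
  \<comment> \<open>A positive left side of the defining inequality forces a positive entry of row
    \<open>j\<close> strictly before \<open>i\<close>.\<close>
  have step: "\<exists>k<i. a k j \<noteq> 0" if "a i (Suc j) \<noteq> 0" "1 \<le> j" for i j
  proof (rule ccontr)
    assume "\<not> ?thesis"
    then have "(\<Sum>k=1..<i. a k j) = 0" by (auto intro!: sum.neutral)
    then have "(\<Sum>k=1..i. a k (j + 1)) \<le> 0" using ineq[of j i] supp[OF that(1)] that by simp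
    moreover have "a i (j + 1) \<le> (\<Sum>k=1..i. a k (j + 1))"
      using supp[OF that(1)] nn by (intro member_le_sum) auto
    ultimately show False using that nn[of i "Suc j"] by simp
  qed
  \<comment> \<open>The nonempty rows are closed downwards by \<open>step\<close>, hence form an
    initial segment \<open>{1..k}\<close>.\<close>
  define K where "K = {j. \<exists>i. a i j \<noteq> 0}"
  have K_sub: "K \<subseteq> {1..n}" using supp by (fastforce simp: K_def)
  have fK: "finite K" using K_sub finite_subset by blast
  have K_ne: "K \<noteq> {}" using ne by (auto simp: K_def fun_eq_iff)
  define k where "k = Max K"
  have down: "j \<in> K" if "Suc j \<in> K" "1 \<le> j" for j using step that by (auto simp: K_def)
  have "j \<in> K" if "1 \<le> j" "j \<le> k" for j
    using that(2,1)
  proof (induction rule: inc_induct)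
    case base
    then show ?case using Max_in[OF fK K_ne] by (simp add: k_def)
  qed (use down in auto)
  then have K_eq: "K = {1..k}" using K_sub Max_ge[OF fK] by (auto simp: k_def)
  have k1: "1 \<le> k" using K_ne K_eq by auto
  define m where "m j = (LEAST i. a i j \<noteq> 0)" for j
  have m: "a (m j) j \<noteq> 0" if "j \<in> {1..k}" for j
  proof -
    have "\<exists>i. a i j \<noteq> 0" using that K_eq K_def by blast
    then show ?thesis unfolding m_def by (rule LeastI_ex)
  qed
  have m_le: "m j \<le> i" if "a i j \<noteq> 0" for i j using that unfolding m_def by (rule Least_le)
  have m_Suc: "m j < m (Suc j)" if "1 \<le> j" "Suc j \<le> k" for j
    using step[of "m (Suc j)" j] m[of "Suc j"] m_le that by (meson atLeastAtMost_iff le_less_trans le_SucI)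
  define xs where "xs = map m [1..<Suc k]"
  \<comment> \<open>The largest multiple of the column that can be subtracted without leaving the
    non-negative arrays; it makes at least one entry vanish, so the support shrinks.\<close>
  define e where "e = Min ((\<lambda>j. a (m j) j) ` {1..k})"
  define b where "b i j = a i j - e * tableau_array (map (\<lambda>x. [x]) xs) i j" for i j
  have len: "length xs = k" by (simp add: xs_def)
  have col: "tableau_array (map (\<lambda>x. [x]) xs) i j = of_bool (j \<in> {1..k} \<and> i = m j)" for i j
    by (auto simp: tableau_array_def xs_def nth_append simp del: upt_Suc)
  have e_le: "e \<le> a (m j) j" if "j \<in> {1..k}" for j
    unfolding e_def using that by (intro Min_le) auto
  have "e \<in> (\<lambda>j. a (m j) j) ` {1..k}"
    unfolding e_def using k1 by (intro Min_in) auto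
  then obtain j0 where j0: "j0 \<in> {1..k}" "e = a (m j0) j0" by blast
  have e_pos: "0 < e" using m[OF j0(1)] nn[of "m j0" j0] j0(2) by linarith
  have "sorted_wrt (<) xs"
    using m_Suc by (auto simp: sorted_wrt_iff_nth_Suc_transp xs_def simp del: upt_Suc)
  moreover have "xs \<noteq> []" using len k1 by auto
  moreover have "set xs \<subseteq> {1..n}" using m supp unfolding xs_def by fastforce
  moreover have "{(i, j). b i j \<noteq> 0} \<subset> {(i, j). a i j \<noteq> 0}"
  proof (rule psubsetI)
    show "{(i, j). b i j \<noteq> 0} \<subseteq> {(i, j). a i j \<noteq> 0}"
      using m by (auto simp: b_def col)
    have "b (m j0) j0 = 0" using j0 by (simp add: b_def col)
    then show "{(i, j). b i j \<noteq> 0} \<noteq> {(i, j). a i j \<noteq> 0}" using m[OF j0(1)] by blast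
  qed
  moreover have "b \<in> D_cone n"
    unfolding D_cone_def
  proof (intro CollectI conjI allI impI)
    fix i j
    show "0 \<le> b i j" using e_le nn by (auto simp: b_def col)
  next
    fix i j assume "\<not> (1 \<le> j \<and> j \<le> i \<and> i \<le> n)"
    then have "a i j = 0" using supp by blast
    then show "b i j = 0" using m by (auto simp: b_def col)
  next
    fix j i assume ji: "1 \<le> j \<and> j < n \<and> i \<in> {1..n}"
    have m1: "1 \<le> m l" if "l \<in> {1..k}" for l using supp[OF m[OF that]] by simp
    have sum_b: "(\<Sum>x\<in>X. b x l) = (\<Sum>x\<in>X. a x l) - e * of_bool (l \<in> {1..k} \<and> m l \<in> X)" if "finite X" for X l
    proof -
      have "(\<Sum>x\<in>X. tableau_array (map (\<lambda>x. [x]) xs) x l) = of_bool (l \<in> {1..k} \<and> m l \<in> X)"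
        using that by (cases "l \<in> {1..k}") (auto simp: col of_bool_def)
      then show ?thesis by (simp add: b_def sum_subtractf flip: sum_distrib_left)
    qed
    show "(\<Sum>x = 1..i. b x (j + 1)) \<le> (\<Sum>x = 1..<i. b x j)"
    \<comment> \<open>If row \<open>j + 1\<close> loses \<open>e\<close> on the left, then row
      \<open>j\<close> loses \<open>e\<close> on the right, because \<open>m j < m (j + 1)\<close>.
      Otherwise row \<open>j + 1\<close> has no entry up to \<open>i\<close>, by minimality of
      \<open>m\<close>, and the left side is 0.\<close>
    proof (cases "j + 1 \<in> {1..k} \<and> m (j + 1) \<in> {1..i}")
      case True
      then have "j \<in> {1..k}" "m j \<in> {1..<i}" using m_Suc[of j] m1[of j] ji by auto
      then show ?thesis using True ineq[of j i] ji by (simp add: sum_b)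
    next
      case False
      have "a x (j + 1) = 0" if "x \<in> {1..i}" for x
      proof (rule ccontr)
        assume x: "a x (j + 1) \<noteq> 0"
        then have "j + 1 \<in> K" by (auto simp: K_def)
        then have "j + 1 \<in> {1..k}" using K_eq by simp
        with False show False using m_le[OF x] m1[of "j + 1"] that by auto
      qed
      then have "(\<Sum>x = 1..i. b x (j + 1)) = 0"
        using False by (subst sum_b) (auto intro!: sum.neutral)
      also have "0 \<le> (\<Sum>x = 1..<i. b x j)"
        using e_le nn by (intro sum_nonneg) (auto simp: b_def col)
      finally show ?thesis .
    qed
  qed
  ultimately show thesis using that e_pos unfolding b_def by blast
qed

definition cone_over :: "'b set \<Rightarrow> ('b \<Rightarrow> array) \<Rightarrow> array set" where
  "cone_over Z A = {\<lambda>i j. \<Sum>z\<in>Z. d z * A z i j | d. \<forall>z\<in>Z. 0 \<le> d z}"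

lemma cone_over_add_scaled:
  assumes "finite Z" "b \<in> cone_over Z A" "z \<in> Z" "0 \<le> e"
  shows "(\<lambda>i j. b i j + e * A z i j) \<in> cone_over Z A"
proof -
  obtain d where d: "\<forall>z\<in>Z. 0 \<le> d z" "b = (\<lambda>i j. \<Sum>z\<in>Z. d z * A z i j)"
    using assms(2) by (auto simp: cone_over_def)
  have "(\<lambda>i j. b i j + e * A z i j) = (\<lambda>i j. \<Sum>y\<in>Z. (d y + (if y = z then e else 0)) * A y i j)"
    using assms(1,3) by (simp add: d(2) distrib_right sum.distrib if_distrib[of "\<lambda>x. x * _"] cong: if_cong)
  then show ?thesis using d(1) assms(4) unfolding cone_over_def
    by (intro CollectI exI[of _ "\<lambda>y. d y + (if y = z then e else 0)"]) auto
qed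

text \<open>Induction on the size of the support, which is finite and drops strictly with each
  column peeled off.\<close>

lemma D_cone_subset_cone_over_columns:
  assumes "finite Z" and "\<And>xs. xs \<noteq> [] \<Longrightarrow> sorted_wrt (<) xs \<Longrightarrow> set xs \<subseteq> {1..n} \<Longrightarrow>
    \<exists>z\<in>Z. A z = tableau_array (map (\<lambda>x. [x]) xs)"
  shows "D_cone n \<subseteq> cone_over Z A"
proof
  fix a assume "a \<in> D_cone n"
  then show "a \<in> cone_over Z A"
  proof (induction "card {(i, j). a i j \<noteq> 0}" arbitrary: a rule: less_induct)
    case less
    show ?case
    proof (cases "a = (\<lambda>i j. 0)")
      case True
      then show ?thesis by (auto simp: cone_over_def intro!: exI[of _ "\<lambda>_. 0"])
    next
      case False
      let ?b = "\<lambda>xs e i j. a i j - e * tableau_array (map (\<lambda>x. [x]) xs) i j"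
        obtain xs e where xs: "xs \<noteq> []" "sorted_wrt (<) xs" "set xs \<subseteq> {1..n}" "0 < e"
        and b: "?b xs e \<in> D_cone n"
        and sub: "{(i, j). ?b xs e i j \<noteq> 0} \<subset> {(i, j). a i j \<noteq> 0}"
        using D_cone_peel_column[OF less.prems False] by blast
      have "{(i, j). a i j \<noteq> 0} \<subseteq> {1..n} \<times> {1..n}"
        using less.prems unfolding D_cone_def by (clarsimp, meson dual_order.trans)
      then have "finite {(i, j). a i j \<noteq> 0}" by (rule finite_subset) simp
      then have "?b xs e \<in> cone_over Z A" using less.hyps[OF psubset_card_mono[OF _ sub] b] by simp
      moreover obtain z where z: "z \<in> Z" "A z = tableau_array (map (\<lambda>x. [x]) xs)"
        using assms(2) xs by blast
      ultimately show ?thesis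
        using cone_over_add_scaled[OF assms(1) _ z(1), of "?b xs e" A e] xs(4) z(2) by simp
    qed
  qed
qed

section \<open>Minors in the first columns\<close>

text \<open>The rows form a list that may be unsorted or contain repetitions, because such minors
  appear as terms of Pluecker relations.\<close>

definition row_minor :: "nat list \<Rightarrow> mpoly" where
  "row_minor xs = det (mat (length xs) (length xs) (\<lambda>(r, c). Var (xs ! r) (c + 1)))"

lemma flag_minor_set: "sorted_wrt (<) xs \<Longrightarrow> flag_minor (set xs) = row_minor xs"
  by (simp add: flag_minor_def row_minor_def strict_sorted_iff sorted_list_of_set.idem_if_sorted_distinct
      distinct_card)

lemma row_minor_swap:
  assumes "i < length xs" "j < length xs" "i \<noteq> j"
  shows "row_minor (xs[i := xs ! j, j := xs ! i]) = - row_minor xs"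
proof -
  let ?A = "mat (length xs) (length xs) (\<lambda>(r, c). Var (xs ! r) (c + 1))"
  have "mat (length xs) (length xs) (\<lambda>(r, c). Var (xs[i := xs ! j, j := xs ! i] ! r) (c + 1)) = swaprows i j ?A"
    using assms by (intro eq_matI) (auto simp: nth_list_update)
  then show ?thesis
    using det_swaprows[of i "length xs" j ?A] assms by (simp add: row_minor_def)
qed

text \<open>The hypothesis orients the equation: as a rewrite rule it sorts the rows and then
  stops.\<close>

lemma row_minor_2_swap: "a < b \<Longrightarrow> row_minor [b, a] = - row_minor [a, b]"
  using row_minor_swap[of 0 "[a, b]" 1] by simp

lemma row_minor_3_swap:
  "a < b \<Longrightarrow> row_minor [b, a, c] = - row_minor [a, b, c]"
  "b < c \<Longrightarrow> row_minor [a, c, b] = - row_minor [a, b, c]"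
  using row_minor_swap[of 0 "[a, b, c]" 1] row_minor_swap[of 1 "[a, b, c]" 2] by simp_all

lemma row_minor_repeat:
  assumes "i < length xs" "j < length xs" "i \<noteq> j" "xs ! i = xs ! j"
  shows "row_minor xs = 0"
  unfolding row_minor_def
  by (rule det_identical_rows[of _ "length xs" i j]) (use assms in auto)

lemma row_minor_2_repeat: "row_minor [a, a] = 0"
  using row_minor_repeat[of 0 "[a, a]" 1] by simp

lemma row_minor_3_repeat:
  "row_minor [a, a, b] = 0" "row_minor [a, b, a] = 0" "row_minor [b, a, a] = 0"
  using row_minor_repeat[of 0 "[a, a, b]" 1] row_minor_repeat[of 0 "[a, b, a]" 2]
    row_minor_repeat[of 1 "[b, a, a]" 2] by simp_all

text \<open>Laplace expansion along the last row. The point is that the coefficients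
  \<open>C\<close> do not depend on \<open>b\<close>.\<close>

lemma row_minor_expand_last:
  "\<exists>C. \<forall>b. row_minor (A @ [b]) = (\<Sum>j<Suc (length A). Var b (j + 1) * C j)"
proof -
  let ?s = "Suc (length A)"
  let ?M = "\<lambda>b. mat ?s ?s (\<lambda>(r, c). Var ((A @ [b]) ! r) (c + 1))"
  \<comment> \<open>Deleting the last row removes every occurrence of \<open>b\<close>.\<close>
  have "mat_delete (?M b) (length A) j = mat_delete (?M 0) (length A) j" for b j
    by (intro eq_matI) (auto simp: mat_delete_def nth_append)
  then have cof: "cofactor (?M b) (length A) j = cofactor (?M 0) (length A) j" for b j
    unfolding cofactor_def by metis
  have "row_minor (A @ [b]) = (\<Sum>j<?s. Var b (j + 1) * cofactor (?M 0) (length A) j)" for b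
    using laplace_expansion_row[of "?M b" ?s "length A"]
    unfolding cof[of b] by (simp add: row_minor_def del: sum.lessThan_Suc)
  then show ?thesis by blast
qed

text \<open>
  The sum is the expansion of a determinant with two equal columns along one of them.
\<close>

lemma row_minor_column_relation:
  assumes j: "Suc j < length B"
  shows "(\<Sum>k<length B. (-1) ^ k * Var (B ! k) (j + 1) * row_minor (take k B @ drop (Suc k) B)) = 0"
proof -
  have "B \<noteq> []" using j by auto
  let ?t = "length B"
  \<comment> \<open>Its columns are the generic columns \<open>j + 1\<close>, 1, ...,
    \<open>?t - 1\<close>. Since \<open>Suc j < ?t\<close>, the first one occurs again at position
    \<open>Suc j\<close>, while deleting it leaves the matrices of \<open>row_minor\<close>.\<close>
  let ?N = "mat ?t ?t (\<lambda>(r, c). Var (B ! r) (if c = 0 then j + 1 else c))"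
  have "cofactor ?N k 0 = (-1) ^ k * row_minor (take k B @ drop (Suc k) B)" if "k < ?t" for k
  proof -
    have "mat_delete ?N k 0 = mat (?t - 1) (?t - 1) (\<lambda>(r, c). Var ((take k B @ drop (Suc k) B) ! r) (c + 1))"
      using that by (intro eq_matI) (auto simp: mat_delete_def nth_append min_def)
    moreover have "length (take k B @ drop (Suc k) B) = ?t - 1" using that by simp
    ultimately show ?thesis by (simp add: cofactor_def row_minor_def)
  qed
  then have "det ?N = (\<Sum>k<?t. Var (B ! k) (j + 1) * ((-1) ^ k * row_minor (take k B @ drop (Suc k) B)))"
    using j \<open>B \<noteq> []\<close> by (subst laplace_expansion_column[of _ ?t 0]) (auto intro!: sum.cong)
  moreover have "det ?N = 0"
    by (rule det_identical_cols[of _ ?t 0 "Suc j"]) (use j \<open>B \<noteq> []\<close> in \<open>auto simp: col_def\<close>)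
  ultimately show ?thesis by (simp add: mult_ac)
qed

text \<open>The left side of the Pluecker relation that moves each row of \<open>B\<close> in turn
  over to \<open>A\<close>.\<close>

definition pluecker :: "nat list \<Rightarrow> nat list \<Rightarrow> mpoly" where
  "pluecker A B = (\<Sum>k<length B. (-1) ^ k * row_minor (A @ [B ! k]) * row_minor (take k B @ drop (Suc k) B))"

text \<open>The first factor is linear in the entries of the moved row, which come from columns up
  to \<open>length A + 1\<close>. The coefficient of each column is a multiple of the sum in
  \<open>row_minor_column_relation\<close>, which vanishes because \<open>B\<close> is longer than
  that.\<close>

lemma pluecker_eq_0:
  assumes "length A + 1 < length B"
  shows "pluecker A B = 0"
proof -
  obtain C where C: "row_minor (A @ [b]) = (\<Sum>j<Suc (length A). Var b (j + 1) * C j)" for b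
    using row_minor_expand_last by blast
  have "pluecker A B =
     (\<Sum>k<length B. \<Sum>j<Suc (length A). C j * ((-1) ^ k * Var (B ! k) (j + 1) * row_minor (take k B @ drop (Suc k) B)))"
    unfolding pluecker_def C by (simp only: sum_distrib_left sum_distrib_right mult_ac)
  also have "\<dots> = (\<Sum>j<Suc (length A). C j *
      (\<Sum>k<length B. (-1) ^ k * Var (B ! k) (j + 1) * row_minor (take k B @ drop (Suc k) B)))"
    by (subst sum.swap) (simp only: sum_distrib_left)
  also have "\<dots> = 0" using assms by (intro sum.neutral ballI) (subst row_minor_column_relation; simp)
  finally show ?thesis .
qed

section \<open>Evaluation at matrices and invariance under the unipotent group\<close>

definition eval_monom :: "monom \<Rightarrow> complex mat \<Rightarrow> complex" where
  "eval_monom m x = (\<Prod>(i, j)\<in>Poly_Mapping.keys m. x $$ (i - 1, j - 1) ^ Poly_Mapping.lookup m (i, j))"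

text \<open>Spreading the product over a common finite superset allows monomials with different
  supports to be combined; \<open>eval_mpoly_superset\<close> does the same for sums.\<close>

lemma eval_monom_superset:
  assumes "finite K" "Poly_Mapping.keys m \<subseteq> K"
  shows "eval_monom m x = (\<Prod>(i, j)\<in>K. x $$ (i - 1, j - 1) ^ Poly_Mapping.lookup m (i, j))"
  unfolding eval_monom_def using assms by (intro prod.mono_neutral_left) (auto simp: in_keys_iff)

lemma eval_monom_add: "eval_monom (m + m') x = eval_monom m x * eval_monom m' x"
proof -
  let ?K = "Poly_Mapping.keys m \<union> Poly_Mapping.keys m'"
  have "Poly_Mapping.keys (m + m') \<subseteq> ?K" by (rule Poly_Mapping.keys_add)
  then have "eval_monom (m + m') x = (\<Prod>(i, j)\<in>?K. x $$ (i - 1, j - 1) ^ Poly_Mapping.lookup (m + m') (i, j))"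
    by (intro eval_monom_superset) auto
  also have "\<dots> = (\<Prod>(i, j)\<in>?K. x $$ (i - 1, j - 1) ^ Poly_Mapping.lookup m (i, j)) *
      (\<Prod>(i, j)\<in>?K. x $$ (i - 1, j - 1) ^ Poly_Mapping.lookup m' (i, j))"
    unfolding prod.distrib[symmetric] by (intro prod.cong) (auto simp: lookup_add power_add)
  also have "\<dots> = eval_monom m x * eval_monom m' x"
    by (subst (1 2) eval_monom_superset[of ?K]) auto
  finally show ?thesis .
qed

lemma eval_mpoly_superset:
  assumes "finite K" "Poly_Mapping.keys p \<subseteq> K"
  shows "eval_mpoly p x = (\<Sum>m\<in>K. Poly_Mapping.lookup p m * eval_monom m x)"
  unfolding eval_mpoly_def eval_monom_def[symmetric]
  using assms by (intro sum.mono_neutral_left) (auto simp: in_keys_iff)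

lemma eval_mpoly_add: "eval_mpoly (p + q) x = eval_mpoly p x + eval_mpoly q x"
proof -
  let ?K = "Poly_Mapping.keys p \<union> Poly_Mapping.keys q"
  have "Poly_Mapping.keys (p + q) \<subseteq> ?K" by (rule Poly_Mapping.keys_add)
  then have "eval_mpoly (p + q) x = (\<Sum>m\<in>?K. Poly_Mapping.lookup (p + q) m * eval_monom m x)"
    by (intro eval_mpoly_superset) auto
  also have "\<dots> = (\<Sum>m\<in>?K. Poly_Mapping.lookup p m * eval_monom m x) + (\<Sum>m\<in>?K. Poly_Mapping.lookup q m * eval_monom m x)"
    by (simp add: lookup_add distrib_right sum.distrib)
  also have "\<dots> = eval_mpoly p x + eval_mpoly q x"
    by (subst (1 2) eval_mpoly_superset[of ?K]) auto
  finally show ?thesis .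
qed

lemma eval_mpoly_single: "eval_mpoly (Poly_Mapping.single m c) x = c * eval_monom m x"
  by (simp add: eval_mpoly_superset[of "{m}"])

lemma eval_mpoly_zero: "eval_mpoly 0 x = 0"
  by (simp add: eval_mpoly_def)

lemma eval_mpoly_sum: "eval_mpoly (\<Sum>a\<in>A. f a) x = (\<Sum>a\<in>A. eval_mpoly (f a) x)"
  by (induction A rule: infinite_finite_induct) (simp_all add: eval_mpoly_add eval_mpoly_zero)

lemma mpoly_sum_single:
  fixes p :: mpoly
  shows "p = (\<Sum>m\<in>Poly_Mapping.keys p. Poly_Mapping.single m (Poly_Mapping.lookup p m))"
proof (rule poly_mapping_eqI)
  fix k
  have "Poly_Mapping.lookup (\<Sum>m\<in>Poly_Mapping.keys p. Poly_Mapping.single m (Poly_Mapping.lookup p m)) k =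
     (\<Sum>m\<in>Poly_Mapping.keys p. if m = k then Poly_Mapping.lookup p m else 0)"
    by (simp add: lookup_sum lookup_single when_def)
  also have "\<dots> = Poly_Mapping.lookup p k" by (simp add: sum.delta in_keys_iff)
  finally show "Poly_Mapping.lookup p k = Poly_Mapping.lookup (\<Sum>m\<in>Poly_Mapping.keys p. Poly_Mapping.single m (Poly_Mapping.lookup p m)) k" ..
qed

lemma eval_mpoly_mult: "eval_mpoly (p * q) x = eval_mpoly p x * eval_mpoly q x"
proof -
  have "p * q = (\<Sum>m\<in>Poly_Mapping.keys p. \<Sum>m'\<in>Poly_Mapping.keys q.
      Poly_Mapping.single (m + m') (Poly_Mapping.lookup p m * Poly_Mapping.lookup q m'))"
    by (subst mpoly_sum_single[of p], subst mpoly_sum_single[of q]) (simp add: sum_product mult_single)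
  then have "eval_mpoly (p * q) x = (\<Sum>m\<in>Poly_Mapping.keys p. \<Sum>m'\<in>Poly_Mapping.keys q.
      (Poly_Mapping.lookup p m * eval_monom m x) * (Poly_Mapping.lookup q m' * eval_monom m' x))"
    by (simp add: eval_mpoly_sum eval_mpoly_single eval_monom_add mult_ac)
  also have "\<dots> = eval_mpoly p x * eval_mpoly q x"
    by (simp add: sum_product eval_mpoly_superset[of "Poly_Mapping.keys p" p]
        eval_mpoly_superset[of "Poly_Mapping.keys q" q])
  finally show ?thesis .
qed

lemma comm_ring_hom_eval_mpoly: "comm_ring_hom (\<lambda>p. eval_mpoly p x)"
proof -
  have "eval_mpoly 1 x = 1" using eval_mpoly_single[of 0 1 x] by (simp add: eval_monom_def)
  then show ?thesis by unfold_locales (simp_all add: eval_mpoly_add eval_mpoly_mult eval_mpoly_zero)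
qed

lemma eval_mpoly_Var: "eval_mpoly (Var i j) x = x $$ (i - 1, j - 1)"
  unfolding Var_def eval_mpoly_single by (simp add: eval_monom_def)

lemma eval_row_minor:
  "eval_mpoly (row_minor xs) x = det (mat (length xs) (length xs) (\<lambda>(r, c). x $$ (xs ! r - 1, c)))"
proof -
  interpret comm_ring_hom "\<lambda>p. eval_mpoly p x" by (rule comm_ring_hom_eval_mpoly)
  have "map_mat (\<lambda>p. eval_mpoly p x) (mat (length xs) (length xs) (\<lambda>(r, c). Var (xs ! r) (c + 1))) =
      mat (length xs) (length xs) (\<lambda>(r, c). x $$ (xs ! r - 1, c))"
    by (intro eq_matI) (auto simp: eval_mpoly_Var)
  then show ?thesis unfolding row_minor_def hom_det[symmetric] by simp
qed

text \<open>Restricted to the first \<open>length xs\<close> columns, multiplication by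
  \<open>u\<close> is multiplication by its leading block \<open>?U\<close>, a unitriangular matrix
  of determinant 1.\<close>

lemma eval_row_minor_unipotent:
  assumes x: "x \<in> carrier_mat n n" and u: "u \<in> unipotent_upper n"
    and xs: "set xs \<subseteq> {1..n}" "length xs \<le> n"
  shows "eval_mpoly (row_minor xs) (x * u) = eval_mpoly (row_minor xs) x"
proof -
  let ?k = "length xs"
  let ?X = "mat ?k ?k (\<lambda>(r, c). x $$ (xs ! r - 1, c))" and ?U = "mat ?k ?k (\<lambda>(r, c). u $$ (r, c))"
  have u': "u \<in> carrier_mat n n" "\<And>i j. j < i \<Longrightarrow> i < n \<Longrightarrow> u $$ (i, j) = 0" "\<And>i. i < n \<Longrightarrow> u $$ (i, i) = 1"
    using u by (auto simp: unipotent_upper_def)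
  have "mat ?k ?k (\<lambda>(r, c). (x * u) $$ (xs ! r - 1, c)) = ?X * ?U"
  proof (rule eq_matI)
    fix r c assume "r < dim_row (?X * ?U)" "c < dim_col (?X * ?U)"
    then have rc: "r < ?k" "c < ?k" by auto
    have "xs ! r \<in> {1..n}" using xs(1) rc by (meson nth_mem subsetD)
    then have "(x * u) $$ (xs ! r - 1, c) = (\<Sum>l = 0..<n. x $$ (xs ! r - 1, l) * u $$ (l, c))"
      using x u'(1) rc xs(2) by (auto simp: scalar_prod_def)
    \<comment> \<open>Entries of \<open>u\<close> below the diagonal vanish, so a column
      \<open>c < ?k\<close> involves no later column of \<open>x\<close>.\<close>
    also have "\<dots> = (\<Sum>l = 0..<?k. x $$ (xs ! r - 1, l) * u $$ (l, c))"
      using u'(2) rc xs(2) by (intro sum.mono_neutral_right) auto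
    also have "\<dots> = (?X * ?U) $$ (r, c)" using rc by (simp add: scalar_prod_def)
    finally show "mat ?k ?k (\<lambda>(r, c). (x * u) $$ (xs ! r - 1, c)) $$ (r, c) = (?X * ?U) $$ (r, c)"
      using rc by simp
  qed auto
  moreover have "det ?U = 1"
  proof -
    have "upper_triangular ?U" using u'(2) xs(2) by (intro upper_triangularI) auto
    then have "det ?U = prod_list (diag_mat ?U)" by (rule det_upper_triangular) auto
    also have "diag_mat ?U = replicate ?k 1"
      using u'(3) xs(2) by (auto simp: diag_mat_def intro!: nth_equalityI)
    finally show ?thesis by simp
  qed
  ultimately show ?thesis unfolding eval_row_minor by (simp add: det_mult[of _ ?k])
qed

lemma matrix_polys_intros:
  "p \<in> matrix_polys n \<Longrightarrow> q \<in> matrix_polys n \<Longrightarrow> p + q \<in> matrix_polys n"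
  "p \<in> matrix_polys n \<Longrightarrow> q \<in> matrix_polys n \<Longrightarrow> p * q \<in> matrix_polys n"
  "of_int c \<in> matrix_polys n"
  "i \<in> {1..n} \<Longrightarrow> j \<in> {1..n} \<Longrightarrow> Var i j \<in> matrix_polys n"
proof -
  show "p + q \<in> matrix_polys n" if "p \<in> matrix_polys n" "q \<in> matrix_polys n"
    using that Poly_Mapping.keys_add[of p q] unfolding matrix_polys_def by blast
  show "p * q \<in> matrix_polys n" if "p \<in> matrix_polys n" "q \<in> matrix_polys n"
  proof -
    have "Poly_Mapping.keys m \<subseteq> {1..n} \<times> {1..n}" if m: "m \<in> Poly_Mapping.keys (p * q)" for m
    proof -
      obtain a b where "m = a + b" "a \<in> Poly_Mapping.keys p" "b \<in> Poly_Mapping.keys q"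
        using keys_mult[of p q] m by blast
      then show ?thesis using \<open>p \<in> _\<close> \<open>q \<in> _\<close> Poly_Mapping.keys_add[of a b] unfolding matrix_polys_def by blast
    qed
    then show ?thesis by (auto simp: matrix_polys_def)
  qed
  show "of_int c \<in> matrix_polys n"
    unfolding single_of_int[symmetric]
    by (auto simp: matrix_polys_def simp del: single_of_int split: if_splits)
  show "i \<in> {1..n} \<Longrightarrow> j \<in> {1..n} \<Longrightarrow> Var i j \<in> matrix_polys n"
    by (auto simp: matrix_polys_def Var_def)
qed

lemma matrix_polys_sum: "(\<And>a. a \<in> A \<Longrightarrow> f a \<in> matrix_polys n) \<Longrightarrow> (\<Sum>a\<in>A. f a) \<in> matrix_polys n"
  using matrix_polys_intros(1)[of _ n] matrix_polys_intros(3)[of 0 n]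
  by (induction A rule: infinite_finite_induct) auto

lemma matrix_polys_prod: "(\<And>a. a \<in> A \<Longrightarrow> f a \<in> matrix_polys n) \<Longrightarrow> (\<Prod>a\<in>A. f a) \<in> matrix_polys n"
  using matrix_polys_intros(2)[of _ n] matrix_polys_intros(3)[of 1 n]
  by (induction A rule: infinite_finite_induct) auto

lemma row_minor_in_matrix_polys:
  assumes "set xs \<subseteq> {1..n}" "length xs \<le> n"
  shows "row_minor xs \<in> matrix_polys n"
proof -
  have "(signof p :: mpoly) \<in> matrix_polys n" for p :: "nat \<Rightarrow> nat"
    using matrix_polys_intros(3)[of "sign p" n] by simp
  moreover have "Var (xs ! i) (p i + 1) \<in> matrix_polys n"
    if "p permutes {0..<length xs}" "i < length xs" for p i
  proof (rule matrix_polys_intros(4))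
    show "xs ! i \<in> {1..n}" using assms(1) that(2) by (meson nth_mem subsetD)
    show "p i + 1 \<in> {1..n}" using permutes_in_image[OF that(1), of i] that(2) assms(2) by simp
  qed
  ultimately show ?thesis
    unfolding row_minor_def det_def
    by (auto intro!: matrix_polys_sum matrix_polys_intros(2) matrix_polys_prod)
qed

lemma row_minor_in_invariant_polys:
  assumes "set xs \<subseteq> {1..n}" "length xs \<le> n"
  shows "row_minor xs \<in> invariant_polys n"
  using assms row_minor_in_matrix_polys eval_row_minor_unipotent by (simp add: invariant_polys_def)

lemma invariant_polys_intros:
  "p \<in> invariant_polys n \<Longrightarrow> q \<in> invariant_polys n \<Longrightarrow> p + q \<in> invariant_polys n"
  "p \<in> invariant_polys n \<Longrightarrow> q \<in> invariant_polys n \<Longrightarrow> p * q \<in> invariant_polys n"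
  "of_int c \<in> invariant_polys n"
proof -
  show "of_int c \<in> invariant_polys n"
  proof -
    have "eval_mpoly (of_int c) x = of_int c" for x
      by (rule ring_hom.hom_of_int) (rule comm_ring_hom.axioms(1)[OF comm_ring_hom_eval_mpoly])
    then show ?thesis by (simp add: invariant_polys_def matrix_polys_intros)
  qed
qed (auto simp: invariant_polys_def matrix_polys_intros eval_mpoly_add eval_mpoly_mult)

section \<open>Leading monomials of minors and of their products\<close>

definition monic_at :: "monom \<Rightarrow> mpoly \<Rightarrow> bool" where
  "monic_at m p \<longleftrightarrow> Poly_Mapping.lookup p m = 1 \<and> (\<forall>k\<in>Poly_Mapping.keys p. k \<le> m)"

lemma monic_at_nonzero: "monic_at m p \<Longrightarrow> p \<noteq> 0"
  by (auto simp: monic_at_def)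

lemma lead_monom_monic_at:
  assumes "monic_at m p"
  shows "lead_monom p = m"
  unfolding lead_monom_def using assms by (intro Max_eqI) (auto simp: monic_at_def in_keys_iff)

lemma monic_at_single: "monic_at m (Poly_Mapping.single m 1)"
  by (auto simp: monic_at_def)

lemma monic_at_decompose:
  assumes "monic_at m p"
  obtains p' where "p = Poly_Mapping.single m 1 + p'" "\<And>k. k \<in> Poly_Mapping.keys p' \<Longrightarrow> k < m"
proof
  show "p = Poly_Mapping.single m 1 + (p - Poly_Mapping.single m 1)" by simp
  fix k assume k: "k \<in> Poly_Mapping.keys (p - Poly_Mapping.single m 1)"
  have "k \<noteq> m" using k assms by (auto simp: monic_at_def in_keys_iff lookup_minus)
  moreover have "k \<in> Poly_Mapping.keys p"
    using k \<open>k \<noteq> m\<close> by (auto simp: in_keys_iff lookup_minus lookup_single)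
  ultimately show "k < m" using assms by (auto simp: monic_at_def)
qed

lemma monic_at_add:
  assumes "monic_at m p" "\<And>k. k \<in> Poly_Mapping.keys q \<Longrightarrow> k < m"
  shows "monic_at m (p + q)"
proof -
  have "Poly_Mapping.lookup q m = 0" using assms(2)[of m] by (auto simp: in_keys_iff)
  then show ?thesis
    using assms Poly_Mapping.keys_add[of p q] by (fastforce simp: monic_at_def lookup_add)
qed

lemma keys_mult_less:
  fixes p q :: mpoly
  assumes "\<And>k. k \<in> Poly_Mapping.keys p \<Longrightarrow> k \<le> m" "\<And>k. k \<in> Poly_Mapping.keys q \<Longrightarrow> k < m'"
    and k: "k \<in> Poly_Mapping.keys (p * q)"
  shows "k < m + m'"
proof -
  obtain a b where "k = a + b" "a \<in> Poly_Mapping.keys p" "b \<in> Poly_Mapping.keys q"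
    using keys_mult[of p q] k by blast
  then show ?thesis using assms(1,2) by (simp add: add_le_less_mono)
qed

text \<open>The monomial order is compatible with addition, so once the leading terms are split off,
  every other product is strictly smaller than \<open>m + m'\<close>.\<close>

lemma monic_at_mult:
  assumes "monic_at m p" "monic_at m' q"
  shows "monic_at (m + m') (p * q)"
proof -
  obtain p' where p': "p = Poly_Mapping.single m 1 + p'" "\<And>k. k \<in> Poly_Mapping.keys p' \<Longrightarrow> k < m"
    using monic_at_decompose[OF assms(1)] by blast
  obtain q' where q': "q = Poly_Mapping.single m' 1 + q'" "\<And>k. k \<in> Poly_Mapping.keys q' \<Longrightarrow> k < m'"
    using monic_at_decompose[OF assms(2)] by blast
  have "p * q = Poly_Mapping.single (m + m') 1 + (p * q' + Poly_Mapping.single m' 1 * p')"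
    by (simp add: p'(1) q'(1) algebra_simps mult_single)
  moreover have "k < m + m'" if "k \<in> Poly_Mapping.keys (p * q' + Poly_Mapping.single m' 1 * p')" for k
  proof -
    have "k \<in> Poly_Mapping.keys (p * q') \<or> k \<in> Poly_Mapping.keys (Poly_Mapping.single m' 1 * p')"
      using that Poly_Mapping.keys_add[of "p * q'" "Poly_Mapping.single m' 1 * p'"] by blast
    then show ?thesis
      using keys_mult_less[of p m q' m' k] keys_mult_less[of "Poly_Mapping.single m' 1" m' p' m k] assms(1) p'(2) q'(2)
      by (auto simp: monic_at_def add.commute)
  qed
  ultimately show ?thesis using monic_at_add[OF monic_at_single] by metis
qed

text \<open>The product of the diagonal entries of the matrix behind \<open>row_minor xs\<close>,
  its leading monomial when the rows increase.\<close>

definition diagonal_monom :: "nat list \<Rightarrow> monom" where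
  "diagonal_monom xs = (\<Sum>i<length xs. Poly_Mapping.single (xs ! i, i + 1) 1)"

lemma lookup_diagonal_monom:
  "Poly_Mapping.lookup (diagonal_monom xs) (a, b) = of_bool (1 \<le> b \<and> b \<le> length xs \<and> xs ! (b - 1) = a)"
proof -
  have "Poly_Mapping.lookup (diagonal_monom xs) (a, b) =
      (\<Sum>i<length xs. if b = Suc i then of_bool (xs ! i = a) else 0)"
    unfolding diagonal_monom_def lookup_sum lookup_single when_def by (intro sum.cong) auto
  also have "\<dots> = of_bool (1 \<le> b \<and> b \<le> length xs \<and> xs ! (b - 1) = a)"
    by (cases b) (auto simp: sum.delta)
  finally show ?thesis .
qed

lemma Var_prod_eq_single:
  "(\<Prod>i\<in>A. Var (f i) (g i)) = Poly_Mapping.single (\<Sum>i\<in>A. Poly_Mapping.single (f i, g i) 1) 1"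
  by (induction A rule: infinite_finite_induct) (simp_all add: Var_def mult_single)

text \<open>
  At the first row \<open>r\<close> moved by \<open>p\<close>, the diagonal monomial has the variable in column \<open>r + 1\<close> and
  the monomial of \<open>p\<close> only a later, hence smaller, variable.
\<close>

lemma permutation_monom_less:
  assumes xs: "sorted_wrt (<) xs" and p: "p permutes {0..<length xs}" "p \<noteq> id"
  shows "(\<Sum>i = 0..<length xs. Poly_Mapping.single (xs ! i, p i + 1) (1::nat)) < diagonal_monom xs"
proof -
  define r where "r = (LEAST i. p i \<noteq> i)"
  have "\<exists>i. p i \<noteq> i" using p(2) by auto
  then have r: "p r \<noteq> r" unfolding r_def by (rule LeastI_ex)
  have below: "p i = i" if "i < r" for i using not_less_Least[of i "\<lambda>i. p i \<noteq> i"] that by (auto simp: r_def)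
  have r_lt: "r < length xs" using r permutes_not_in[OF p(1), of r] by fastforce
  \<comment> \<open>\<open>p\<close> fixes everything below \<open>r\<close> and is injective, so it
    can only move \<open>r\<close> upwards.\<close>
  have pr: "r < p r"
  proof (rule ccontr)
    assume "\<not> r < p r"
    then have "p (p r) = p r" using r below[of "p r"] by simp
    then show False using r permutes_inj[OF p(1)] by (metis injD)
  qed
  let ?m = "\<Sum>i = 0..<length xs. Poly_Mapping.single (xs ! i, p i + 1) (1::nat)"
  have lk: "Poly_Mapping.lookup ?m k = (\<Sum>i = 0..<length xs. if (xs ! i, p i + 1) = k then 1 else 0)" for k
    by (simp add: lookup_sum lookup_single when_def del: One_nat_def)
  have dk: "Poly_Mapping.lookup (diagonal_monom xs) k = (\<Sum>i = 0..<length xs. if (xs ! i, i + 1) = k then 1 else 0)" for k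
    by (simp add: diagonal_monom_def lookup_sum lookup_single when_def atLeast0LessThan del: One_nat_def)
  have mono: "xs ! i < xs ! j \<longleftrightarrow> i < j" if "i < length xs" "j < length xs" for i j
    using xs that by (metis linorder_neqE_nat order_less_asym sorted_wrt_nth_less)
  have inj: "xs ! i = xs ! j \<longleftrightarrow> i = j" if "i < length xs" "j < length xs" for i j
    using mono[OF that] mono[OF that(2,1)] by (metis less_irrefl linorder_neqE_nat)
  have "Poly_Mapping.lookup ?m (xs ! r, r + 1) = 0"
    unfolding lk using pr r_lt inj by (intro sum.neutral) auto
  moreover have "Poly_Mapping.lookup (diagonal_monom xs) (xs ! r, r + 1) = 1"
    using r_lt by (simp add: lookup_diagonal_monom)
  \<comment> \<open>Before \<open>(xs ! r, r + 1)\<close> only rows \<open>xs ! i\<close> with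
    \<open>i < r\<close> contribute, and \<open>p\<close> fixes these \<open>i\<close>.\<close>
  moreover have "Poly_Mapping.lookup ?m k = Poly_Mapping.lookup (diagonal_monom xs) k"
    if k: "k < (xs ! r, r + 1)" for k
    unfolding lk dk
  proof (intro sum.cong refl)
    fix i assume i: "i \<in> {0..<length xs}"
    obtain a b where ab: "k = (a, b)" by (cases k)
    show "(if (xs ! i, p i + 1) = k then 1 else 0) = (if (xs ! i, i + 1) = k then 1 else (0::nat))"
      using k i below[of i] pr mono[of i r] inj[of i r] r_lt
      by (cases "i < r"; cases "i = r") (auto simp: ab less_prod_def')
  qed
  ultimately have "less_fun (Poly_Mapping.lookup ?m) (Poly_Mapping.lookup (diagonal_monom xs))"
    unfolding less_fun_def by (intro exI[of _ "(xs ! r, r + 1)"]) simp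
  then show ?thesis by (simp add: less_poly_mapping.rep_eq)
qed

text \<open>In the Leibniz formula the identity contributes the diagonal monomial with coefficient
  1, and every other permutation a smaller monomial.\<close>

lemma monic_at_row_minor:
  assumes xs: "sorted_wrt (<) xs"
  shows "monic_at (diagonal_monom xs) (row_minor xs)"
proof -
  let ?P = "{p. p permutes {0..<length xs}}"
  define t :: "(nat \<Rightarrow> nat) \<Rightarrow> mpoly" where
    "t p = signof p * Poly_Mapping.single (\<Sum>i = 0..<length xs. Poly_Mapping.single (xs ! i, p i + 1) 1) 1" for p
  have fin: "finite ?P" by (rule finite_permutations) simp
  have "row_minor xs = (\<Sum>p\<in>?P. t p)"
    unfolding row_minor_def det_def t_def Var_prod_eq_single[symmetric]
    by (auto intro!: sum.cong prod.cong)
  also have "\<dots> = t id + (\<Sum>p\<in>?P - {id}. t p)"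
    using fin permutes_id by (intro sum.remove) auto
  also have "t id = Poly_Mapping.single (diagonal_monom xs) 1"
    by (simp add: t_def diagonal_monom_def atLeast0LessThan)
  also have "monic_at (diagonal_monom xs) (Poly_Mapping.single (diagonal_monom xs) 1 + (\<Sum>p\<in>?P - {id}. t p))"
  proof (rule monic_at_add[OF monic_at_single])
    fix k assume "k \<in> Poly_Mapping.keys (\<Sum>p\<in>?P - {id}. t p)"
    then obtain p where p: "p \<in> ?P - {id}" "k \<in> Poly_Mapping.keys (t p)"
      using Poly_Mapping.keys_sum[of t "?P - {id}"] by blast
    then have "k = (\<Sum>i = 0..<length xs. Poly_Mapping.single (xs ! i, p i + 1) 1)"
      by (auto simp: t_def sign_def split: if_splits)
    then show "k < diagonal_monom xs" using permutation_monom_less[OF xs, of p] p(1) by simp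
  qed
  finally show ?thesis .
qed

section \<open>The cluster variables and their labels\<close>

text \<open>Lists in place of the sets of \<open>column\<close>, so that the simplifier can compute
  them from the table.\<close>

definition columns :: "tableau \<Rightarrow> nat list list" where
  "columns T = map (\<lambda>c. map (\<lambda>R. R ! c) (filter (\<lambda>R. c < length R) T)) [0..<num_columns T]"

lemma column_eq_set_columns: "c < num_columns T \<Longrightarrow> column T c = set (columns T ! c)"
  by (auto simp: column_def columns_def in_set_conv_nth)

lemma prod_list_map_upt: "prod_list (map f [0..<k]) = (\<Prod>c<k. f c)"
  by (induction k) (simp_all add: mult.commute)

lemma tableau_minor_eq_columns:
  assumes "\<forall>xs\<in>set (columns T). sorted_wrt (<) xs"
  shows "tableau_minor T = prod_list (map row_minor (columns T))"
proof -
  have len: "length (columns T) = num_columns T" by (simp add: columns_def)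
  have "tableau_minor T = (\<Prod>c<num_columns T. row_minor (columns T ! c))"
    unfolding tableau_minor_def using assms len
    by (intro prod.cong) (auto simp: column_eq_set_columns flag_minor_set)
  also have "\<dots> = prod_list (map row_minor (map ((!) (columns T)) [0..<num_columns T]))"
    by (simp add: prod_list_map_upt[symmetric] comp_def)
  also have "map ((!) (columns T)) [0..<num_columns T] = columns T"
    unfolding len[symmetric] by (rule map_nth)
  finally show ?thesis .
qed

lemma monic_at_row_minors:
  "\<forall>xs\<in>set cs. sorted_wrt (<) xs \<Longrightarrow>
    monic_at (sum_list (map diagonal_monom cs)) (prod_list (map row_minor cs))"
proof (induction cs)
  case Nil
  then show ?case using monic_at_single[of 0] by simp
qed (auto intro: monic_at_mult monic_at_row_minor)

lemma row_minors_in_invariant_polys: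
  assumes "\<forall>xs\<in>set cs. sorted_wrt (<) xs \<and> set xs \<subseteq> {1..n}"
  shows "prod_list (map row_minor cs) \<in> invariant_polys n"
  using assms
proof (induction cs)
  case Nil
  then show ?case using invariant_polys_intros(3)[of 1 n] by simp
next
  case (Cons xs cs)
  have "distinct xs" using Cons.prems by (simp add: strict_sorted_iff)
  then have "length xs \<le> n"
    using Cons.prems card_mono[of "{1..n}" "set xs"] by (simp add: distinct_card)
  then show ?case using Cons by (auto intro!: invariant_polys_intros(2) row_minor_in_invariant_polys)
qed

text \<open>The exponent of the variable \<open>(a, b)\<close> in the product of the diagonal
  monomials of \<open>cs\<close>, in a form that can be evaluated.\<close>

definition exponent :: "nat list list \<Rightarrow> nat \<Rightarrow> nat \<Rightarrow> nat" where
  "exponent cs a b = length (filter (\<lambda>xs. 1 \<le> b \<and> b \<le> length xs \<and> xs ! (b - 1) = a) cs)"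

lemma lookup_sum_diagonal_monom:
  "Poly_Mapping.lookup (sum_list (map diagonal_monom cs)) (a, b) = exponent cs a b"
  by (induction cs) (auto simp: exponent_def lookup_add lookup_diagonal_monom)

text \<open>A finite certificate for a lexicographic comparison whose first difference is at
  \<open>(a, b)\<close>. Columns from 6 on are left out because minors with at most five rows do not
  reach them.\<close>

definition lower_at :: "nat list list \<Rightarrow> nat list list \<Rightarrow> nat \<Rightarrow> nat \<Rightarrow> bool" where
  "lower_at cs ds a b \<longleftrightarrow> exponent cs a b < exponent ds a b \<and>
    list_all (\<lambda>i. list_all (\<lambda>j. i = a \<and> b \<le> j \<or> exponent cs i j = exponent ds i j) [0..<6]) [0..<Suc a]"

lemma lower_at_imp_less:
  assumes "lower_at cs ds a b" and len: "\<forall>xs\<in>set cs \<union> set ds. length xs \<le> 5"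
  shows "sum_list (map diagonal_monom cs) < sum_list (map diagonal_monom ds)"
proof -
  have "exponent cs i j = exponent ds i j" if "(i, j) < (a, b)" for i j
  proof (cases "j < 6")
    case True
    have "i < Suc a" "\<not> (i = a \<and> b \<le> j)" using that by (auto simp: less_prod_def')
    then show ?thesis using assms(1) True by (cases "i = a") (auto simp: lower_at_def list_all_iff)
  next
    case False
    then have "\<not> j \<le> length xs" if "xs \<in> set cs \<union> set ds" for xs
      using bspec[OF len that] False by simp
    then have "exponent cs i j = 0" "exponent ds i j = 0"
      by (auto simp: exponent_def filter_empty_conv)
    then show ?thesis by simp
  qed
  then have "less_fun (Poly_Mapping.lookup (sum_list (map diagonal_monom cs)))
      (Poly_Mapping.lookup (sum_list (map diagonal_monom ds)))"
    unfolding less_fun_def using assms(1)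
    by (intro exI[of _ "(a, b)"]) (auto simp: lookup_sum_diagonal_monom lower_at_def)
  then show ?thesis by (simp add: less_poly_mapping.rep_eq)
qed

text \<open>The condition on adjacent rows from \<open>ssyt\<close>, as a recursion that the
  simplifier can run.\<close>

fun column_strict :: "tableau \<Rightarrow> bool" where
  "column_strict (R # S # T) \<longleftrightarrow>
     length S \<le> length R \<and> list_all (\<lambda>(x, y). x < y) (zip R S) \<and> column_strict (S # T)"
| "column_strict _ \<longleftrightarrow> True"

lemma column_strictD:
  "column_strict T \<Longrightarrow> Suc r < length T \<Longrightarrow>
    length (T ! Suc r) \<le> length (T ! r) \<and> (\<forall>c < length (T ! Suc r). T ! r ! c < T ! Suc r ! c)"
proof (induction T arbitrary: r rule: column_strict.induct)
  case (1 R S T)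
  then show ?case by (cases r) (auto simp: list_all_length)
qed auto

lemma ssyt_iff_column_strict:
  assumes "column_strict T" "\<forall>R\<in>set T. R \<noteq> [] \<and> sorted R" "set (concat T) \<subseteq> {1..n}"
  shows "ssyt n T"
  using assms column_strictD[OF assms(1)] by (auto simp: ssyt_def)

text \<open>
  An entry \<open>(T, rest)\<close> stands for the polynomial with label \<open>T\<close> whose further terms are listed in
  \<open>rest\<close>: a coefficient, the columns of a product of flag minors, and the position \<open>(a, b)\<close> of the
  largest variable whose exponent in the leading monomial is smaller than for \<open>T\<close>.
\<close>

definition cluster_table :: "(tableau \<times> (int \<times> nat list list \<times> nat \<times> nat) list) list" where
  "cluster_table =
    [([[1, 2], [3, 4], [5]], [(- 1, [[1, 3, 4], [2, 5]], 4, 2), (- 1, [[1, 2, 5], [3, 4]], 2, 1), (1, [[1, 2, 4], [3, 5]], 2, 1), (- 2, [[1, 2, 3], [4, 5]], 2, 1)]),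
     ([[1, 4], [3], [5]], [(- 1, [[1, 3, 4], [5]], 4, 1)]),
     ([[2, 4], [3], [5]], [(- 1, [[2, 3, 4], [5]], 4, 1)]),
     ([[1, 3], [2, 4], [4], [5]], [(- 1, [[1, 2, 3, 4], [4, 5]], 3, 1)]),
     ([[1, 3], [2], [5]], [(- 1, [[1, 2, 3], [5]], 3, 1)]),
     ([[1, 2], [2, 4], [3], [5]], [(- 1, [[1, 2, 3, 4], [2, 5]], 4, 2)]),
     ([[1, 3], [2, 5], [4]], [(- 1, [[1, 2, 3], [4, 5]], 3, 1)]),
     ([[2], [4]], []),
     ([[1, 3], [2], [4]], [(- 1, [[1, 2, 3], [4]], 3, 1)]),
     ([[1], [4]], []),
     ([[2], [3]], []),
     ([[3], [4]], []),
     ([[3]], []),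
     ([[1], [3]], []),
     ([[1, 3], [2, 4], [3], [5]], [(- 1, [[1, 2, 3, 4], [3, 5]], 4, 2)]),
     ([[4]], []),
     ([[2]], []),
     ([[2], [3], [4]], []),
     ([[1, 4], [2], [3], [5]], [(- 1, [[1, 2, 3, 4], [5]], 4, 1)]),
     ([[1, 1], [2, 4], [3], [5]], [(- 1, [[1, 2, 3, 4], [1, 5]], 4, 2)]),
     ([[1, 3], [2], [4], [5]], [(- 1, [[1, 2, 3, 5], [4]], 3, 1), (1, [[1, 2, 3, 4], [5]], 3, 1)]),
     ([[3], [5]], []),
     ([[2], [3], [5]], []),
     ([[2], [5]], []),
     ([[2], [4], [5]], []),
     ([[1], [3], [4]], []),
     ([[1, 4], [2], [5]], [(- 1, [[1, 2, 4], [5]], 4, 1)]),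
     ([[1], [3], [5]], []),
     ([[1], [2], [3], [5]], []),
     ([[1, 3], [2, 5], [4], [5]], [(- 1, [[1, 2, 3, 5], [4, 5]], 3, 1)]),
     ([[1], [2], [5]], []),
     ([[1], [4], [5]], []),
     ([[1], [2], [4], [5]], []),
     ([[1], [5]], []),
     ([[1], [3], [4], [5]], []),
     ([[1], [2], [4]], []),
     ([[1]], []),
     ([[1], [2]], []),
     ([[1], [2], [3]], []),
     ([[1], [2], [3], [4]], []),
     ([[1], [2], [3], [4], [5]], []),
     ([[2], [3], [4], [5]], []),
     ([[3], [4], [5]], []),
     ([[4], [5]], []),
     ([[5]], [])]"

definition label :: "nat \<Rightarrow> tableau" where
  "label z = fst (cluster_table ! z)"

definition lower_terms :: "nat \<Rightarrow> mpoly" where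
  "lower_terms z = (\<Sum>(c, cs, _)\<leftarrow>snd (cluster_table ! z). of_int c * prod_list (map row_minor cs))"

definition cluster_poly :: "nat \<Rightarrow> mpoly" where
  "cluster_poly z = prod_list (map row_minor (columns (label z))) + lower_terms z"

text \<open>Besides the shape of the label and the order certificates, it requires the rows of all
  lower terms to be entries of the label. This makes one table usable for every alphabet containing
  the label.\<close>

definition table_entry_ok where
  "table_entry_ok = (\<lambda>(T, rest). column_strict T \<and> list_all (\<lambda>R. R \<noteq> [] \<and> sorted R) T \<and>
     list_all (\<lambda>x. 1 \<le> x \<and> x \<le> 5) (concat T) \<and>
     list_all (sorted_wrt (<)) (columns T) \<and> list_all (\<lambda>xs. length xs \<le> 5) (columns T) \<and>
     list_all (\<lambda>(c :: int, cs, a, b). list_all (sorted_wrt (<)) cs \<and> list_all (\<lambda>xs. length xs \<le> 5) cs \<and>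
       list_all (\<lambda>x. x \<in> set (concat T)) (concat cs) \<and> lower_at cs (columns T) a b) rest)"

lemma cluster_table_ok: "list_all table_entry_ok cluster_table"
  by (simp add: cluster_table_def table_entry_ok_def columns_def num_columns_def lower_at_def
      exponent_def upt_conv_Cons upt_conv_Nil)

lemma cluster_poly_simps:
  "cluster_poly 0 = row_minor [1,3,5] * row_minor [2,4] - 2 * row_minor [1,2,3] * row_minor [4,5] + row_minor [1,2,4] * row_minor [3,5] - row_minor [1,2,5] * row_minor [3,4] - row_minor [1,3,4] * row_minor [2,5]"
  "cluster_poly 1 = row_minor [1,3,5] * row_minor [4] - row_minor [1,3,4] * row_minor [5]"
  "cluster_poly 2 = row_minor [2,3,5] * row_minor [4] - row_minor [2,3,4] * row_minor [5]"
  "cluster_poly 3 = row_minor [1,2,4,5] * row_minor [3,4] - row_minor [1,2,3,4] * row_minor [4,5]"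
  "cluster_poly 4 = row_minor [1,2,5] * row_minor [3] - row_minor [1,2,3] * row_minor [5]"
  "cluster_poly 5 = row_minor [1,2,3,5] * row_minor [2,4] - row_minor [1,2,3,4] * row_minor [2,5]"
  "cluster_poly 6 = row_minor [1,2,4] * row_minor [3,5] - row_minor [1,2,3] * row_minor [4,5]"
  "cluster_poly 7 = row_minor [2,4]"
  "cluster_poly 8 = row_minor [1,2,4] * row_minor [3] - row_minor [1,2,3] * row_minor [4]"
  "cluster_poly 9 = row_minor [1,4]"
  "cluster_poly 10 = row_minor [2,3]"
  "cluster_poly 11 = row_minor [3,4]"
  "cluster_poly 12 = row_minor [3]"
  "cluster_poly 13 = row_minor [1,3]"
  "cluster_poly 14 = row_minor [1,2,3,5] * row_minor [3,4] - row_minor [1,2,3,4] * row_minor [3,5]"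
  "cluster_poly 15 = row_minor [4]"
  "cluster_poly 16 = row_minor [2]"
  "cluster_poly 17 = row_minor [2,3,4]"
  "cluster_poly 18 = row_minor [1,2,3,5] * row_minor [4] - row_minor [1,2,3,4] * row_minor [5]"
  "cluster_poly 19 = row_minor [1,2,3,5] * row_minor [1,4] - row_minor [1,2,3,4] * row_minor [1,5]"
  "cluster_poly 20 = row_minor [1,2,4,5] * row_minor [3] + row_minor [1,2,3,4] * row_minor [5] - row_minor [1,2,3,5] * row_minor [4]"
  "cluster_poly 21 = row_minor [3,5]"
  "cluster_poly 22 = row_minor [2,3,5]"
  "cluster_poly 23 = row_minor [2,5]"
  "cluster_poly 24 = row_minor [2,4,5]"
  "cluster_poly 25 = row_minor [1,3,4]"
  "cluster_poly 26 = row_minor [1,2,5] * row_minor [4] - row_minor [1,2,4] * row_minor [5]"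
  "cluster_poly 27 = row_minor [1,3,5]"
  "cluster_poly 28 = row_minor [1,2,3,5]"
  "cluster_poly 29 = row_minor [1,2,4,5] * row_minor [3,5] - row_minor [1,2,3,5] * row_minor [4,5]"
  "cluster_poly 30 = row_minor [1,2,5]"
  "cluster_poly 31 = row_minor [1,4,5]"
  "cluster_poly 32 = row_minor [1,2,4,5]"
  "cluster_poly 33 = row_minor [1,5]"
  "cluster_poly 34 = row_minor [1,3,4,5]"
  "cluster_poly 35 = row_minor [1,2,4]"
  "cluster_poly 36 = row_minor [1]"
  "cluster_poly 37 = row_minor [1,2]"
  "cluster_poly 38 = row_minor [1,2,3]"
  "cluster_poly 39 = row_minor [1,2,3,4]"
  "cluster_poly 40 = row_minor [1,2,3,4,5]"
  "cluster_poly 41 = row_minor [2,3,4,5]"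
  "cluster_poly 42 = row_minor [3,4,5]"
  "cluster_poly 43 = row_minor [4,5]"
  "cluster_poly 44 = row_minor [5]"
  by (simp_all add: cluster_poly_def lower_terms_def label_def cluster_table_def columns_def num_columns_def upt_conv_Cons upt_conv_Nil)

lemma cluster_table_entry:
  assumes "z < 45"
  shows "column_strict (label z)" "\<forall>R\<in>set (label z). R \<noteq> [] \<and> sorted R"
    "\<forall>xs\<in>set (columns (label z)). sorted_wrt (<) xs \<and> length xs \<le> 5"
    "(c, cs, a, b) \<in> set (snd (cluster_table ! z)) \<Longrightarrow>
      (\<forall>xs\<in>set cs. sorted_wrt (<) xs \<and> length xs \<le> 5) \<and> set (concat cs) \<subseteq> set (concat (label z)) \<and>
      lower_at cs (columns (label z)) a b"
proof -
  have "length cluster_table = 45" by (simp add: cluster_table_def)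
  then have "table_entry_ok (cluster_table ! z)"
    using assms cluster_table_ok by (simp add: list_all_length)
  then have "table_entry_ok (label z, snd (cluster_table ! z))" by (simp add: label_def)
  then show "column_strict (label z)" "\<forall>R\<in>set (label z). R \<noteq> [] \<and> sorted R"
    "\<forall>xs\<in>set (columns (label z)). sorted_wrt (<) xs \<and> length xs \<le> 5"
    "(c, cs, a, b) \<in> set (snd (cluster_table ! z)) \<Longrightarrow>
      (\<forall>xs\<in>set cs. sorted_wrt (<) xs \<and> length xs \<le> 5) \<and> set (concat cs) \<subseteq> set (concat (label z)) \<and>
      lower_at cs (columns (label z)) a b"
    by (fastforce simp: table_entry_ok_def list_all_iff)+
qed

text \<open>A monomial of a lower term is at most the leading monomial of its product of minors,
  which the stored position certifies to be below that of the label.\<close>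

lemma keys_lower_terms:
  assumes "z < 45" "k \<in> Poly_Mapping.keys (lower_terms z)"
  shows "k < sum_list (map diagonal_monom (columns (label z)))"
proof -
  let ?m = "sum_list (map diagonal_monom (columns (label z)))"
  have "k < ?m"
    if "k \<in> Poly_Mapping.keys (\<Sum>(c, cs, _)\<leftarrow>xs. of_int c * prod_list (map row_minor cs) :: mpoly)"
      "set xs \<subseteq> set (snd (cluster_table ! z))" for xs k
    using that
  proof (induction xs)
    case (Cons x xs)
    obtain c cs a b where x: "x = (c, cs, a, b)" by (cases x)
    then have entry: "(\<forall>xs\<in>set cs. sorted_wrt (<) xs \<and> length xs \<le> 5) \<and> lower_at cs (columns (label z)) a b"
      using cluster_table_entry(4)[OF assms(1)] Cons.prems(2) by auto
    have "k < ?m" if k: "k \<in> Poly_Mapping.keys (of_int c * prod_list (map row_minor cs) :: mpoly)"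
    proof -
      \<comment> \<open>As a constant monomial, the coefficient adds 0 to the exponents.\<close>
      have "of_int c * prod_list (map row_minor cs) = Poly_Mapping.single 0 (of_int c) * prod_list (map row_minor cs)"
        by simp
      then obtain k0 k' where k': "k = k0 + k'" "k' \<in> Poly_Mapping.keys (prod_list (map row_minor cs))"
        "k0 \<in> Poly_Mapping.keys (Poly_Mapping.single 0 (of_int c) :: mpoly)"
        using k keys_mult[of "Poly_Mapping.single 0 (of_int c)" "prod_list (map row_minor cs)"] by auto
      moreover have "k0 = 0" using k'(3) by (auto simp del: single_of_int split: if_splits)
      ultimately have "k = k'" by simp
      then have "k \<le> sum_list (map diagonal_monom cs)"
        using k'(2) monic_at_row_minors[of cs] entry by (auto simp: monic_at_def)
      also have "\<dots> < ?m"
        using lower_at_imp_less[of cs "columns (label z)" a b] entry cluster_table_entry(3)[OF assms(1)] by blast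
      finally show ?thesis .
    qed
    then show ?case
      using Cons Poly_Mapping.keys_add by (fastforce simp: x)
  qed simp
  then show ?thesis using assms(2) unfolding lower_terms_def by blast
qed

text \<open>Since lower terms only use rows that occur in the label, a label in the alphabet
  \<open>{1..n}\<close> already makes them invariant polynomials of size \<open>n\<close>.\<close>

lemma is_label_cluster_poly:
  assumes z: "z < 45" and n: "set (concat (label z)) \<subseteq> {1..n}"
  shows "is_label n (to_fract (cluster_poly z)) (label z)"
  unfolding is_label_def
proof (intro conjI bexI[of _ "lower_terms z"])
  have minor: "tableau_minor (label z) = prod_list (map row_minor (columns (label z)))"
    using cluster_table_entry(3)[OF z] by (intro tableau_minor_eq_columns) blast
  then show "to_fract (cluster_poly z) = to_fract (tableau_minor (label z) + lower_terms z)"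
    by (simp add: cluster_poly_def)
  show "ssyt n (label z)"
    using cluster_table_entry(1,2)[OF z] n by (rule ssyt_iff_column_strict)
  have "lead_monom (tableau_minor (label z)) = sum_list (map diagonal_monom (columns (label z)))"
    unfolding minor using cluster_table_entry(3)[OF z] by (intro lead_monom_monic_at monic_at_row_minors) blast
  moreover have "lead_monom (lower_terms z) \<in> Poly_Mapping.keys (lower_terms z)" if "lower_terms z \<noteq> 0"
    unfolding lead_monom_def using that by (intro Max_in) auto
  ultimately show "lower_terms z = 0 \<or> lead_monom (lower_terms z) < lead_monom (tableau_minor (label z))"
    using keys_lower_terms[OF z] by metis
  have "(\<Sum>(c, cs, _)\<leftarrow>xs. of_int c * prod_list (map row_minor cs) :: mpoly) \<in> invariant_polys n"
    if "set xs \<subseteq> set (snd (cluster_table ! z))" for xs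
    using that
  proof (induction xs)
    case Nil
    then show ?case using invariant_polys_intros(3)[of 0 n] by simp
  next
    case (Cons x xs)
    obtain c cs a b where x: "x = (c, cs, a, b)" by (cases x)
    then have "\<forall>xs\<in>set cs. sorted_wrt (<) xs \<and> set xs \<subseteq> {1..n}"
      using cluster_table_entry(4)[OF z, of c cs a b] Cons.prems n by fastforce
    then have "of_int c * prod_list (map row_minor cs) \<in> invariant_polys n"
      by (intro invariant_polys_intros row_minors_in_invariant_polys)
    moreover have "(\<Sum>(c, cs, _)\<leftarrow>xs. of_int c * prod_list (map row_minor cs)) \<in> invariant_polys n"
      using Cons by simp
    ultimately show ?case by (simp add: x invariant_polys_intros(1))
  qed
  then show "lower_terms z \<in> invariant_polys n" unfolding lower_terms_def by blast
qed

text \<open>Needed to divide by the old variable in a mutation.\<close>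

lemma cluster_poly_nonzero:
  assumes "z < 45"
  shows "cluster_poly z \<noteq> 0"
proof -
  have "monic_at (sum_list (map diagonal_monom (columns (label z)))) (cluster_poly z)"
    unfolding cluster_poly_def using cluster_table_entry(3)[OF assms] keys_lower_terms[OF assms]
    by (intro monic_at_add monic_at_row_minors) auto
  then show ?thesis by (rule monic_at_nonzero)
qed

section \<open>Exchange relations\<close>

definition exchange :: "nat \<Rightarrow> nat \<Rightarrow> nat list \<Rightarrow> nat list \<Rightarrow> bool" where
  "exchange z z' I J \<longleftrightarrow>
     cluster_poly z * cluster_poly z' = prod_list (map cluster_poly I) + prod_list (map cluster_poly J)"

text \<open>
  In a certificate, \<open>(c, q, A, B)\<close> stands for the Pluecker relation given by \<open>A\<close> and \<open>B\<close>, multiplied by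
  \<open>c\<close> and by the minors listed in \<open>q\<close>.
\<close>

lemma exchangeI:
  fixes cert :: "(int \<times> nat list list \<times> nat list \<times> nat list) list"
  assumes "list_all (\<lambda>(c, q, A, B). length A + 1 < length B) cert"
    and "cluster_poly z * cluster_poly z' - (prod_list (map cluster_poly I) + prod_list (map cluster_poly J)) =
      (\<Sum>(c, q, A, B)\<leftarrow>cert. of_int c * prod_list (map row_minor q) * pluecker A B)"
  shows "exchange z z' I J"
proof -
  have "(\<Sum>(c, q, A, B)\<leftarrow>cert. of_int c * prod_list (map row_minor q) * pluecker A B) = 0"
    using assms(1) by (induction cert) (auto simp: pluecker_eq_0)
  then show ?thesis using assms(2) by (simp add: exchange_def)
qed

text \<open>In the certificates below \<open>A\<close> has at most two elements and \<open>B\<close>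
  is increasing, so only minors with two or three rows have to be sorted or recognised as
  zero.\<close>

lemmas exchange_unfold = cluster_poly_simps pluecker_def lessThan_Suc
  row_minor_2_swap row_minor_3_swap row_minor_2_repeat row_minor_3_repeat

text \<open>Here and in the following lemmas, unfolding turns both sides into polynomials in minors
  with increasing rows. The certificate makes them equal with these minors treated as unknowns, so
  ring normalisation suffices.\<close>

lemma exch_0_23: "exchange 0 23 [10,24,33] [22,37,43]"
  by (rule exchangeI[of "[(1, [[1,5]], [2], [2, 3, 4, 5]), (- 1, [[2,3,5]], [1], [2, 4, 5]), (1, [[2,5]], [4], [1, 2, 3, 5]), (- 1, [[2,5]], [5], [1, 2, 3, 4])]"],
      simp, simp add: exchange_unfold del: One_nat_def, (simp add: algebra_simps)?)

lemma exch_0_35: "exchange 0 35 [9,24,38] [17,31,37]"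
  by (rule exchangeI[of "[(1, [[2,3,4]], [1], [1, 2, 4, 5]), (1, [[1,4]], [1, 2], [2, 3, 4, 5]), (1, [[1,2,4]], [4], [1, 2, 3, 5]), (- 1, [[1,2,4]], [5], [1, 2, 3, 4])]"],
      simp, simp add: exchange_unfold del: One_nat_def, (simp add: algebra_simps)?)

lemma exch_1_33: "exchange 1 33 [13,31,44] [27,36,43]"
  by (rule exchangeI[of "[(- 1, [[1,3,5]], [], [1, 4, 5]), (1, [[5]], [1], [1, 3, 4, 5])]"],
      simp, simp add: exchange_unfold del: One_nat_def, (simp add: algebra_simps)?)

lemma exch_1_35: "exchange 1 35 [15,31,38] [25,26]"
  by (rule exchangeI[of "[(1, [[4]], [1, 2], [1, 3, 4, 5])]"],
      simp, simp add: exchange_unfold del: One_nat_def, (simp add: algebra_simps)?)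

lemma exch_2_9: "exchange 2 9 [0,15] [17,36,43]"
  by (rule exchangeI[of "[(- 1, [[4]], [4], [1, 2, 3, 5]), (- 1, [[2,3,4]], [], [1, 4, 5]), (1, [[4]], [5], [1, 2, 3, 4])]"],
      simp, simp add: exchange_unfold del: One_nat_def, (simp add: algebra_simps)?)

lemma exch_2_23: "exchange 2 23 [10,24,44] [16,22,43]"
  by (rule exchangeI[of "[(- 1, [[2,3,5]], [], [2, 4, 5]), (1, [[5]], [2], [2, 3, 4, 5])]"],
      simp, simp add: exchange_unfold del: One_nat_def, (simp add: algebra_simps)?)

lemma exch_2_27: "exchange 2 27 [1,22] [38,42,44]"
  by (rule exchangeI[of "[(1, [[5]], [1, 3], [2, 3, 4, 5])]"],
      simp, simp add: exchange_unfold del: One_nat_def, (simp add: algebra_simps)?)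

lemma exch_2_30: "exchange 2 30 [22,26] [24,38,44]"
  by (rule exchangeI[of "[(1, [[5]], [1, 2], [2, 3, 4, 5])]"],
      simp, simp add: exchange_unfold del: One_nat_def, (simp add: algebra_simps)?)

lemma exch_3_5: "exchange 3 5 [7,14,32] [37,39,41,43]"
  by (rule exchangeI[of "[(1, [[1,2,3,4],[4,5]], [2], [1, 2, 3, 4, 5]), (- 1, [[1,2,3,4],[1,2,4,5]], [2], [3, 4, 5])]"],
      simp, simp add: exchange_unfold del: One_nat_def, (simp add: algebra_simps)?)

lemma exch_3_18: "exchange 3 18 [14,15,32] [20,39,43]"
  by (rule exchangeI[of "[(- 1, [[1,2,3,4],[1,2,4,5]], [], [3, 4, 5])]"],
      simp, simp add: exchange_unfold del: One_nat_def, (simp add: algebra_simps)?)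

text \<open>The certificate is empty because the relation holds as soon as the variables 3, 29 and
  14 are expanded in minors.\<close>

lemma exch_3_21: "exchange 3 21 [11,29] [14,43]"
  by (rule exchangeI[of "[]"],
      simp, simp add: exchange_unfold del: One_nat_def, (simp add: algebra_simps)?)

lemma exch_3_31: "exchange 3 31 [9,32,42] [34,35,43]"
  by (rule exchangeI[of "[(1, [[1,2,4,5]], [4], [1, 3, 4, 5]), (- 1, [[4,5]], [1, 4], [1, 2, 3, 4, 5])]"],
      simp, simp add: exchange_unfold del: One_nat_def, (simp add: algebra_simps)?)

lemma exch_4_15: "exchange 4 15 [8,44] [12,26]"
  by (rule exchangeI[of "[]"],
      simp, simp add: exchange_unfold del: One_nat_def, (simp add: algebra_simps)?)

lemma exch_4_18: "exchange 4 18 [12,26,28] [20,38,44]"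
  by (rule exchangeI[of "[(- 1, [[3],[5]], [1, 2], [1, 2, 3, 4, 5])]"],
      simp, simp add: exchange_unfold del: One_nat_def, (simp add: algebra_simps)?)

lemma exch_4_31: "exchange 4 31 [26,27] [30,36,42]"
  by (rule exchangeI[of "[(- 1, [[1,2,5]], [], [1, 3, 4, 5]), (1, [[5]], [1, 2], [1, 3, 4, 5])]"],
      simp, simp add: exchange_unfold del: One_nat_def, (simp add: algebra_simps)?)

lemma exch_4_33: "exchange 4 33 [21,30,36] [27,37,44]"
  by (rule exchangeI[of "[(- 1, [[1,2,5]], [], [1, 3, 5]), (1, [[5]], [1], [1, 2, 3, 5])]"],
      simp, simp add: exchange_unfold del: One_nat_def, (simp add: algebra_simps)?)

lemma exch_5_21: "exchange 5 21 [10,28,43] [14,23]"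
  by (rule exchangeI[of "[(- 1, [[1,2,3,5]], [2], [3, 4, 5])]"],
      simp, simp add: exchange_unfold del: One_nat_def, (simp add: algebra_simps)?)

lemma exch_5_35: "exchange 5 35 [7,32,38] [24,37,39]"
  by (rule exchangeI[of "[(1, [[1,2,3,4]], [2], [1, 2, 4, 5]), (- 1, [[2,4]], [1, 2], [1, 2, 3, 4, 5])]"],
      simp, simp add: exchange_unfold del: One_nat_def, (simp add: algebra_simps)?)

lemma exch_6_9: "exchange 6 9 [11,33,35] [25,37,43]"
  by (rule exchangeI[of "[(1, [[4,5]], [1], [1, 2, 3, 4]), (- 1, [[1,2,4]], [1], [3, 4, 5])]"],
      simp, simp add: exchange_unfold del: One_nat_def, (simp add: algebra_simps)?)

lemma exch_6_12: "exchange 6 12 [8,21] [11,38,44]"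
  by (rule exchangeI[of "[(- 1, [[1,2,3]], [], [3, 4, 5])]"],
      simp, simp add: exchange_unfold del: One_nat_def, (simp add: algebra_simps)?)

lemma exch_6_28: "exchange 6 28 [21,30,39] [29,38]"
  by (rule exchangeI[of "[(- 1, [[3,5]], [1, 2], [1, 2, 3, 4, 5])]"],
      simp, simp add: exchange_unfold del: One_nat_def, (simp add: algebra_simps)?)

lemma exch_7_12: "exchange 7 12 [10,15] [11,16]"
  by (rule exchangeI[of "[(- 1, [], [], [2, 3, 4])]"],
      simp, simp add: exchange_unfold del: One_nat_def, (simp add: algebra_simps)?)

lemma exch_7_19: "exchange 7 19 [5,9] [37,39,43]"
  by (rule exchangeI[of "[(- 1, [[1,2,3,4]], [1], [2, 4, 5])]"],
      simp, simp add: exchange_unfold del: One_nat_def, (simp add: algebra_simps)?)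

lemma exch_7_22: "exchange 7 22 [10,24] [17,23]"
  by (rule exchangeI[of "[(1, [], [2], [2, 3, 4, 5])]"],
      simp, simp add: exchange_unfold del: One_nat_def, (simp add: algebra_simps)?)

lemma exch_7_25: "exchange 7 25 [9,17] [11,35]"
  by (rule exchangeI[of "[(1, [], [4], [1, 2, 3, 4])]"],
      simp, simp add: exchange_unfold del: One_nat_def, (simp add: algebra_simps)?)

lemma exch_7_26: "exchange 7 26 [15,24,37] [16,35,43]"
  by (rule exchangeI[of "[(- 1, [[1,2,4]], [], [2, 4, 5]), (1, [[4]], [2], [1, 2, 4, 5])]"],
      simp, simp add: exchange_unfold del: One_nat_def, (simp add: algebra_simps)?)

lemma exch_7_28: "exchange 7 28 [5] [23,39]"
  by (rule exchangeI[of "[]"],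
      simp, simp add: exchange_unfold del: One_nat_def, (simp add: algebra_simps)?)

lemma exch_7_29: "exchange 7 29 [3,23] [37,41,43]"
  by (rule exchangeI[of "[(1, [[4,5]], [2], [1, 2, 3, 4, 5]), (- 1, [[1,2,4,5]], [2], [3, 4, 5])]"],
      simp, simp add: exchange_unfold del: One_nat_def, (simp add: algebra_simps)?)

lemma exch_7_30: "exchange 7 30 [23,35] [24,37]"
  by (rule exchangeI[of "[(1, [], [2], [1, 2, 4, 5])]"],
      simp, simp add: exchange_unfold del: One_nat_def, (simp add: algebra_simps)?)

lemma exch_7_31: "exchange 7 31 [9,24] [35,43]"
  by (rule exchangeI[of "[(1, [], [4], [1, 2, 4, 5])]"],
      simp, simp add: exchange_unfold del: One_nat_def, (simp add: algebra_simps)?)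

lemma exch_7_34: "exchange 7 34 [3] [9,41]"
  by (rule exchangeI[of "[(1, [], [4], [1, 2, 3, 4, 5])]"],
      simp, simp add: exchange_unfold del: One_nat_def, (simp add: algebra_simps)?)

lemma exch_8_10: "exchange 8 10 [11,16,38] [12,17,37]"
  by (rule exchangeI[of "[(- 1, [[1,2,3]], [], [2, 3, 4]), (1, [[3]], [2], [1, 2, 3, 4])]"],
      simp, simp add: exchange_unfold del: One_nat_def, (simp add: algebra_simps)?)

lemma exch_8_22: "exchange 8 22 [4,17] [16,38,42]"
  by (rule exchangeI[of "[(- 1, [[1,2,3]], [], [2, 3, 4, 5]), (1, [[3]], [1, 2], [2, 3, 4, 5])]"],
      simp, simp add: exchange_unfold del: One_nat_def, (simp add: algebra_simps)?)

lemma exch_8_28: "exchange 8 28 [4,39] [20,38]"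
  by (rule exchangeI[of "[(- 1, [[3]], [1, 2], [1, 2, 3, 4, 5])]"],
      simp, simp add: exchange_unfold del: One_nat_def, (simp add: algebra_simps)?)

lemma exch_8_33: "exchange 8 33 [6,36] [25,37,44]"
  by (rule exchangeI[of "[(- 1, [[1,3,4]], [], [1, 2, 5]), (1, [[1]], [5], [1, 2, 3, 4]), (1, [[1,5]], [], [1, 2, 3, 4])]"],
      simp, simp add: exchange_unfold del: One_nat_def, (simp add: algebra_simps)?)

lemma exch_9_12: "exchange 9 12 [11,36] [13,15]"
  by (rule exchangeI[of "[(- 1, [], [], [1, 3, 4])]"],
      simp, simp add: exchange_unfold del: One_nat_def, (simp add: algebra_simps)?)

lemma exch_9_16: "exchange 9 16 [7,36] [15,37]"
  by (rule exchangeI[of "[(- 1, [], [], [1, 2, 4])]"],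
      simp, simp add: exchange_unfold del: One_nat_def, (simp add: algebra_simps)?)

lemma exch_9_22: "exchange 9 22 [0] [17,33]"
  by (rule exchangeI[of "[(- 1, [], [4], [1, 2, 3, 5]), (1, [], [5], [1, 2, 3, 4])]"],
      simp, simp add: exchange_unfold del: One_nat_def, (simp add: algebra_simps)?)

lemma exch_9_23: "exchange 9 23 [7,33] [37,43]"
  by (rule exchangeI[of "[(- 1, [], [1], [2, 4, 5])]"],
      simp, simp add: exchange_unfold del: One_nat_def, (simp add: algebra_simps)?)

lemma exch_9_27: "exchange 9 27 [13,31] [25,33]"
  by (rule exchangeI[of "[(1, [], [1], [1, 3, 4, 5])]"],
      simp, simp add: exchange_unfold del: One_nat_def, (simp add: algebra_simps)?)

lemma exch_9_28: "exchange 9 28 [19] [33,39]"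
  by (rule exchangeI[of "[]"],
      simp, simp add: exchange_unfold del: One_nat_def, (simp add: algebra_simps)?)

lemma exch_10_25: "exchange 10 25 [11,38] [13,17]"
  by (rule exchangeI[of "[(1, [], [3], [1, 2, 3, 4])]"],
      simp, simp add: exchange_unfold del: One_nat_def, (simp add: algebra_simps)?)

lemma exch_10_27: "exchange 10 27 [13,22] [21,38]"
  by (rule exchangeI[of "[(1, [], [3], [1, 2, 3, 5])]"],
      simp, simp add: exchange_unfold del: One_nat_def, (simp add: algebra_simps)?)

lemma exch_10_32: "exchange 10 32 [5] [37,41]"
  by (rule exchangeI[of "[(1, [], [2], [1, 2, 3, 4, 5])]"],
      simp, simp add: exchange_unfold del: One_nat_def, (simp add: algebra_simps)?)

lemma exch_10_34: "exchange 10 34 [13,41] [14]"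
  by (rule exchangeI[of "[(1, [], [3], [1, 2, 3, 4, 5])]"],
      simp, simp add: exchange_unfold del: One_nat_def, (simp add: algebra_simps)?)

lemma exch_10_35: "exchange 10 35 [7,38] [17,37]"
  by (rule exchangeI[of "[(1, [], [2], [1, 2, 3, 4])]"],
      simp, simp add: exchange_unfold del: One_nat_def, (simp add: algebra_simps)?)

lemma exch_11_18: "exchange 11 18 [12,39,43] [14,15]"
  by (rule exchangeI[of "[(- 1, [[1,2,3,4]], [], [3, 4, 5])]"],
      simp, simp add: exchange_unfold del: One_nat_def, (simp add: algebra_simps)?)

lemma exch_11_19: "exchange 11 19 [9,14] [13,39,43]"
  by (rule exchangeI[of "[(- 1, [[1,2,3,4]], [1], [3, 4, 5])]"],
      simp, simp add: exchange_unfold del: One_nat_def, (simp add: algebra_simps)?)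

lemma exch_11_24: "exchange 11 24 [7,42] [17,43]"
  by (rule exchangeI[of "[(1, [], [4], [2, 3, 4, 5])]"],
      simp, simp add: exchange_unfold del: One_nat_def, (simp add: algebra_simps)?)

lemma exch_11_28: "exchange 11 28 [14] [21,39]"
  by (rule exchangeI[of "[]"],
      simp, simp add: exchange_unfold del: One_nat_def, (simp add: algebra_simps)?)

lemma exch_11_31: "exchange 11 31 [9,42] [25,43]"
  by (rule exchangeI[of "[(1, [], [4], [1, 3, 4, 5])]"],
      simp, simp add: exchange_unfold del: One_nat_def, (simp add: algebra_simps)?)

lemma exch_11_32: "exchange 11 32 [3] [39,43]"
  by (rule exchangeI[of "[]"],
      simp, simp add: exchange_unfold del: One_nat_def, (simp add: algebra_simps)?)

lemma exch_12_23: "exchange 12 23 [10,44] [16,21]"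
  by (rule exchangeI[of "[(- 1, [], [], [2, 3, 5])]"],
      simp, simp add: exchange_unfold del: One_nat_def, (simp add: algebra_simps)?)

lemma exch_12_24: "exchange 12 24 [2] [16,42]"
  by (rule exchangeI[of "[(- 1, [], [], [2, 3, 4, 5])]"],
      simp, simp add: exchange_unfold del: One_nat_def, (simp add: algebra_simps)?)

lemma exch_12_30: "exchange 12 30 [4] [38,44]"
  by (rule exchangeI[of "[]"],
      simp, simp add: exchange_unfold del: One_nat_def, (simp add: algebra_simps)?)

lemma exch_12_31: "exchange 12 31 [1] [36,42]"
  by (rule exchangeI[of "[(- 1, [], [], [1, 3, 4, 5])]"],
      simp, simp add: exchange_unfold del: One_nat_def, (simp add: algebra_simps)?)

lemma exch_12_32: "exchange 12 32 [18] [20]"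
  by (rule exchangeI[of "[]"],
      simp, simp add: exchange_unfold del: One_nat_def, (simp add: algebra_simps)?)

lemma exch_12_33: "exchange 12 33 [13,44] [21,36]"
  by (rule exchangeI[of "[(- 1, [], [], [1, 3, 5])]"],
      simp, simp add: exchange_unfold del: One_nat_def, (simp add: algebra_simps)?)

lemma exch_12_35: "exchange 12 35 [8] [15,38]"
  by (rule exchangeI[of "[]"],
      simp, simp add: exchange_unfold del: One_nat_def, (simp add: algebra_simps)?)

lemma exch_13_16: "exchange 13 16 [10,36] [12,37]"
  by (rule exchangeI[of "[(- 1, [], [], [1, 2, 3])]"],
      simp, simp add: exchange_unfold del: One_nat_def, (simp add: algebra_simps)?)

lemma exch_13_24: "exchange 13 24 [0] [37,42]"
  by (rule exchangeI[of "[(- 1, [], [1], [2, 3, 4, 5]), (- 1, [], [4], [1, 2, 3, 5]), (1, [], [5], [1, 2, 3, 4])]"],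
      simp, simp add: exchange_unfold del: One_nat_def, (simp add: algebra_simps)?)

lemma exch_13_30: "exchange 13 30 [27,37] [33,38]"
  by (rule exchangeI[of "[(1, [], [1], [1, 2, 3, 5])]"],
      simp, simp add: exchange_unfold del: One_nat_def, (simp add: algebra_simps)?)

lemma exch_13_32: "exchange 13 32 [19] [34,37]"
  by (rule exchangeI[of "[(1, [], [1], [1, 2, 3, 4, 5])]"],
      simp, simp add: exchange_unfold del: One_nat_def, (simp add: algebra_simps)?)

lemma exch_13_35: "exchange 13 35 [9,38] [25,37]"
  by (rule exchangeI[of "[(1, [], [1], [1, 2, 3, 4])]"],
      simp, simp add: exchange_unfold del: One_nat_def, (simp add: algebra_simps)?)

lemma exch_14_22: "exchange 14 22 [10,28,42] [21,38,41]"
  by (rule exchangeI[of "[(1, [[1,2,3,5]], [3], [2, 3, 4, 5]), (- 1, [[3,5]], [2, 3], [1, 2, 3, 4, 5])]"],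
      simp, simp add: exchange_unfold del: One_nat_def, (simp add: algebra_simps)?)

lemma exch_15_21: "exchange 15 21 [11,44] [12,43]"
  by (rule exchangeI[of "[(- 1, [], [], [3, 4, 5])]"],
      simp, simp add: exchange_unfold del: One_nat_def, (simp add: algebra_simps)?)

lemma exch_15_22: "exchange 15 22 [2] [17,44]"
  by (rule exchangeI[of "[]"],
      simp, simp add: exchange_unfold del: One_nat_def, (simp add: algebra_simps)?)

lemma exch_15_23: "exchange 15 23 [7,44] [16,43]"
  by (rule exchangeI[of "[(- 1, [], [], [2, 4, 5])]"],
      simp, simp add: exchange_unfold del: One_nat_def, (simp add: algebra_simps)?)

lemma exch_15_27: "exchange 15 27 [1] [25,44]"
  by (rule exchangeI[of "[]"],
      simp, simp add: exchange_unfold del: One_nat_def, (simp add: algebra_simps)?)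

lemma exch_15_28: "exchange 15 28 [18] [39,44]"
  by (rule exchangeI[of "[]"],
      simp, simp add: exchange_unfold del: One_nat_def, (simp add: algebra_simps)?)

lemma exch_15_29: "exchange 15 29 [3,44] [20,43]"
  by (rule exchangeI[of "[(- 1, [[1,2,4,5]], [], [3, 4, 5])]"],
      simp, simp add: exchange_unfold del: One_nat_def, (simp add: algebra_simps)?)

lemma exch_15_30: "exchange 15 30 [26] [35,44]"
  by (rule exchangeI[of "[]"],
      simp, simp add: exchange_unfold del: One_nat_def, (simp add: algebra_simps)?)

lemma exch_15_33: "exchange 15 33 [9,44] [36,43]"
  by (rule exchangeI[of "[(- 1, [], [], [1, 4, 5])]"],
      simp, simp add: exchange_unfold del: One_nat_def, (simp add: algebra_simps)?)

lemma exch_16_25: "exchange 16 25 [8] [17,36]"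
  by (rule exchangeI[of "[(- 1, [], [], [1, 2, 3, 4])]"],
      simp, simp add: exchange_unfold del: One_nat_def, (simp add: algebra_simps)?)

lemma exch_16_27: "exchange 16 27 [4] [22,36]"
  by (rule exchangeI[of "[(- 1, [], [], [1, 2, 3, 5])]"],
      simp, simp add: exchange_unfold del: One_nat_def, (simp add: algebra_simps)?)

lemma exch_16_31: "exchange 16 31 [24,36] [26]"
  by (rule exchangeI[of "[(- 1, [], [], [1, 2, 4, 5])]"],
      simp, simp add: exchange_unfold del: One_nat_def, (simp add: algebra_simps)?)

lemma exch_16_33: "exchange 16 33 [23,36] [37,44]"
  by (rule exchangeI[of "[(- 1, [], [], [1, 2, 5])]"],
      simp, simp add: exchange_unfold del: One_nat_def, (simp add: algebra_simps)?)

lemma exch_16_34: "exchange 16 34 [20] [36,41]"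
  by (rule exchangeI[of "[(- 1, [], [], [1, 2, 3, 4, 5])]"],
      simp, simp add: exchange_unfold del: One_nat_def, (simp add: algebra_simps)?)

lemma exch_17_18: "exchange 17 18 [2,39] [15,38,41]"
  by (rule exchangeI[of "[(- 1, [[4]], [2, 3], [1, 2, 3, 4, 5])]"],
      simp, simp add: exchange_unfold del: One_nat_def, (simp add: algebra_simps)?)

lemma exch_17_20: "exchange 17 20 [8,41] [16,39,42]"
  by (rule exchangeI[of "[(1, [[4]], [2, 3], [1, 2, 3, 4, 5]), (- 1, [[3]], [2, 4], [1, 2, 3, 4, 5]), (- 1, [[1,2,3,4]], [], [2, 3, 4, 5])]"],
      simp, simp add: exchange_unfold del: One_nat_def, (simp add: algebra_simps)?)

lemma exch_17_28: "exchange 17 28 [22,39] [38,41]"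
  by (rule exchangeI[of "[(- 1, [], [2, 3], [1, 2, 3, 4, 5])]"],
      simp, simp add: exchange_unfold del: One_nat_def, (simp add: algebra_simps)?)

lemma exch_17_29: "exchange 17 29 [6,41] [23,39,42]"
  by (rule exchangeI[of "[(1, [[4,5]], [2, 3], [1, 2, 3, 4, 5]), (- 1, [[3,5]], [2, 4], [1, 2, 3, 4, 5]), (1, [[1,2,3,4]], [5], [2, 3, 4, 5])]"],
      simp, simp add: exchange_unfold del: One_nat_def, (simp add: algebra_simps)?)

lemma exch_17_34: "exchange 17 34 [25,41] [39,42]"
  by (rule exchangeI[of "[(- 1, [], [3, 4], [1, 2, 3, 4, 5])]"],
      simp, simp add: exchange_unfold del: One_nat_def, (simp add: algebra_simps)?)

lemma exch_18_23: "exchange 18 23 [5,44] [16,28,43]"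
  by (rule exchangeI[of "[(- 1, [[1,2,3,5]], [], [2, 4, 5])]"],
      simp, simp add: exchange_unfold del: One_nat_def, (simp add: algebra_simps)?)

lemma exch_18_27: "exchange 18 27 [1,28] [34,38,44]"
  by (rule exchangeI[of "[(- 1, [[5]], [1, 3], [1, 2, 3, 4, 5])]"],
      simp, simp add: exchange_unfold del: One_nat_def, (simp add: algebra_simps)?)

lemma exch_18_33: "exchange 18 33 [19,44] [28,36,43]"
  by (rule exchangeI[of "[(- 1, [[1,2,3,5]], [], [1, 4, 5])]"],
      simp, simp add: exchange_unfold del: One_nat_def, (simp add: algebra_simps)?)

lemma exch_18_35: "exchange 18 35 [15,32,38] [26,39]"
  by (rule exchangeI[of "[(- 1, [[4]], [1, 2], [1, 2, 3, 4, 5])]"],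
      simp, simp add: exchange_unfold del: One_nat_def, (simp add: algebra_simps)?)

lemma exch_19_22: "exchange 19 22 [0,28] [33,38,41]"
  by (rule exchangeI[of "[(- 1, [[1,2,3,5]], [4], [1, 2, 3, 5]), (- 1, [[1,5]], [2, 3], [1, 2, 3, 4, 5]), (1, [[1,2,3,5]], [5], [1, 2, 3, 4])]"],
      simp, simp add: exchange_unfold del: One_nat_def, (simp add: algebra_simps)?)

lemma exch_19_30: "exchange 19 30 [28,31,37] [32,33,38]"
  by (rule exchangeI[of "[(1, [[1,2,3,5]], [1], [1, 2, 4, 5]), (- 1, [[1,5]], [1, 2], [1, 2, 3, 4, 5])]"],
      simp, simp add: exchange_unfold del: One_nat_def, (simp add: algebra_simps)?)

lemma exch_20_33: "exchange 20 33 [29,36] [34,37,44]"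
  by (rule exchangeI[of "[(- 1, [[1,2,4,5]], [], [1, 3, 5]), (1, [[1,2,3,5]], [], [1, 4, 5]), (1, [[5]], [1], [1, 2, 3, 4, 5])]"],
      simp, simp add: exchange_unfold del: One_nat_def, (simp add: algebra_simps)?)

lemma exch_21_24: "exchange 21 24 [22,43] [23,42]"
  by (rule exchangeI[of "[(1, [], [5], [2, 3, 4, 5])]"],
      simp, simp add: exchange_unfold del: One_nat_def, (simp add: algebra_simps)?)

lemma exch_21_32: "exchange 21 32 [28,43] [29]"
  by (rule exchangeI[of "[]"],
      simp, simp add: exchange_unfold del: One_nat_def, (simp add: algebra_simps)?)

lemma exch_21_35: "exchange 21 35 [6] [38,43]"
  by (rule exchangeI[of "[]"],
      simp, simp add: exchange_unfold del: One_nat_def, (simp add: algebra_simps)?)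

lemma exch_22_25: "exchange 22 25 [17,27] [38,42]"
  by (rule exchangeI[of "[(1, [], [1, 3], [2, 3, 4, 5])]"],
      simp, simp add: exchange_unfold del: One_nat_def, (simp add: algebra_simps)?)

lemma exch_22_32: "exchange 22 32 [24,28] [30,41]"
  by (rule exchangeI[of "[(- 1, [], [2, 5], [1, 2, 3, 4, 5])]"],
      simp, simp add: exchange_unfold del: One_nat_def, (simp add: algebra_simps)?)

lemma exch_22_34: "exchange 22 34 [27,41] [28,42]"
  by (rule exchangeI[of "[(- 1, [], [3, 5], [1, 2, 3, 4, 5])]"],
      simp, simp add: exchange_unfold del: One_nat_def, (simp add: algebra_simps)?)

lemma exch_22_35: "exchange 22 35 [17,30] [24,38]"
  by (rule exchangeI[of "[(1, [], [1, 2], [2, 3, 4, 5])]"],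
      simp, simp add: exchange_unfold del: One_nat_def, (simp add: algebra_simps)?)

lemma exch_23_25: "exchange 23 25 [6] [17,33]"
  by (rule exchangeI[of "[(1, [], [5], [1, 2, 3, 4])]"],
      simp, simp add: exchange_unfold del: One_nat_def, (simp add: algebra_simps)?)

lemma exch_23_27: "exchange 23 27 [21,30] [22,33]"
  by (rule exchangeI[of "[(1, [], [5], [1, 2, 3, 5])]"],
      simp, simp add: exchange_unfold del: One_nat_def, (simp add: algebra_simps)?)

lemma exch_23_34: "exchange 23 34 [29] [33,41]"
  by (rule exchangeI[of "[(1, [], [5], [1, 2, 3, 4, 5])]"],
      simp, simp add: exchange_unfold del: One_nat_def, (simp add: algebra_simps)?)

lemma exch_24_34: "exchange 24 34 [31,41] [32,42]"
  by (rule exchangeI[of "[(- 1, [], [4, 5], [1, 2, 3, 4, 5])]"],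
      simp, simp add: exchange_unfold del: One_nat_def, (simp add: algebra_simps)?)

lemma exch_27_32: "exchange 27 32 [28,31] [30,34]"
  by (rule exchangeI[of "[(- 1, [], [1, 5], [1, 2, 3, 4, 5])]"],
      simp, simp add: exchange_unfold del: One_nat_def, (simp add: algebra_simps)?)

lemma exch_27_35: "exchange 27 35 [25,30] [31,38]"
  by (rule exchangeI[of "[(1, [], [1, 2], [1, 3, 4, 5])]"],
      simp, simp add: exchange_unfold del: One_nat_def, (simp add: algebra_simps)?)

lemma exch_28_35: "exchange 28 35 [30,39] [32,38]"
  by (rule exchangeI[of "[(- 1, [], [1, 2], [1, 2, 3, 4, 5])]"],
      simp, simp add: exchange_unfold del: One_nat_def, (simp add: algebra_simps)?)

lemma exch_29_31: "exchange 29 31 [30,34,43] [32,33,42]"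
  by (rule exchangeI[of "[(1, [[1,2,4,5]], [5], [1, 3, 4, 5]), (- 1, [[4,5]], [1, 5], [1, 2, 3, 4, 5])]"],
      simp, simp add: exchange_unfold del: One_nat_def, (simp add: algebra_simps)?)

lemmas exchange_relations =
  exch_0_23 exch_0_35 exch_1_33 exch_1_35 exch_2_9 exch_2_23 exch_2_27 exch_2_30 exch_3_5
  exch_3_18 exch_3_21 exch_3_31 exch_4_15 exch_4_18 exch_4_31 exch_4_33 exch_5_21 exch_5_35
  exch_6_9 exch_6_12 exch_6_28 exch_7_12 exch_7_19 exch_7_22 exch_7_25 exch_7_26 exch_7_28
  exch_7_29 exch_7_30 exch_7_31 exch_7_34 exch_8_10 exch_8_22 exch_8_28 exch_8_33 exch_9_12
  exch_9_16 exch_9_22 exch_9_23 exch_9_27 exch_9_28 exch_10_25 exch_10_27 exch_10_32 exch_10_34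
  exch_10_35 exch_11_18 exch_11_19 exch_11_24 exch_11_28 exch_11_31 exch_11_32 exch_12_23
  exch_12_24 exch_12_30 exch_12_31 exch_12_32 exch_12_33 exch_12_35 exch_13_16 exch_13_24
  exch_13_30 exch_13_32 exch_13_35 exch_14_22 exch_15_21 exch_15_22 exch_15_23 exch_15_27
  exch_15_28 exch_15_29 exch_15_30 exch_15_33 exch_16_25 exch_16_27 exch_16_31 exch_16_33
  exch_16_34 exch_17_18 exch_17_20 exch_17_28 exch_17_29 exch_17_34 exch_18_23 exch_18_27
  exch_18_33 exch_18_35 exch_19_22 exch_19_30 exch_20_33 exch_21_24 exch_21_32 exch_21_35
  exch_22_25 exch_22_32 exch_22_34 exch_22_35 exch_23_25 exch_23_27 exch_23_34 exch_24_34
  exch_27_32 exch_27_35 exch_28_35 exch_29_31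

section \<open>Exploring the seeds\<close>

text \<open>
  A seed is represented by the list of the indices of its variables, in a fixed order of the vertices
  with the \<open>m\<close> mutable ones first, and by the rows of its weight matrix at the mutable vertices. The
  weights between frozen vertices never influence a mutation and are not recorded.
\<close>

definition represents ::
  "(nat \<times> nat) list \<Rightarrow> nat \<Rightarrow> (nat \<times> nat) seed \<Rightarrow> nat list \<Rightarrow> int list list \<Rightarrow> bool" where
  "represents vs m S ids M \<longleftrightarrow>
     distinct vs \<and> m \<le> length vs \<and> length ids = length vs \<and> length M = m \<and>
     (\<forall>r<m. length (M ! r) = length vs) \<and>
     vertices S = set vs \<and> mutables S = set (take m vs) \<and>
     (\<forall>k<length vs. ids ! k < 45 \<and> variable S (vs ! k) = to_fract (cluster_poly (ids ! k))) \<and>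
     (\<forall>r<m. \<forall>c<length vs. weight S (vs ! r) (vs ! c) = M ! r ! c \<and>
        weight S (vs ! c) (vs ! r) = - (M ! r ! c))"

text \<open>One monomial of an exchange relation as a list of indices with multiplicity. For weights
  at most 1, \<open>insort\<close> produces the increasing lists in which the exchange relations are
  stated.\<close>

fun positive_part :: "nat list \<Rightarrow> int list \<Rightarrow> nat list" where
  "positive_part (z # zs) (w # ws) =
     (if w = 1 then insort z (positive_part zs ws)
      else if w \<le> 0 then positive_part zs ws
      else replicate (nat w) z @ positive_part zs ws)"
| "positive_part _ _ = []"

fun add_positive :: "int \<Rightarrow> int list \<Rightarrow> int list \<Rightarrow> int list" where
  "add_positive w (b # bs) (a # as) = (if 0 < b then a + w * b else a) # add_positive w bs as"
| "add_positive w _ _ = []"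

fun add_negative :: "int \<Rightarrow> int list \<Rightarrow> int list \<Rightarrow> int list" where
  "add_negative w (b # bs) (a # as) = (if b < 0 then a - w * b else a) # add_negative w bs as"
| "add_negative w _ _ = []"

text \<open>Here \<open>x\<close> is the row of some vertex \<open>u\<close>, \<open>r\<close> that
  of the mutated vertex, and \<open>w\<close> the weight from \<open>u\<close> to it. If
  \<open>0 < w\<close>, then \<open>u\<close> is in \<open>In\<close> and changes towards
  \<open>Out\<close>, the positive entries of \<open>r\<close>. If \<open>w < 0\<close>, it is in
  \<open>Out\<close> and changes towards \<open>In\<close>, the negative ones.\<close>

definition mutate_row :: "nat \<Rightarrow> int list \<Rightarrow> int list \<Rightarrow> int \<Rightarrow> int list" where
  "mutate_row v r x w =
     (if w = 0 then x else if 0 < w then (add_positive w r x)[v := - w] else (add_negative w r x)[v := - w])"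

primrec mutate_rows :: "nat \<Rightarrow> int list \<Rightarrow> int list list \<Rightarrow> int list list" where
  "mutate_rows v r [] = []"
| "mutate_rows v r (x # xs) = mutate_row v r x (x ! v) # mutate_rows v r xs"

text \<open>Each relation is proved in one orientation only, while a mutation may meet the two
  variables and the two monomials in either order.\<close>

definition exchange_any :: "nat \<Rightarrow> nat \<Rightarrow> nat list \<Rightarrow> nat list \<Rightarrow> bool" where
  "exchange_any z z' I J \<longleftrightarrow>
     exchange z z' I J \<or> exchange z z' J I \<or> exchange z' z I J \<or> exchange z' z J I"

datatype mutation_tree = Stop | Mutate nat nat mutation_tree mutation_tree

text \<open>
  \<open>Mutate v z c s\<close> mutates at vertex number \<open>v\<close>, where the variable with index \<open>z\<close> appears, and
  continues with \<open>c\<close> from the new seed and with \<open>s\<close> from the old one.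
\<close>

primrec explore :: "mutation_tree \<Rightarrow> nat list \<Rightarrow> int list list \<Rightarrow> nat list list" where
  "explore Stop ids M = []"
| "explore (Mutate v z c s) ids M =
     (if v < length M \<and> z < 45 \<and>
         exchange_any (ids ! v) z (positive_part ids (M ! v)) (positive_part ids (map uminus (M ! v)))
      then ids[v := z] # explore c (ids[v := z]) ((mutate_rows v (M ! v) M)[v := map uminus (M ! v)]) @
        explore s ids M
      else [])"

lemma prod_list_positive_part:
  fixes f :: "nat \<Rightarrow> 'a::comm_monoid_mult"
  shows "length zs = length ws \<Longrightarrow>
    prod_list (map f (positive_part zs ws)) = (\<Prod>k<length ws. f (zs ! k) ^ nat (ws ! k))"
proof (induction zs ws rule: positive_part.induct)
  case (1 z zs w ws)
  have ins: "prod_list (map f (insort z xs)) = f z * prod_list (map f xs)" for xs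
    by (induction xs) (auto simp: mult.left_commute)
  have "prod_list (map f (positive_part (z # zs) (w # ws))) = f z ^ nat w * prod_list (map f (positive_part zs ws))"
    by (auto simp: ins prod_list_replicate)
  moreover have "prod_list (map f (positive_part zs ws)) = (\<Prod>k<length ws. f (zs ! k) ^ nat (ws ! k))"
    using 1 by auto
  ultimately show ?case by (simp add: prod.lessThan_Suc_shift del: prod.lessThan_Suc positive_part.simps)
qed auto

lemma length_add_positive: "length r = length x \<Longrightarrow> length (add_positive w r x) = length x"
  by (induction w r x rule: add_positive.induct) auto

lemma length_add_negative: "length r = length x \<Longrightarrow> length (add_negative w r x) = length x"
  by (induction w r x rule: add_negative.induct) auto

lemma nth_add_positive:
  "length r = length x \<Longrightarrow> c < length x \<Longrightarrow>
    add_positive w r x ! c = (if 0 < r ! c then x ! c + w * r ! c else x ! c)"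
proof (induction w r x arbitrary: c rule: add_positive.induct)
  case (1 w b bs a as)
  then show ?case by (cases c) auto
qed auto

lemma nth_add_negative:
  "length r = length x \<Longrightarrow> c < length x \<Longrightarrow>
    add_negative w r x ! c = (if r ! c < 0 then x ! c - w * r ! c else x ! c)"
proof (induction w r x arbitrary: c rule: add_negative.induct)
  case (1 w b bs a as)
  then show ?case by (cases c) auto
qed auto

lemma length_mutate_rows: "length (mutate_rows v r xs) = length xs"
  by (induction xs) auto

lemma nth_mutate_rows: "i < length xs \<Longrightarrow> mutate_rows v r xs ! i = mutate_row v r (xs ! i) (xs ! i ! v)"
proof (induction xs arbitrary: i)
  case (Cons x xs)
  then show ?case by (cases i) auto
qed simp

lemma length_mutate_row: "length r = length x \<Longrightarrow> length (mutate_row v r x w) = length x"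
  by (simp add: mutate_row_def length_add_positive length_add_negative)

lemma nth_mutate_row:
  assumes "length r = length x" "c < length x" "w = x ! v"
  shows "mutate_row v r x w ! c =
    (if c = v then - w
     else if 0 < w \<and> 0 < r ! c then x ! c + w * r ! c
     else if w < 0 \<and> r ! c < 0 then x ! c - w * r ! c else x ! c)"
  using assms by (auto simp: mutate_row_def nth_add_positive nth_add_negative
      length_add_positive length_add_negative nth_list_update)

lemma to_fract_prod_list: "to_fract (prod_list xs) = prod_list (map to_fract xs)"
  by (induction xs) simp_all

text \<open>By the exchange relation the numerator of the new variable is
  \<open>cluster_poly (ids ! v) * cluster_poly z\<close>, and dividing by the nonzero old variable
  leaves \<open>cluster_poly z\<close>. The weights follow by comparing \<open>mutate_weight\<close>
  with \<open>mutate_row\<close> case by case.\<close>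

lemma represents_mutate:
  assumes rep: "represents vs m S ids M"
    and v: "v < m" and z: "z < 45"
    and ex: "exchange_any (ids ! v) z (positive_part ids (M ! v)) (positive_part ids (map uminus (M ! v)))"
  shows "represents vs m (mutate (vs ! v) S) (ids[v := z])
      ((mutate_rows v (M ! v) M)[v := map uminus (M ! v)])"
proof -
  let ?L = "length vs" and ?v = "vs ! v"
  have len: "distinct vs" "m \<le> ?L" "length ids = ?L" "length M = m"
    and rowlen: "\<And>r. r < m \<Longrightarrow> length (M ! r) = ?L"
    and vert: "vertices S = set vs" and mutb: "mutables S = set (take m vs)"
    and idv: "\<And>k. k < ?L \<Longrightarrow> ids ! k < 45"
    and var: "\<And>k. k < ?L \<Longrightarrow> variable S (vs ! k) = to_fract (cluster_poly (ids ! k))"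
    and wt: "\<And>r c. r < m \<Longrightarrow> c < ?L \<Longrightarrow> weight S (vs ! r) (vs ! c) = M ! r ! c"
    and wt': "\<And>r c. r < m \<Longrightarrow> c < ?L \<Longrightarrow> weight S (vs ! c) (vs ! r) = - (M ! r ! c)"
    using rep by (auto simp: represents_def)
  have vL: "v < ?L" using v len by simp
  have inj: "vs ! i = vs ! j \<longleftrightarrow> i = j" if "i < ?L" "j < ?L" for i j
    using len(1) that by (simp add: nth_eq_iff_index_eq)
  have prod_vs: "(\<Prod>u\<in>set vs. g u) = (\<Prod>k<?L. g (vs ! k))" for g :: "nat \<times> nat \<Rightarrow> ratfun"
    using prod.reindex_bij_betw[OF bij_betw_nth[OF len(1) refl refl], of g] by simp
  \<comment> \<open>The product may run over all vertices, since \<open>nat\<close> turns a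
    non-positive weight into exponent 0.\<close>
  have part: "(\<Prod>u | u \<in> set vs \<and> 0 < g u. variable S u ^ nat (g u)) =
      to_fract (prod_list (map cluster_poly (positive_part ids ws)))"
    if "length ws = ?L" "\<And>k. k < ?L \<Longrightarrow> g (vs ! k) = ws ! k" for g ws
  proof -
    have "(\<Prod>u | u \<in> set vs \<and> 0 < g u. variable S u ^ nat (g u)) = (\<Prod>u\<in>set vs. variable S u ^ nat (g u))"
    proof (rule prod.mono_neutral_left)
      show "\<forall>u\<in>set vs - {u \<in> set vs. 0 < g u}. variable S u ^ nat (g u) = 1"
      proof
        fix u assume "u \<in> set vs - {u \<in> set vs. 0 < g u}"
        then have "g u \<le> 0" by auto
        then show "variable S u ^ nat (g u) = 1" by simp
      qed
    qed auto
    also have "\<dots> = (\<Prod>k<?L. to_fract (cluster_poly (ids ! k)) ^ nat (ws ! k))"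
      unfolding prod_vs using that(2) var by (intro prod.cong) auto
    also have "\<dots> = prod_list (map (\<lambda>z. to_fract (cluster_poly z)) (positive_part ids ws))"
      using prod_list_positive_part[of ids ws "\<lambda>z. to_fract (cluster_poly z)"] that(1) len(3) by simp
    finally show ?thesis by (simp add: to_fract_prod_list comp_def)
  qed
  have "(\<Prod>u\<in>In S ?v. variable S u ^ nat (weight S u ?v)) =
      to_fract (prod_list (map cluster_poly (positive_part ids (map uminus (M ! v)))))"
    unfolding In_def vert by (rule part) (use v rowlen wt' in auto)
  moreover have "(\<Prod>u\<in>Out S ?v. variable S u ^ nat (weight S ?v u)) =
      to_fract (prod_list (map cluster_poly (positive_part ids (M ! v))))"
    unfolding Out_def vert by (rule part) (use v rowlen wt in auto)
  moreover have "cluster_poly (ids ! v) * cluster_poly z =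
      prod_list (map cluster_poly (positive_part ids (map uminus (M ! v)))) +
      prod_list (map cluster_poly (positive_part ids (M ! v)))"
    using ex by (auto simp: exchange_any_def exchange_def mult.commute add.commute)
  ultimately have "mutate_variable S ?v = to_fract (cluster_poly (ids ! v) * cluster_poly z) / to_fract (cluster_poly (ids ! v))"
    unfolding mutate_variable_def by (simp add: var[OF vL])
  also have "\<dots> = to_fract (cluster_poly z)"
    using cluster_poly_nonzero[OF idv[OF vL]] by simp
  finally have new: "mutate_variable S ?v = to_fract (cluster_poly z)" .
  have wvv: "M ! v ! v = 0" using wt[OF v vL] wt'[OF v vL] by simp
  have inout: "vs ! c \<in> In S ?v \<longleftrightarrow> M ! v ! c < 0" "vs ! c \<in> Out S ?v \<longleftrightarrow> 0 < M ! v ! c"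
    if "c < ?L" for c
    using that wt[OF v that] wt'[OF v that] by (auto simp: In_def Out_def vert)
  \<comment> \<open>For a mutable vertex the same membership can be read off its own row at
    \<open>v\<close>; by skew-symmetry the sign is opposite to that in row \<open>v\<close>.\<close>
  have inout': "vs ! r \<in> In S ?v \<longleftrightarrow> 0 < M ! r ! v" "vs ! r \<in> Out S ?v \<longleftrightarrow> M ! r ! v < 0"
    if "r < m" for r
    using that len wt[OF that vL] wt'[OF that vL] by (auto simp: In_def Out_def vert)
  have wts: "mutate_weight S ?v (vs ! r) (vs ! c) = (mutate_rows v (M ! v) M)[v := map uminus (M ! v)] ! r ! c \<and>
      mutate_weight S ?v (vs ! c) (vs ! r) = - ((mutate_rows v (M ! v) M)[v := map uminus (M ! v)] ! r ! c)"
    if rc: "r < m" "c < ?L" for r c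
  proof (cases "r = v")
    case True
    then show ?thesis using rc v wt wt' rowlen len by (simp add: mutate_weight_def length_mutate_rows)
  next
    case False
    have rL: "r < ?L" using rc len by simp
    have "(mutate_rows v (M ! v) M)[v := map uminus (M ! v)] ! r ! c =
       mutate_row v (M ! v) (M ! r) (M ! r ! v) ! c"
      using False rc len by (simp add: nth_mutate_rows)
    also have "\<dots> = (if c = v then - (M ! r ! v)
      else if 0 < M ! r ! v \<and> 0 < M ! v ! c then M ! r ! c + M ! r ! v * M ! v ! c
      else if M ! r ! v < 0 \<and> M ! v ! c < 0 then M ! r ! c - M ! r ! v * M ! v ! c else M ! r ! c)"
      using rc v rowlen by (intro nth_mutate_row) auto
    finally have eq: "(mutate_rows v (M ! v) M)[v := map uminus (M ! v)] ! r ! c = \<dots>" .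
    show ?thesis
      unfolding eq mutate_weight_def
      using rc False inj[OF rL vL] inj[OF rc(2) vL] inout[OF rc(2)] inout'[OF rc(1)] wt[OF rc] wt'[OF rc]
        wt[OF rc(1) vL] wt'[OF rc(1) vL] wt[OF v rc(2)] wt'[OF v rc(2)]
      by auto
  qed
  show ?thesis
    unfolding represents_def
    using len vert mutb wts new var idv z inj vL v rowlen
    by (auto simp: mutate_def vertices_def nth_list_update length_mutate_rows nth_mutate_rows length_mutate_row)
qed

text \<open>This holds for every tree, because a step whose check fails contributes no list. The
  part \<open>drop m\<close> is constant: mutations never touch frozen vertices.\<close>

lemma explore_reaches_seeds:
  assumes "represents vs m S ids M" "S \<in> seeds n" "X \<in> set (explore t ids M)"
  shows "\<exists>S'\<in>seeds n. \<exists>M'. represents vs m S' X M' \<and> drop m X = drop m ids"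
  using assms
proof (induction t arbitrary: S ids M)
  case (Mutate v z c s)
  let ?ids = "ids[v := z]" and ?M = "(mutate_rows v (M ! v) M)[v := map uminus (M ! v)]"
  have "length M = m" using Mutate.prems(1) by (simp add: represents_def)
  then have v: "v < m" "z < 45"
    and ex: "exchange_any (ids ! v) z (positive_part ids (M ! v)) (positive_part ids (map uminus (M ! v)))"
    and X: "X = ?ids \<or> X \<in> set (explore c ?ids ?M) \<or> X \<in> set (explore s ids M)"
    using Mutate.prems(3) by (auto split: if_splits)
  have rep: "represents vs m (mutate (vs ! v) S) ?ids ?M"
    using represents_mutate[OF Mutate.prems(1) v ex] .
  have "vs ! v \<in> mutables S"
    using Mutate.prems(1) v(1) by (auto simp: represents_def in_set_conv_nth intro!: exI[of _ v])
  then have seed: "mutate (vs ! v) S \<in> seeds n" using Mutate.prems(2) by (intro seeds.mutation)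
  have dr: "drop m ?ids = drop m ids" using v(1) by simp
  from X show ?case
  proof (elim disjE)
    assume "X = ?ids"
    then show ?thesis using rep seed dr by blast
  next
    assume "X \<in> set (explore c ?ids ?M)"
    then show ?thesis using Mutate.IH(1)[OF rep seed] dr by simp
  next
    assume "X \<in> set (explore s ids M)"
    then show ?thesis using Mutate.IH(2)[OF Mutate.prems(1,2)] by blast
  qed
qed simp

text \<open>\<open>represents\<close> does not record that the indices are distinct. Hence the
  coefficient of an index is placed on the first vertex \<open>pos\<close> carrying it, and other
  vertices with that index get 0.\<close>

lemma cone_over_subset_seed_cone:
  assumes rep: "represents vs m S ids M"
    and lab: "\<And>k. k < length vs \<Longrightarrow> set (concat (label (ids ! k))) \<subseteq> {1..n}"
    and d: "\<And>z. z \<in> set ids \<Longrightarrow> 0 \<le> d z"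
  shows "(\<lambda>i j. \<Sum>z\<in>set ids. d z * tableau_array (label z) i j) \<in> seed_cone n S"
proof -
  let ?L = "length vs"
  have len: "distinct vs" "length ids = ?L" and vert: "vertices S = set vs"
    and idv: "\<And>k. k < ?L \<Longrightarrow> ids ! k < 45"
    and var: "\<And>k. k < ?L \<Longrightarrow> variable S (vs ! k) = to_fract (cluster_poly (ids ! k))"
    using rep by (auto simp: represents_def)
  define pos where "pos z = (LEAST k. k < ?L \<and> ids ! k = z)" for z
  have pos: "pos z < ?L \<and> ids ! pos z = z" if "z \<in> set ids" for z
  proof -
    have "\<exists>k. k < ?L \<and> ids ! k = z" using that len by (auto simp: in_set_conv_nth)
    then show ?thesis unfolding pos_def by (rule LeastI_ex)
  qed
  define idx where "idx u = (LEAST k. k < ?L \<and> vs ! k = u)" for u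
  have idx: "idx (vs ! k) = k" if "k < ?L" for k
    unfolding idx_def using that len(1) by (intro Least_equality) (auto simp: nth_eq_iff_index_eq)
  define c where "c u = (let k = idx u in if pos (ids ! k) = k then d (ids ! k) else 0)" for u
  define T where "T u = label (ids ! idx u)" for u
  have "(\<Sum>u\<in>set vs. c u * tableau_array (T u) i j) = (\<Sum>z\<in>set ids. d z * tableau_array (label z) i j)" for i j
  proof -
    have "(\<Sum>u\<in>set vs. c u * tableau_array (T u) i j) = (\<Sum>u\<in>(\<lambda>z. vs ! pos z) ` set ids. c u * tableau_array (T u) i j)"
    proof (rule sum.mono_neutral_right)
      show "\<forall>u\<in>set vs - (\<lambda>z. vs ! pos z) ` set ids. c u * tableau_array (T u) i j = 0"
      proof
        fix u assume u: "u \<in> set vs - (\<lambda>z. vs ! pos z) ` set ids"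
        then obtain k where k: "k < ?L" "u = vs ! k" by (auto simp: in_set_conv_nth)
        have "ids ! k \<in> set ids" using k len by simp
        have "pos (ids ! k) \<noteq> k"
        proof
          assume "pos (ids ! k) = k"
          then have "u = (\<lambda>z. vs ! pos z) (ids ! k)" by (simp add: k)
          then show False using u \<open>ids ! k \<in> set ids\<close> by blast
        qed
        then show "c u * tableau_array (T u) i j = 0" by (simp add: c_def k idx)
      qed
    qed (use pos in auto)
    also have "\<dots> = (\<Sum>z\<in>set ids. c (vs ! pos z) * tableau_array (T (vs ! pos z)) i j)"
    proof (rule sum.reindex_cong[OF _ refl refl])
      show "inj_on (\<lambda>z. vs ! pos z) (set ids)"
      proof (rule inj_onI)
        fix y z assume "y \<in> set ids" "z \<in> set ids" "vs ! pos y = vs ! pos z"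
        then show "y = z" using pos[of y] pos[of z] idx by metis
      qed
    qed
    also have "\<dots> = (\<Sum>z\<in>set ids. d z * tableau_array (label z) i j)"
      using pos idx by (intro sum.cong) (auto simp: c_def T_def)
    finally show ?thesis .
  qed
  then have "(\<lambda>i j. \<Sum>z\<in>set ids. d z * tableau_array (label z) i j) = (\<lambda>i j. \<Sum>v\<in>vertices S. c v * tableau_array (T v) i j)"
    by (simp add: vert)
  moreover have "\<forall>v\<in>vertices S. 0 \<le> c v \<and> is_label n (variable S v) (T v)"
  proof
    fix u assume "u \<in> vertices S"
    then obtain k where k: "k < ?L" "u = vs ! k" by (auto simp: vert in_set_conv_nth)
    then show "0 \<le> c u \<and> is_label n (variable S u) (T u)"
      using d[of "ids ! k"] len is_label_cluster_poly[OF idv lab] by (simp add: c_def T_def idx var)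
  qed
  ultimately show ?thesis unfolding seed_cone_def by blast
qed

section \<open>Straightening\<close>

text \<open>Bolzano-Weierstrass for finitely many coordinates: for each further coordinate a
  monotone subsequence is extracted, which converges because it is bounded.\<close>

lemma common_convergent_subsequence:
  fixes s :: "nat \<Rightarrow> 'b \<Rightarrow> real"
  assumes "finite Z" "\<And>z k. z \<in> Z \<Longrightarrow> 0 \<le> s k z \<and> s k z \<le> B z"
  shows "\<exists>r l. strict_mono (r :: nat \<Rightarrow> nat) \<and> (\<forall>z\<in>Z. (\<lambda>k. s (r k) z) \<longlonglongrightarrow> l z)"
  using assms
proof (induction Z rule: finite_induct)
  case empty
  then show ?case by (auto intro: exI[of _ id] strict_mono_id)
next
  case (insert x Z)
  then obtain r l where r: "strict_mono (r :: nat \<Rightarrow> nat)" "\<forall>z\<in>Z. (\<lambda>k. s (r k) z) \<longlonglongrightarrow> l z"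
    by (meson insertCI)
  obtain q where q: "strict_mono (q :: nat \<Rightarrow> nat)" "monoseq (\<lambda>k. s (r (q k)) x)"
    using seq_monosub[of "\<lambda>k. s (r k) x"] by blast
  have "Bseq (\<lambda>k. s (r (q k)) x)"
    using insert.prems[of x] by (intro BseqI'[of _ "B x"]) (auto simp: abs_of_nonneg)
  then obtain y where y: "(\<lambda>k. s (r (q k)) x) \<longlonglongrightarrow> y"
    using q(2) Bseq_monoseq_convergent by (auto simp: convergent_def)
  have "(\<lambda>k. s (r (q k)) z) \<longlonglongrightarrow> (l(x := y)) z" if "z \<in> insert x Z" for z
  proof (cases "z = x")
    case False
    then have "(\<lambda>k. s (r k) z) \<longlonglongrightarrow> l z" using r(2) that by simp
    then show ?thesis using LIMSEQ_subseq_LIMSEQ[OF _ q(1)] False by (fastforce simp: comp_def)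
  qed (use y in simp)
  moreover have "strict_mono (\<lambda>k. r (q k))" using r(1) q(1) by (simp add: strict_mono_def)
  ultimately show ?case by blast
qed

text \<open>
  Among all nonnegative representations of an array take one minimizing the total potential: a pair
  of generators with a straightening relation cannot both occur in it.
\<close>

lemma cone_over_straightened:
  fixes A :: "'b \<Rightarrow> array" and h :: "'b \<Rightarrow> real"
  assumes fin: "finite Z" and nonneg: "\<And>z i j. z \<in> Z \<Longrightarrow> 0 \<le> A z i j"
    and pos: "\<And>z. z \<in> Z \<Longrightarrow> \<exists>i j. 1 \<le> A z i j"
    and straight: "\<And>x y. x \<in> Z \<Longrightarrow> y \<in> Z \<Longrightarrow> bad x y \<Longrightarrow> x \<noteq> y \<and>
      (\<exists>c. (\<forall>z\<in>Z. 0 \<le> c z) \<and> (\<forall>i j. A x i j + A y i j = (\<Sum>z\<in>Z. c z * A z i j)) \<and>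
        (\<Sum>z\<in>Z. c z * h z) < h x + h y)"
    and a: "a \<in> cone_over Z A"
  obtains d where "\<And>z. z \<in> Z \<Longrightarrow> 0 \<le> d z" "a = (\<lambda>i j. \<Sum>z\<in>Z. d z * A z i j)"
    "\<And>x y. x \<in> Z \<Longrightarrow> y \<in> Z \<Longrightarrow> 0 < d x \<Longrightarrow> 0 < d y \<Longrightarrow> \<not> bad x y"
proof -
  define rep where "rep d \<longleftrightarrow> (\<forall>z\<in>Z. 0 \<le> d z) \<and> (\<forall>i j. a i j = (\<Sum>z\<in>Z. d z * A z i j))" for d :: "'b \<Rightarrow> real"
  define w where "w d = (\<Sum>z\<in>Z. d z * h z)" for d
  obtain d0 where d0: "rep d0" using a by (auto simp: cone_over_def rep_def)
  \<comment> \<open>A generator with an entry at least 1 at \<open>(i, j)\<close> has coefficient at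
    most \<open>a i j\<close>, as nothing cancels. This bounds the set of representations, and with
    it the potential from below.\<close>
  obtain B where B: "\<And>z d. z \<in> Z \<Longrightarrow> rep d \<Longrightarrow> d z \<le> B z"
  proof -
    have "\<exists>b. \<forall>d. rep d \<longrightarrow> d z \<le> b" if z: "z \<in> Z" for z
    proof -
      obtain i j where ij: "1 \<le> A z i j" using pos z by blast
      have "d z \<le> a i j" if d: "rep d" for d
      proof -
        have "d z * 1 \<le> d z * A z i j" using d z ij by (intro mult_left_mono) (auto simp: rep_def)
        also have "\<dots> \<le> (\<Sum>z\<in>Z. d z * A z i j)"
          using d fin z nonneg by (intro member_le_sum) (auto simp: rep_def)
        finally show ?thesis using d by (simp add: rep_def)
      qed
      then show ?thesis by blast
    qed
    then show ?thesis using that by metis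
  qed
  have lower: "(\<Sum>z\<in>Z. - (B z * \<bar>h z\<bar>)) \<le> w d" if d: "rep d" for d
    unfolding w_def
  proof (intro sum_mono)
    fix z assume z: "z \<in> Z"
    have "0 \<le> d z" using d z by (simp add: rep_def)
    then have "- (d z * h z) \<le> d z * \<bar>h z\<bar>"
      using abs_ge_minus_self[of "h z"] mult_left_mono[of "- h z" "\<bar>h z\<bar>" "d z"] by simp
    also have "\<dots> \<le> B z * \<bar>h z\<bar>" using B[OF z d] by (intro mult_right_mono) auto
    finally show "- (B z * \<bar>h z\<bar>) \<le> d z * h z" by simp
  qed
  define I where "I = Inf (w ` {d. rep d})"
  have bdd: "bdd_below (w ` {d. rep d})" using lower by (intro bdd_belowI[of _ "\<Sum>z\<in>Z. - (B z * \<bar>h z\<bar>)"]) auto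
  have I_le: "I \<le> w d" if "rep d" for d unfolding I_def using that bdd by (intro cInf_lower) auto
  \<comment> \<open>A minimising sequence; the limit of a subsequence is again a representation and
    attains the infimum.\<close>
  have "\<exists>d. rep d \<and> w d < I + 1 / real (Suc k)" for k
  proof -
    have "Inf (w ` {d. rep d}) < I + 1 / real (Suc k)" by (simp add: I_def)
    then show ?thesis using d0 cInf_lessD[of "w ` {d. rep d}"] by blast
  qed
  then obtain s where s: "\<And>k. rep (s k)" "\<And>k. w (s k) < I + 1 / real (Suc k)" by metis
  have "0 \<le> s k z \<and> s k z \<le> B z" if "z \<in> Z" for k z
    using s(1)[of k] B[OF that s(1)] that by (simp add: rep_def)
  from common_convergent_subsequence[OF fin, of s B, OF this]
  obtain r l where r: "strict_mono (r :: nat \<Rightarrow> nat)" and l: "\<And>z. z \<in> Z \<Longrightarrow> (\<lambda>k. s (r k) z) \<longlonglongrightarrow> l z"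
    by blast
  have "rep l"
    unfolding rep_def
  proof (intro conjI ballI allI)
    show "0 \<le> l z" if "z \<in> Z" for z
      using l[OF that] s(1) that by (intro LIMSEQ_le_const[OF l[OF that]]) (auto simp: rep_def)
    fix i j
    have "(\<lambda>k. \<Sum>z\<in>Z. s (r k) z * A z i j) \<longlonglongrightarrow> (\<Sum>z\<in>Z. l z * A z i j)"
      using l by (intro tendsto_sum tendsto_mult_right) auto
    moreover have "(\<lambda>k. \<Sum>z\<in>Z. s (r k) z * A z i j) = (\<lambda>k. a i j)" using s(1) by (auto simp: rep_def)
    ultimately show "a i j = (\<Sum>z\<in>Z. l z * A z i j)" using LIMSEQ_unique[OF tendsto_const] by simp
  qed
  have "(\<lambda>k. w (s (r k))) \<longlonglongrightarrow> w l"
    unfolding w_def using l by (intro tendsto_sum tendsto_mult_right) auto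
  moreover have "(\<lambda>k. w (s (r k))) \<longlonglongrightarrow> I"
  proof (rule tendsto_sandwich)
    show "(\<lambda>k. I) \<longlonglongrightarrow> I" by simp
    have "(\<lambda>k. I + 1 / real (Suc k)) \<longlonglongrightarrow> I + 0"
      using lim_1_over_n by (intro tendsto_add tendsto_const LIMSEQ_Suc) simp
    then show "(\<lambda>k. I + 1 / real (Suc (r k))) \<longlonglongrightarrow> I"
      using LIMSEQ_subseq_LIMSEQ[OF _ r] by (fastforce simp: comp_def)
    show "\<forall>\<^sub>F k in sequentially. I \<le> w (s (r k))" using I_le s(1) by simp
    show "\<forall>\<^sub>F k in sequentially. w (s (r k)) \<le> I + 1 / real (Suc (r k))"
      using s(2) by (intro always_eventually allI less_imp_le) blast
  qed
  ultimately have wl: "w l = I" by (rule LIMSEQ_unique)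
  have not_bad: "\<not> bad x y" if xy: "x \<in> Z" "y \<in> Z" "0 < l x" "0 < l y" for x y
  proof
    assume "bad x y"
    then obtain c where c: "x \<noteq> y" "\<forall>z\<in>Z. 0 \<le> c z" "\<forall>i j. A x i j + A y i j = (\<Sum>z\<in>Z. c z * A z i j)"
      "(\<Sum>z\<in>Z. c z * h z) < h x + h y"
      using straight[OF xy(1,2)] by blast
    \<comment> \<open>The amount of \<open>x\<close> and \<open>y\<close> that is replaced by the
      right side of their straightening relation.\<close>
    define e where "e = min (l x) (l y)"
    have e: "0 < e" "e \<le> l x" "e \<le> l y" using xy by (auto simp: e_def)
    \<comment> \<open>Since \<open>x\<close> and \<open>y\<close> differ, each of their coefficients
      loses \<open>e\<close> only once and stays non-negative.\<close>
    define d where "d z = l z - e * of_bool (z = x) - e * of_bool (z = y) + e * c z" for z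
    have shift: "(\<Sum>z\<in>Z. d z * g z) = (\<Sum>z\<in>Z. l z * g z) - e * (g x + g y) + e * (\<Sum>z\<in>Z. c z * g z)" for g
    proof -
      have delta: "(\<Sum>z\<in>Z. of_bool (z = v) * g z) = g v" if "v \<in> Z" for v
        using that fin by (simp add: of_bool_def if_distrib[of "\<lambda>t. t * _"] cong: if_cong)
      have "(\<Sum>z\<in>Z. d z * g z) = (\<Sum>z\<in>Z. l z * g z - e * (of_bool (z = x) * g z) - e * (of_bool (z = y) * g z) + e * (c z * g z))"
        by (intro sum.cong) (auto simp: d_def algebra_simps)
      also have "\<dots> = (\<Sum>z\<in>Z. l z * g z) - e * (\<Sum>z\<in>Z. of_bool (z = x) * g z) -
          e * (\<Sum>z\<in>Z. of_bool (z = y) * g z) + e * (\<Sum>z\<in>Z. c z * g z)"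
        by (simp only: sum.distrib sum_subtractf sum_distrib_left)
      finally show ?thesis using delta xy by (simp add: algebra_simps)
    qed
    have "rep d"
      unfolding rep_def
    proof (intro conjI ballI allI)
      show "0 \<le> d z" if "z \<in> Z" for z
        using that c(1,2) e \<open>rep l\<close> by (auto simp: d_def rep_def)
      show "a i j = (\<Sum>z\<in>Z. d z * A z i j)" for i j
        using \<open>rep l\<close> c(3) by (simp add: shift[of "\<lambda>z. A z i j"] rep_def)
    qed
    then have "I \<le> w d" by (rule I_le)
    also have "w d = w l - e * (h x + h y - (\<Sum>z\<in>Z. c z * h z))" by (simp add: w_def shift algebra_simps)
    also have "\<dots> < w l" using e(1) c(4) by simp
    finally show False using wl by simp
  qed
  have "a = (\<lambda>i j. \<Sum>z\<in>Z. l z * A z i j)" "\<And>z. z \<in> Z \<Longrightarrow> 0 \<le> l z"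
    using \<open>rep l\<close> by (auto simp: rep_def fun_eq_iff)
  then show thesis using that[of l] not_bad by blast
qed

text \<open>
  The potentials are found by a search: every relation in \<open>straightening\<close> has to decrease them.
\<close>

definition potentials :: "nat list" where
  "potentials =
     [30, 32, 29, 31, 31, 32, 32, 26, 28, 20, 16, 15, 17, 16, 18, 12, 11, 11, 23, 29, 22, 17, 20,
     20, 16, 20, 18, 26, 12, 28, 15, 16, 17, 11, 11, 17, 1, 0, 1, 3, 3, 1, 0, 1, 3]"

definition potential :: "nat \<Rightarrow> nat" where
  "potential z = potentials ! z"

text \<open>
  A pair \<open>(z', D)\<close> in the list at \<open>z\<close> records that \<open>z\<close> and \<open>z'\<close> are incompatible, and that the arrays of
  their labels have the same sum as those of the labels in \<open>D\<close>.
\<close>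

definition straightening :: "(nat \<times> (nat \<times> nat list) list) list" where
  "straightening =
    [(0, [(1,[2,13,31]), (3,[9,37,41,42]), (4,[22,36,37,42]), (5,[10,19,24]), (6,[17,33,37,42]),
      (7,[9,10,24]), (8,[17,36,37,42]), (11,[9,10,42]), (12,[10,36,42]), (14,[10,19,42]),
      (16,[10,24,36]), (20,[36,37,41,42]), (21,[10,33,42]), (23,[10,24,33]), (25,[13,17,31]),
      (26,[2,31,37]), (27,[13,22,31]), (29,[33,37,41,42]), (30,[22,31,37]), (32,[31,37,41]),
      (34,[13,31,41]), (35,[17,31,37])]),
     (1, [(3,[15,34,37,42]), (4,[12,26,27]), (5,[0,18]), (6,[4,25,43]), (7,[0,15]), (8,[12,25,26]),
      (9,[13,15,31]), (10,[2,13]), (11,[13,15,42]), (14,[13,18,42]), (16,[2,36]), (19,[13,18,31]),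
      (20,[12,26,34]), (21,[12,27,43]), (23,[22,36,43]), (24,[2,31]), (29,[4,34,43]), (30,[26,27]),
      (32,[26,34]), (33,[27,36,43]), (35,[25,26])]),
     (2, [(3,[15,37,41,42]), (4,[12,22,26]), (5,[10,18,24]), (6,[4,17,43]), (7,[10,15,24]),
      (8,[12,17,26]), (9,[0,15]), (11,[10,15,42]), (14,[10,18,42]), (19,[0,18]), (20,[12,26,41]),
      (21,[12,22,43]), (23,[16,22,43]), (25,[1,17]), (27,[1,22]), (29,[4,41,43]), (30,[22,26]),
      (32,[26,41]), (33,[22,36,43]), (34,[1,41]), (35,[17,26])]),
     (3, [(4,[20,37,42]), (5,[7,14,32]), (6,[11,29,35]), (8,[11,20,35]), (10,[11,37,41]),
      (12,[11,20]), (13,[11,34,37]), (17,[11,35,41]), (18,[14,15,32]), (19,[9,14,32]), (21,[11,29]),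
      (22,[37,41,42]), (24,[7,32,42]), (25,[11,34,35]), (26,[15,32,37,42]), (27,[34,37,42]),
      (28,[14,32]), (30,[32,37,42]), (31,[9,32,42])]),
     (4, [(5,[16,28,37,42]), (6,[8,21,30]), (7,[16,37,42]), (9,[36,37,42]), (10,[12,22,37]),
      (11,[12,37,42]), (13,[12,27,37]), (14,[12,28,37,42]), (15,[12,26]), (18,[12,26,28]),
      (19,[28,36,37,42]), (23,[16,21,30]), (24,[16,30,42]), (29,[20,21,30]), (31,[30,36,42]),
      (32,[20,30]), (33,[21,30,36]), (35,[8,30])]),
     (5, [(6,[3,23,38]), (8,[3,16,38]), (11,[7,14]), (12,[14,16]), (13,[10,19]), (17,[7,38,41]),
      (20,[14,16,32]), (21,[14,23]), (22,[10,24,28]), (25,[9,38,41]), (26,[18,24,37]), (27,[0,28]),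
      (29,[14,23,32]), (30,[24,28,37]), (31,[19,24]), (34,[19,41]), (35,[7,32,38])]),
     (6, [(7,[11,23,35]), (9,[11,33,35]), (10,[17,21,37]), (12,[8,21]), (13,[21,25,37]),
      (14,[11,29,38]), (15,[8,43]), (18,[20,38,43]), (19,[3,33,38]), (22,[17,21,30]),
      (24,[23,35,42]), (26,[8,30,43]), (27,[21,25,30]), (28,[29,38]), (31,[33,35,42]),
      (32,[29,35])]),
     (7, [(8,[11,16,35]), (12,[11,16]), (13,[9,10]), (18,[5,15]), (19,[5,9]), (20,[3,16]),
      (21,[11,23]), (22,[10,24]), (25,[9,17]), (26,[15,24,37]), (27,[0]), (28,[5]), (29,[3,23]),
      (30,[24,37]), (31,[9,24]), (34,[9,41])]),
     (8, [(9,[11,35,36]), (10,[12,17,37]), (13,[12,25,37]), (14,[11,20,38]), (18,[15,20,38]),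
      (19,[3,36,38]), (22,[4,17]), (23,[6,16]), (24,[16,35,42]), (27,[4,25]), (28,[20,38]),
      (29,[6,20]), (31,[35,36,42]), (32,[20,35]), (33,[6,36])]),
     (9, [(12,[11,36]), (16,[7,36]), (18,[15,19]), (20,[3,36]), (21,[11,33]), (22,[0]),
      (23,[7,33]), (26,[15,31,37]), (27,[13,31]), (28,[19]), (29,[3,33]), (30,[31,37])]),
     (10, [(20,[12,37,41]), (25,[13,17]), (26,[2,37]), (27,[13,22]), (29,[21,37,41]), (30,[22,37]),
      (31,[0]), (32,[37,41]), (34,[13,41]), (35,[17,37])]),
     (11, [(18,[14,15]), (19,[9,14]), (22,[10,42]), (24,[7,42]), (26,[15,37,42]), (27,[13,42]),
      (28,[14]), (30,[37,42]), (31,[9,42]), (32,[3])]),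
     (12, [(19,[14,36]), (23,[16,21]), (24,[16,42]), (29,[20,21]), (30,[4]), (31,[36,42]),
      (32,[20]), (33,[21,36]), (35,[8])]),
     (13, [(16,[10,36]), (20,[12,34,37]), (23,[10,33]), (24,[0]), (26,[1,37]), (29,[21,34,37]),
      (30,[27,37]), (32,[34,37]), (35,[25,37])]),
     (14, [(17,[11,38,41]), (22,[10,28,42]), (24,[5,42]), (25,[11,34,38]), (26,[18,37,42]),
      (27,[13,28,42]), (30,[28,37,42]), (31,[19,42]), (35,[3,38])]),
     (15, [(21,[12,43]), (22,[2]), (23,[16,43]), (27,[1]), (28,[18]), (29,[20,43]), (30,[26]),
      (33,[36,43])]),
     (16, [(19,[5,36]), (25,[17,36]), (27,[22,36]), (31,[24,36]), (33,[23,36]), (34,[36,41])]),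
     (17, [(18,[15,38,41]), (19,[9,38,41]), (20,[8,41]), (28,[38,41]), (29,[6,41]), (32,[35,41]),
      (34,[25,41])]),
     (18, [(21,[12,28,43]), (22,[2,28]), (23,[16,28,43]), (25,[15,34,38]), (27,[1,28]),
      (29,[20,28,43]), (30,[26,28]), (33,[28,36,43]), (35,[15,32,38])]),
     (19, [(20,[14,32,36]), (21,[14,33]), (22,[0,28]), (23,[5,33]), (25,[9,34,38]),
      (26,[18,31,37]), (27,[13,28,31]), (29,[14,32,33]), (30,[28,31,37]), (35,[9,32,38])]),
     (20, [(22,[4,41]), (23,[16,29]), (24,[16,32,42]), (25,[8,34]), (27,[4,34]), (31,[32,36,42]),
      (33,[29,36])]),
     (21, [(24,[23,42]), (26,[4,43]), (31,[33,42]), (32,[29]), (35,[6])]),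
     (22, [(25,[17,27]), (29,[21,30,41]), (32,[30,41]), (34,[27,41]), (35,[17,30])]),
     (23, [(25,[17,33]), (26,[16,30,43]), (27,[22,33]), (31,[24,33]), (34,[33,41])]),
     (24, [(25,[17,31]), (27,[22,31]), (29,[23,32,42]), (34,[31,41])]),
     (25, [(28,[34,38]), (29,[6,34]), (32,[34,35])]),
     (26, [(29,[20,30,43]), (33,[30,36,43])]),
     (27, [(29,[21,30,34]), (32,[30,34]), (35,[25,30])]),
     (28, [(35,[32,38])]),
     (29, [(31,[32,33,42])]),
     (30, []),
     (31, []),
     (32, []),
     (33, []),
     (34, []),
     (35, [])]"

section \<open>Verification of the straightening relations and of the generators\<close>

lemma label_simps:
  "label 0 = [[1,2],[3,4],[5]]" "label 1 = [[1,4],[3],[5]]" "label 2 = [[2,4],[3],[5]]" "label 3 =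
  [[1,3],[2,4],[4],[5]]"
  "label 4 = [[1,3],[2],[5]]" "label 5 = [[1,2],[2,4],[3],[5]]" "label 6 = [[1,3],[2,5],[4]]" "label 7 =
  [[2],[4]]"
  "label 8 = [[1,3],[2],[4]]" "label 9 = [[1],[4]]" "label 10 = [[2],[3]]" "label 11 = [[3],[4]]"
  "label 12 = [[3]]" "label 13 = [[1],[3]]" "label 14 = [[1,3],[2,4],[3],[5]]" "label 15 = [[4]]"
  "label 16 = [[2]]" "label 17 = [[2],[3],[4]]" "label 18 = [[1,4],[2],[3],[5]]" "label 19 =
  [[1,1],[2,4],[3],[5]]"
  "label 20 = [[1,3],[2],[4],[5]]" "label 21 = [[3],[5]]" "label 22 = [[2],[3],[5]]" "label 23 = [[2],[5]]"
  "label 24 = [[2],[4],[5]]" "label 25 = [[1],[3],[4]]" "label 26 = [[1,4],[2],[5]]" "label 27 =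
  [[1],[3],[5]]"
  "label 28 = [[1],[2],[3],[5]]" "label 29 = [[1,3],[2,5],[4],[5]]" "label 30 = [[1],[2],[5]]" "label 31 =
  [[1],[4],[5]]"
  "label 32 = [[1],[2],[4],[5]]" "label 33 = [[1],[5]]" "label 34 = [[1],[3],[4],[5]]" "label 35 =
  [[1],[2],[4]]"
  "label 36 = [[1]]" "label 37 = [[1],[2]]" "label 38 = [[1],[2],[3]]" "label 39 = [[1],[2],[3],[4]]"
  "label 40 = [[1],[2],[3],[4],[5]]" "label 41 = [[2],[3],[4],[5]]" "label 42 = [[3],[4],[5]]" "label 43 =
  [[4],[5]]"
  "label 44 = [[5]]"
  by (simp_all add: label_def cluster_table_def del: One_nat_def)

lemma potential_simps:
  "potential 0 = 30" "potential 1 = 32" "potential 2 = 29" "potential 3 = 31" "potential 4 = 31" "potential 5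
  = 32"
  "potential 6 = 32" "potential 7 = 26" "potential 8 = 28" "potential 9 = 20" "potential 10 = 16" "potential
  11 = 15"
  "potential 12 = 17" "potential 13 = 16" "potential 14 = 18" "potential 15 = 12" "potential 16 = 11"
  "potential 17 = 11"
  "potential 18 = 23" "potential 19 = 29" "potential 20 = 22" "potential 21 = 17" "potential 22 = 20"
  "potential 23 = 20"
  "potential 24 = 16" "potential 25 = 20" "potential 26 = 18" "potential 27 = 26" "potential 28 = 12"
  "potential 29 = 28"
  "potential 30 = 15" "potential 31 = 16" "potential 32 = 17" "potential 33 = 11" "potential 34 = 11"
  "potential 35 = 17"
  "potential 36 = 1" "potential 37 = 0" "potential 38 = 1" "potential 39 = 3" "potential 40 = 3" "potential 41
  = 1"
  "potential 42 = 0" "potential 43 = 1" "potential 44 = 3"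
  by (simp_all add: potential_def potentials_def del: One_nat_def)

text \<open>Arrays only count entries per row, so they add under concatenation of rows, even if the
  result is not a semi-standard tableau.\<close>

fun add_rows :: "tableau \<Rightarrow> tableau \<Rightarrow> tableau" where
  "add_rows (R # T) (S # U) = (R @ S) # add_rows T U"
| "add_rows [] U = U"
| "add_rows T [] = T"

lemma tableau_array_0: "tableau_array T i 0 = 0"
  by (simp add: tableau_array_def)

lemma tableau_array_Nil: "tableau_array [] i j = 0"
  by (simp add: tableau_array_def)

lemma tableau_array_Cons_Suc:
  "tableau_array (R # T) i (Suc j) = (if j = 0 then real (count_list R i) else tableau_array T i j)"
  by (cases j) (auto simp: tableau_array_def)

lemma tableau_array_add_rows: "tableau_array (add_rows T U) i j = tableau_array T i j + tableau_array U i j"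
proof (induction T U arbitrary: j rule: add_rows.induct)
  case (1 R T S U)
  then show ?case by (cases j) (auto simp: tableau_array_0 tableau_array_Cons_Suc count_list_append)
qed (simp_all add: tableau_array_Nil)

lemma tableau_array_foldr_add_rows:
  "tableau_array (foldr add_rows Ts []) i j = (\<Sum>T\<leftarrow>Ts. tableau_array T i j)"
  by (induction Ts) (simp_all add: tableau_array_Nil tableau_array_add_rows)

lemma tableau_array_map_sort: "tableau_array (map sort T) = tableau_array T"
proof -
  have "count_list (sort xs) i = count_list xs i" for xs :: "nat list" and i
    by (metis count_mset mset_sort)
  then show ?thesis by (auto simp: tableau_array_def fun_eq_iff)
qed

text \<open>Two sums of arrays are compared through sorted rows, that is, as multisets of entries in
  each row.\<close>

definition straightening_ok :: "nat \<Rightarrow> nat \<Rightarrow> nat list \<Rightarrow> bool" where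
  "straightening_ok z z' D \<longleftrightarrow> z \<noteq> z' \<and> list_all (\<lambda>y. y < 45) D \<and>
     map sort (add_rows (label z) (label z')) = map sort (foldr add_rows (map label D) []) \<and>
     sum_list (map potential D) < potential z + potential z'"

lemma straightening_table_ok:
  "list_all (\<lambda>(z, l). list_all (\<lambda>(z', D). straightening_ok z z' D) l) straightening"
  by (simp add: straightening_def straightening_ok_def label_simps potential_simps del: One_nat_def)

lemma column_labels_exist:
  "list_all (\<lambda>xs. xs = [] \<or> sorted_wrt (<) xs \<and> map (\<lambda>x. [x]) xs \<in> set (map fst cluster_table))
    (subseqs [1, 2, 3, 4, 5])"
  by (simp add: cluster_table_def Let_def del: One_nat_def)

text \<open>All nonempty subsets of \<open>{1..5}\<close> occur in the table as one-column labels,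
  so the columns peeled off an array of D(5) are among the generators.\<close>

lemma column_label:
  assumes "xs \<noteq> []" "sorted_wrt (<) xs" "set xs \<subseteq> {1..5}"
  shows "\<exists>z<45. label z = map (\<lambda>x. [x]) xs"
proof -
  have "{1..5} = set [1, 2, 3, 4, 5::nat]" by auto
  then have "set xs \<in> set ` set (subseqs [1, 2, 3, 4, 5])"
    unfolding subseqs_powset using assms(3) by simp
  then obtain ys where ys: "ys \<in> set (subseqs [1, 2, 3, 4, 5])" "set ys = set xs"
    by (metis imageE)
  moreover have "ys \<noteq> []" using ys(2) assms(1) by auto
  ultimately have "sorted_wrt (<) ys" "map (\<lambda>x. [x]) ys \<in> set (map fst cluster_table)"
    using column_labels_exist unfolding list_all_iff by blast+
  moreover have "ys = xs"
    using \<open>sorted_wrt (<) ys\<close> assms(2) ys(2) by (simp add: strict_sorted_iff sorted_distinct_set_unique)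
  moreover have "length cluster_table = 45" by (simp add: cluster_table_def)
  ultimately have "map (\<lambda>x. [x]) xs \<in> set (map fst cluster_table)" "length cluster_table = 45" by simp_all
  then obtain z where "z < 45" "map fst cluster_table ! z = map (\<lambda>x. [x]) xs"
    unfolding in_set_conv_nth by auto
  then show ?thesis using \<open>length cluster_table = 45\<close> by (auto simp: label_def)
qed

lemma label_entries:
  assumes "z < 45"
  shows "set (concat (label z)) \<subseteq> {1..5}"
proof -
  have "length cluster_table = 45" by (simp add: cluster_table_def)
  then have "table_entry_ok (cluster_table ! z)"
    using assms cluster_table_ok by (simp add: list_all_length)
  then have "table_entry_ok (label z, snd (cluster_table ! z))" by (simp add: label_def)
  then show ?thesis by (auto simp: table_entry_ok_def list_all_iff)
qed

lemma label_nonempty: "z < 45 \<Longrightarrow> label z \<noteq> []"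
proof -
  have "list_all (\<lambda>e. fst e \<noteq> []) cluster_table" "length cluster_table = 45"
    by (simp_all add: cluster_table_def)
  then show "z < 45 \<Longrightarrow> label z \<noteq> []" by (simp add: label_def list_all_length)
qed

lemma tableau_array_entry:
  "r < length T \<Longrightarrow> x \<in> set (T ! r) \<Longrightarrow> 1 \<le> tableau_array T x (Suc r)"
  using count_list_0_iff[of "T ! r" x] by (simp add: tableau_array_def Suc_le_eq)

lemma tableau_array_nonneg: "0 \<le> tableau_array T i j"
  by (simp add: tableau_array_def)

lemma D_cone_support: "a \<in> D_cone n \<Longrightarrow> a i j \<noteq> 0 \<Longrightarrow> 1 \<le> j \<and> j \<le> i \<and> i \<le> n"
  unfolding D_cone_def by auto

text \<open>The additional inequalities are harmless: for \<open>n \<le> j\<close> the left side is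
  0, and for \<open>n < i\<close> it stops growing at \<open>n\<close> while the right side does not
  decrease.\<close>

lemma D_cone_mono:
  assumes "n \<le> k"
  shows "D_cone n \<subseteq> D_cone k"
proof
  fix a assume a: "a \<in> D_cone n"
  have nn: "\<And>i j. 0 \<le> a i j" and out: "\<And>i j. \<not> (1 \<le> j \<and> j \<le> i \<and> i \<le> n) \<Longrightarrow> a i j = 0"
    and ineq: "\<And>i j. 1 \<le> j \<Longrightarrow> j < n \<Longrightarrow> i \<in> {1..n} \<Longrightarrow> (\<Sum>k=1..i. a k (j + 1)) \<le> (\<Sum>k=1..<i. a k j)"
    using a unfolding D_cone_def by blast+
  have "(\<Sum>x=1..i. a x (j + 1)) \<le> (\<Sum>x=1..<i. a x j)" if "1 \<le> j" "i \<in> {1..k}" for i j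
  proof (cases "j < n")
    case False
    then have "(\<Sum>x=1..i. a x (j + 1)) = 0" by (intro sum.neutral ballI out) auto
    then show ?thesis using nn by (simp add: sum_nonneg)
  next
    case True
    show ?thesis
    proof (cases "i \<le> n")
      case False
      have "(\<Sum>x=1..i. a x (j + 1)) = (\<Sum>x=1..n. a x (j + 1))"
        using False out by (intro sum.mono_neutral_right) auto
      also have "\<dots> \<le> (\<Sum>x=1..<n. a x j)" using ineq that True by simp
      also have "\<dots> \<le> (\<Sum>x=1..<i. a x j)" using False nn by (intro sum_mono2) auto
      finally show ?thesis .
    qed (use ineq that True in simp)
  qed
  then show "a \<in> D_cone k"
    using nn out assms unfolding D_cone_def by (auto intro: out)
qed

lemma sum_list_eq_sum_count_list:
  fixes g :: "'b \<Rightarrow> real"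
  assumes "set D \<subseteq> Z" "finite Z"
  shows "(\<Sum>z\<leftarrow>D. g z) = (\<Sum>z\<in>Z. real (count_list D z) * g z)"
  using assms(1)
proof (induction D)
  case (Cons y D)
  have "(\<Sum>z\<in>Z. real (count_list (y # D) z) * g z) =
      (\<Sum>z\<in>Z. real (count_list D z) * g z + (if z = y then g z else 0))"
    by (intro sum.cong) (auto simp: algebra_simps)
  also have "\<dots> = (\<Sum>z\<in>Z. real (count_list D z) * g z) + g y"
    using Cons.prems assms(2) by (simp add: sum.distrib)
  finally show ?case using Cons by simp
qed simp

text \<open>\<open>D_cone n\<close> is viewed inside \<open>D_cone 5\<close>, where all 45 labels
  are available, and a representation of minimal potential is taken. Its labels return to the
  alphabet \<open>{1..n}\<close> because \<open>a\<close> vanishes outside.\<close>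

lemma D_cone_straightened:
  assumes a: "a \<in> D_cone n" and n: "n \<le> 5"
  shows "\<exists>d. (\<forall>z<45. 0 \<le> d z) \<and> a = (\<lambda>i j. \<Sum>z<45. d z * tableau_array (label z) i j) \<and>
    (\<forall>z<45. \<forall>z'<45. \<forall>l D. (z, l) \<in> set straightening \<longrightarrow> (z', D) \<in> set l \<longrightarrow> \<not> (0 < d z \<and> 0 < d z')) \<and>
    (\<forall>z<45. 0 < d z \<longrightarrow> set (concat (label z)) \<subseteq> {1..n})"
proof -
  let ?A = "\<lambda>z. tableau_array (label z)"
  define bad where "bad x y \<longleftrightarrow> (\<exists>l D. (x, l) \<in> set straightening \<and> (y, D) \<in> set l)" for x y
  have "D_cone 5 \<subseteq> cone_over {..<45} ?A"
  proof (rule D_cone_subset_cone_over_columns)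
    fix xs :: "nat list" assume "xs \<noteq> []" "sorted_wrt (<) xs" "set xs \<subseteq> {1..5}"
    then show "\<exists>z\<in>{..<45}. ?A z = tableau_array (map (\<lambda>x. [x]) xs)"
      using column_label by (metis lessThan_iff)
  qed simp
  then have rep: "a \<in> cone_over {..<45} ?A" using a D_cone_mono[OF n] by blast
  have pos: "\<exists>i j. 1 \<le> ?A z i j" if z: "z \<in> {..<45}" for z
  proof -
    have "label z \<noteq> []" "hd (label z) \<in> set (label z)" using label_nonempty z by auto
    moreover then have "hd (label z) \<noteq> []" using cluster_table_entry(2)[of z] z by auto
    ultimately show ?thesis
      using tableau_array_entry[of 0 "label z" "hd (hd (label z))"] by (auto simp: hd_conv_nth)
  qed
  have straight: "x \<noteq> y \<and> (\<exists>c. (\<forall>z\<in>{..<45}. 0 \<le> c z) \<and>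
      (\<forall>i j. ?A x i j + ?A y i j = (\<Sum>z<45. c z * ?A z i j)) \<and>
      (\<Sum>z<45. c z * real (potential z)) < real (potential x) + real (potential y))"
    if xy: "bad x y" for x y
  proof -
    obtain l D where "(x, l) \<in> set straightening" "(y, D) \<in> set l" using xy by (auto simp: bad_def)
    then have ok: "straightening_ok x y D" using straightening_table_ok by (fastforce simp: list_all_iff)
    define c where "c z = real (count_list D z)" for z
    have sum_c: "(\<Sum>z\<leftarrow>D. g z) = (\<Sum>z<45. c z * g z)" for g :: "nat \<Rightarrow> real"
    proof -
      have "set D \<subseteq> {..<45}" using ok by (auto simp: straightening_ok_def list_all_iff)
      then show ?thesis unfolding c_def by (rule sum_list_eq_sum_count_list) simp
    qed
    have "?A x i j + ?A y i j = (\<Sum>z<45. c z * ?A z i j)" for i j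
    proof -
      have "?A x i j + ?A y i j = tableau_array (map sort (add_rows (label x) (label y))) i j"
        by (simp add: tableau_array_map_sort tableau_array_add_rows)
      also have "\<dots> = tableau_array (map sort (foldr add_rows (map label D) [])) i j"
        using ok by (simp only: straightening_ok_def)
      also have "\<dots> = (\<Sum>z\<leftarrow>D. ?A z i j)"
        by (simp add: tableau_array_map_sort tableau_array_foldr_add_rows comp_def)
      finally show ?thesis by (simp add: sum_c)
    qed
    moreover have "(\<Sum>z<45. c z * real (potential z)) < real (potential x) + real (potential y)"
    proof -
      have "(\<Sum>z\<leftarrow>D. real (potential z)) = real (sum_list (map potential D))" by (induction D) simp_all
      then show ?thesis using ok sum_c[of "\<lambda>z. real (potential z)"] by (simp add: straightening_ok_def flip: of_nat_add)
    qed
    moreover have "x \<noteq> y" using ok by (simp add: straightening_ok_def)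
    moreover have "\<forall>z\<in>{..<45}. 0 \<le> c z" by (simp add: c_def)
    ultimately show ?thesis by blast
  qed
  obtain d where d: "\<And>z. z \<in> {..<45} \<Longrightarrow> 0 \<le> d z" "a = (\<lambda>i j. \<Sum>z<45. d z * ?A z i j)"
    "\<And>x y. x \<in> {..<45} \<Longrightarrow> y \<in> {..<45} \<Longrightarrow> 0 < d x \<Longrightarrow> 0 < d y \<Longrightarrow> \<not> bad x y"
    using cone_over_straightened[of "{..<45}" ?A bad "\<lambda>z. real (potential z)" a]
      tableau_array_nonneg pos straight rep by blast
  have "set (concat (label z)) \<subseteq> {1..n}" if z: "z < 45" "0 < d z" for z
  proof
    fix x assume "x \<in> set (concat (label z))"
    then obtain R where R: "R \<in> set (label z)" "x \<in> set R" by auto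
    then obtain r where r: "r < length (label z)" "x \<in> set (label z ! r)" by (metis in_set_conv_nth)
    \<comment> \<open>All summands being non-negative, an entry of a label with positive coefficient
      remains visible in \<open>a\<close>.\<close>
    have "0 < d z * ?A z x (Suc r)" using z(2) tableau_array_entry[OF r] by simp
    also have "\<dots> \<le> a x (Suc r)"
      unfolding d(2) using z d(1) tableau_array_nonneg
      by (intro member_le_sum[where f = "\<lambda>z. d z * ?A z x (Suc r)"]) auto
    finally have "a x (Suc r) \<noteq> 0" by simp
    then show "x \<in> {1..n}" using D_cone_support[OF a, of x "Suc r"] by simp
  qed
  moreover have "\<not> (0 < d z \<and> 0 < d z')"
    if "z < 45" "z' < 45" "(z, l) \<in> set straightening" "(z', D) \<in> set l" for z z' l D
  proof -
    have "bad z z'" unfolding bad_def using that(3,4) by blast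
    then show ?thesis using d(3)[of z z'] that by auto
  qed
  moreover have "\<forall>z<45. 0 \<le> d z" using d(1) by simp
  ultimately show ?thesis using d(2) by blast
qed

section \<open>Covering the cone\<close>

primrec occurs :: "nat \<Rightarrow> nat list \<Rightarrow> bool" where
  "occurs x [] = False"
| "occurs x (y # ys) = (if x = y then True else occurs x ys)"

fun is_subsequence :: "nat list \<Rightarrow> nat list \<Rightarrow> bool" where
  "is_subsequence [] X = True"
| "is_subsequence (c # C) [] = False"
| "is_subsequence (c # C) (x # X) = (if c = x then is_subsequence C X else is_subsequence (c # C) X)"

primrec subsequence_of_some :: "nat list \<Rightarrow> nat list list \<Rightarrow> bool" where
  "subsequence_of_some C [] = False"
| "subsequence_of_some C (X # R) = (is_subsequence C X \<or> subsequence_of_some C R)"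

text \<open>The lists of seeds are sorted and the candidates are tried in increasing order, so only
  the head of a list is compared with \<open>z\<close>.\<close>

fun select_head :: "nat \<Rightarrow> nat list list \<Rightarrow> nat list list" where
  "select_head z [] = []"
| "select_head z ([] # R) = select_head z R"
| "select_head z ((x # X) # R) = (if x = z then [X] else []) @ select_head z R"

fun drop_head :: "nat \<Rightarrow> nat list list \<Rightarrow> nat list list" where
  "drop_head z [] = []"
| "drop_head z ([] # R) = [] # drop_head z R"
| "drop_head z ((x # X) # R) = (if x = z then X else x # X) # drop_head z R"

primrec drop_incompatible :: "nat list \<Rightarrow> (nat \<times> nat list) list \<Rightarrow> (nat \<times> nat list) list" where
  "drop_incompatible inc [] = []"
| "drop_incompatible inc (c # C) =
     (if occurs (fst c) inc then drop_incompatible inc C else c # drop_incompatible inc C)"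

lemma length_drop_incompatible [termination_simp]: "length (drop_incompatible inc C) \<le> length C"
  by (induction C) auto

text \<open>Indices are taken from the keys of the table, which is why \<open>straightening\<close>
  also has keys with an empty list: each incompatible pair is stored only at its smaller
  index.\<close>

primrec candidates :: "nat list \<Rightarrow> (nat \<times> (nat \<times> nat list) list) list \<Rightarrow> (nat \<times> nat list) list" where
  "candidates zs [] = []"
| "candidates zs (e # es) =
     (if occurs (fst e) zs then (fst e, map fst (snd e)) # candidates zs es else candidates zs es)"

primrec all_accounted :: "nat \<Rightarrow> nat list \<Rightarrow> nat list \<Rightarrow> bool" where
  "all_accounted n A [] = True"
| "all_accounted n A (z # zs) =
     (if occurs z A then all_accounted n A zs
      else if list_all (\<lambda>x. x \<le> n) (concat (label z)) then False else all_accounted n A zs)"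

text \<open>
  \<open>covers R C\<close> decides whether every set of indices in \<open>C\<close> that is pairwise compatible (\<open>C\<close> lists
  for each index the later ones incompatible with it) is contained in a list of \<open>R\<close>. It uses
  conditionals because the simplifier postpones their branches; as it traverses the chosen branch
  anew, the recursions over \<open>R\<close> avoid them.
\<close>

fun covers :: "nat list list \<Rightarrow> (nat \<times> nat list) list \<Rightarrow> bool" where
  "covers R [] = (R \<noteq> [])"
| "covers R ((z, inc) # C) =
     (if (if length C < 5 then subsequence_of_some (z # map fst C) R else False) then True
      else if covers (select_head z R) (drop_incompatible inc C)
      then covers (drop_head z R) C else False)"

lemma occurs_iff: "occurs x ys \<longleftrightarrow> x \<in> set ys"
  by (induction ys) auto

lemma set_drop_incompatible: "set (drop_incompatible inc C) = {c \<in> set C. fst c \<notin> set inc}"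
  by (induction C) (auto simp: occurs_iff)

lemma candidates_mem: "(z, inc) \<in> set (candidates zs es) \<Longrightarrow> \<exists>l. (z, l) \<in> set es \<and> inc = map fst l"
  by (induction es) (auto split: if_splits)

lemma all_accounted_iff:
  "all_accounted n A zs \<longleftrightarrow> (\<forall>z\<in>set zs. (\<forall>x\<in>set (concat (label z)). x \<le> n) \<longrightarrow> z \<in> set A)"
  by (induction zs) (auto simp: occurs_iff list_all_iff)

lemma is_subsequence_subset: "is_subsequence C X \<Longrightarrow> set C \<subseteq> set X"
  by (induction C X rule: is_subsequence.induct) (auto split: if_splits)

lemma subsequence_of_some_subset: "subsequence_of_some C R \<Longrightarrow> \<exists>X\<in>set R. set C \<subseteq> set X"
  by (induction R) (auto split: if_splits dest: is_subsequence_subset)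

lemma select_head_mem: "X \<in> set (select_head z R) \<Longrightarrow> z # X \<in> set R"
  by (induction z R rule: select_head.induct) (auto split: if_splits)

lemma drop_head_mem: "X \<in> set (drop_head z R) \<Longrightarrow> \<exists>X'\<in>set R. set X \<subseteq> set X'"
  by (induction z R rule: drop_head.induct) (auto split: if_splits)

text \<open>Case distinction on the first candidate \<open>z\<close>. If it is in \<open>Y\<close>,
  compatibility confines the rest of \<open>Y\<close> to the candidates that are kept, and a list
  covering the rest is the tail of a list starting with \<open>z\<close>. If not, a list of
  \<open>drop_head z R\<close> covers \<open>Y\<close> and is contained in a list of
  \<open>R\<close>. The early exit applies when one list contains all remaining candidates.\<close>

lemma covers_sound:
  assumes "covers R C" "Y \<subseteq> fst ` set C" "\<And>z inc. (z, inc) \<in> set C \<Longrightarrow> z \<in> Y \<Longrightarrow> Y \<inter> set inc = {}"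
  shows "\<exists>X\<in>set R. Y \<subseteq> set X"
  using assms
proof (induction R C arbitrary: Y rule: covers.induct)
  case (1 R)
  then show ?case by (cases R) auto
next
  case (2 R z inc C)
  show ?case
  proof (cases "length C < 5 \<and> subsequence_of_some (z # map fst C) R")
    case True
    then obtain X where "X \<in> set R" "set (z # map fst C) \<subseteq> set X" using subsequence_of_some_subset by blast
    then show ?thesis using 2(4) by (intro bexI[of _ X]) auto
  next
    case False
    then have neg: "\<not> (if length C < 5 then subsequence_of_some (z # map fst C) R else False)" by auto
    have cov: "covers (select_head z R) (drop_incompatible inc C)" "covers (drop_head z R) C"
      using 2(3) neg by (auto split: if_splits)
    show ?thesis
    proof (cases "z \<in> Y")
      case True
      have "Y \<inter> set inc = {}" using 2(5)[of z inc] True by simp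
      then have "Y - {z} \<subseteq> fst ` set (drop_incompatible inc C)"
        using 2(4) by (fastforce simp: set_drop_incompatible)
      then have "\<exists>X\<in>set (select_head z R). Y - {z} \<subseteq> set X"
      proof (rule 2(1)[OF neg cov(1)])
        fix z' inc' assume "(z', inc') \<in> set (drop_incompatible inc C)" "z' \<in> Y - {z}"
        then show "(Y - {z}) \<inter> set inc' = {}" using 2(5)[of z' inc'] by (auto simp: set_drop_incompatible)
      qed
      then obtain X where "X \<in> set (select_head z R)" "Y - {z} \<subseteq> set X" by blast
      then show ?thesis using select_head_mem by (intro bexI[of _ "z # X"]) auto
    next
      case False
      then have "Y \<subseteq> fst ` set C" using 2(4) by auto
      then have "\<exists>X\<in>set (drop_head z R). Y \<subseteq> set X"
      proof (rule 2(2)[OF neg cov(1,2)])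
        fix z' inc' assume "(z', inc') \<in> set C" "z' \<in> Y"
        then show "Y \<inter> set inc' = {}" using 2(5)[of z' inc'] by auto
      qed
      then show ?thesis using drop_head_mem by blast
    qed
  qed
qed

lemma D_cone_subset_seed_cones:
  assumes n: "n \<le> 5"
    and rep: "represents vs m (initial_seed n) ids W"
    and entries: "n = 5 \<or>
      list_all (\<lambda>X. list_all (\<lambda>z. list_all (\<lambda>x. x \<le> n) (concat (label z))) X) (ids # explore t ids W)"
    and C: "C = candidates zs straightening"
    and complete: "all_accounted n (map fst C @ drop m ids) [0..<45]"
    and cov: "covers (map (\<lambda>X. sort (take m X)) (ids # explore t ids W)) C"
  shows "D_cone n \<subseteq> (\<Union>S\<in>seeds n. seed_cone n S)"
proof
  fix a assume a: "a \<in> D_cone n"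
  obtain d where d: "\<forall>z<45. 0 \<le> d z" "a = (\<lambda>i j. \<Sum>z<45. d z * tableau_array (label z) i j)"
    and compat: "\<forall>z<45. \<forall>z'<45. \<forall>l D. (z, l) \<in> set straightening \<longrightarrow> (z', D) \<in> set l \<longrightarrow> \<not> (0 < d z \<and> 0 < d z')"
    and supp: "\<forall>z<45. 0 < d z \<longrightarrow> set (concat (label z)) \<subseteq> {1..n}"
    using D_cone_straightened[OF a n] by (elim exE conjE)
  define Y where "Y = {z \<in> fst ` set C. z < 45 \<and> 0 < d z}"
  have "\<exists>X\<in>set (map (\<lambda>X. sort (take m X)) (ids # explore t ids W)). Y \<subseteq> set X"
  proof (rule covers_sound[OF cov])
    show "Y \<subseteq> fst ` set C" by (auto simp: Y_def)
    fix z inc assume "(z, inc) \<in> set C" "z \<in> Y"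
    then obtain l where l: "(z, l) \<in> set straightening" "inc = map fst l"
      unfolding C using candidates_mem by blast
    show "Y \<inter> set inc = {}"
    proof (rule ccontr)
      assume "Y \<inter> set inc \<noteq> {}"
      then obtain z' D where "z' \<in> Y" "(z', D) \<in> set l" by (auto simp: l(2))
      then show False using compat l(1) \<open>z \<in> Y\<close> unfolding Y_def by blast
    qed
  qed
  then obtain X where X: "X \<in> set (ids # explore t ids W)" "Y \<subseteq> set (take m X)" by auto
  have "\<exists>S\<in>seeds n. \<exists>W'. represents vs m S X W' \<and> drop m X = drop m ids"
    using explore_reaches_seeds[OF rep seeds.initial] rep seeds.initial X(1) by auto
  then obtain S W' where S: "S \<in> seeds n" and repX: "represents vs m S X W'" and dr: "drop m X = drop m ids"
    by blast
  have X45: "set X \<subseteq> {..<45}" using repX by (auto simp: represents_def in_set_conv_nth)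
  \<comment> \<open>A candidate lies in \<open>Y\<close> and so in \<open>take m X\<close>; a frozen
    index lies in \<open>drop m X\<close>, which equals \<open>drop m ids\<close>.\<close>
  have in_X: "z \<in> set X" if "z < 45" "0 < d z" for z
  proof -
    have "\<forall>x\<in>set (concat (label z)). x \<le> n" using supp that by fastforce
    then have "z \<in> fst ` set C \<union> set (drop m X)"
      using complete that(1) unfolding all_accounted_iff dr by simp
    then show ?thesis using X(2) that set_take_subset[of m X] set_drop_subset[of m X] by (auto simp: Y_def)
  qed
  have "d z = 0" if "z < 45" "z \<notin> set X" for z
    using d(1) in_X[of z] that by (cases "0 < d z") (auto simp: antisym not_less)
  then have "(\<Sum>z<45. d z * tableau_array (label z) i j) = (\<Sum>z\<in>set X. d z * tableau_array (label z) i j)" for i j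
    using X45 by (intro sum.mono_neutral_right) auto
  then have "a = (\<lambda>i j. \<Sum>z\<in>set X. d z * tableau_array (label z) i j)" by (simp add: d(2))
  also have "\<dots> \<in> seed_cone n S"
  proof (rule cone_over_subset_seed_cone[OF repX])
    fix k assume "k < length vs"
    then have k: "X ! k \<in> set X" using repX by (simp add: represents_def)
    then have "set (concat (label (X ! k))) \<subseteq> {1..5}" using X45 label_entries by auto
    moreover have "\<forall>x\<in>set (concat (label (X ! k))). x \<le> n" if "n \<noteq> 5"
      using entries X(1) k that unfolding list_all_iff by blast
    ultimately show "set (concat (label (X ! k))) \<subseteq> {1..n}" by fastforce
  qed (use X45 d(1) in auto)
  finally show "a \<in> (\<Union>S\<in>seeds n. seed_cone n S)" using S by blast
qed

section \<open>The initial seeds\<close>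

lemma Q_edges_iff:
  "((i, j), (k, l)) \<in> Q_edges n \<longleftrightarrow>
     1 \<le> i \<and> 1 \<le> j \<and> i + j \<le> n + 1 \<and> 1 \<le> k \<and> 1 \<le> l \<and> k + l \<le> n + 1 \<and>
     (k = i + 1 \<and> l = j \<or> k = i \<and> j = l + 1 \<or> i = k + 1 \<and> l = j + 1)"
  by (auto simp: Q_edges_def Q_vertices_def)

text \<open>The set-theoretic description of Q(n) is replaced by finite checks on lists;
  \<open>complete\<close> searches the whole square grid for a missing vertex.\<close>

lemma represents_initial_seed:
  assumes vs: "distinct vs" "m \<le> length vs"
    and sound: "list_all (\<lambda>(i, j). 1 \<le> i \<and> 1 \<le> j \<and> i + j \<le> n + 1) vs"
    and complete: "list_all (\<lambda>(i, j). i + j \<le> n + 1 \<longrightarrow> (i, j) \<in> set vs) (List.product [1..<Suc n] [1..<Suc n])"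
    and mutb: "list_all (\<lambda>(i, j). i \<noteq> 1 \<and> i + j \<noteq> n + 1) (take m vs)"
    and froz: "list_all (\<lambda>(i, j). i = 1 \<or> i + j = n + 1) (drop m vs)"
    and ids: "list_all2 (\<lambda>(i, j) z. z < 45 \<and> cluster_poly z = row_minor [i..<i + j]) vs ids"
    and W: "W = map (\<lambda>u. map (\<lambda>v. of_bool ((u, v) \<in> Q_edges n) - of_bool ((v, u) \<in> Q_edges n)) vs) (take m vs)"
  shows "represents vs m (initial_seed n) ids W"
proof -
  have Q: "set vs = Q_vertices n"
  proof
    show "set vs \<subseteq> Q_vertices n" using sound by (auto simp: Q_vertices_def list_all_iff)
    show "Q_vertices n \<subseteq> set vs"
    proof
      fix u assume "u \<in> Q_vertices n"
      then obtain i j where ij: "u = (i, j)" "1 \<le> i" "1 \<le> j" "i + j \<le> n + 1" by (auto simp: Q_vertices_def)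
      then have "(i, j) \<in> set (List.product [1..<Suc n] [1..<Suc n])" by auto
      then show "u \<in> set vs" using complete ij unfolding list_all_iff by fastforce
    qed
  qed
  have "set vs = set (take m vs) \<union> set (drop m vs)" by (metis append_take_drop_id set_append)
  moreover have "set (take m vs) \<inter> Q_frozen n = {}" "set (drop m vs) \<subseteq> Q_frozen n"
    using mutb froz Q set_drop_subset[of m vs] by (fastforce simp: Q_frozen_def list_all_iff)+
  ultimately have mu: "set (take m vs) = Q_vertices n - Q_frozen n" using Q by blast
  have "vertices (initial_seed n) = set vs"
    using Q by (auto simp: vertices_def initial_seed_def Q_frozen_def)
  moreover have "ids ! k < 45 \<and> variable (initial_seed n) (vs ! k) = to_fract (cluster_poly (ids ! k))"
    if "k < length vs" for k
  proof -
    obtain i j where ij: "vs ! k = (i, j)" by (cases "vs ! k")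
    then have "ids ! k < 45 \<and> cluster_poly (ids ! k) = row_minor [i..<i + j]"
      using list_all2_nthD[OF ids that] by simp
    moreover have "flag_minor {i..<i + j} = row_minor [i..<i + j]"
      using flag_minor_set[of "[i..<i + j]"] by simp
    ultimately show ?thesis by (simp add: ij initial_seed_def)
  qed
  ultimately show ?thesis
    using vs mu list_all2_lengthD[OF ids] unfolding represents_def
    by (auto simp: W initial_seed_def)
qed

section \<open>Vertex orders, weights and mutation trees for n = 3, 4, 5\<close>

definition "vertices_3 = ([(2, 1), (1, 1), (1, 2), (1, 3), (2, 2), (3, 1)] :: (nat \<times> nat) list)"
definition "indices_3 = ([16, 36, 37, 38, 10, 12] :: nat list)"
definition
  "weights_3 =
    ([[0, - 1, 1, 0, - 1, 1]] :: int list list)"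
definition
  "mutations_3 =
     Mutate 0 13 Stop Stop"

definition "vertices_4 = ([(2, 1), (2, 2), (3, 1), (1, 1), (1, 2), (1, 3), (1, 4), (2, 3), (3, 2), (4, 1)] :: (nat \<times> nat) list)"
definition "indices_4 = ([16, 10, 12, 36, 37, 38, 39, 17, 11, 15] :: nat list)"
definition
  "weights_4 =
    ([[0, - 1, 1, - 1, 1, 0, 0, 0, 0, 0],
     [1, 0, - 1, 0, - 1, 1, 0, - 1, 1, 0],
     [- 1, 1, 0, 0, 0, 0, 0, 0, - 1, 1]] :: int list list)"
text \<open>Thirteen mutations, one for each of the 14 seeds of type A3 other than the initial
  seed.\<close>

definition
  "mutations_4 =
     Mutate 0 13 (Mutate 1 25 (Mutate 2 9 (Mutate 0 35 Stop Stop) Stop) (Mutate 2 9 Stop Stop))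
     (Mutate 1 8 (Mutate 0 25 (Mutate 2 35 Stop Stop) (Mutate 2 35 Stop Stop)) (Mutate 2 7 (Mutate 0
     9 (Mutate 1 35 Stop Stop) (Mutate 1 35 Stop Stop)) Stop))"

definition "vertices_5 = ([(2, 1), (2, 2), (2, 3), (3, 1), (3, 2), (4, 1), (1, 1), (1, 2), (1, 3), (1, 4), (1, 5), (2, 4), (3, 3), (4, 2), (5, 1)] :: (nat \<times> nat) list)"
definition "indices_5 = ([16, 10, 17, 12, 11, 15, 36, 37, 38, 39, 40, 41, 42, 43, 44] :: nat list)"
definition
  "weights_5 =
    ([[0, - 1, 0, 1, 0, 0, - 1, 1, 0, 0, 0, 0, 0, 0, 0],
     [1, 0, - 1, - 1, 1, 0, 0, - 1, 1, 0, 0, 0, 0, 0, 0],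
     [0, 1, 0, 0, - 1, 0, 0, 0, - 1, 1, 0, - 1, 1, 0, 0],
     [- 1, 1, 0, 0, - 1, 1, 0, 0, 0, 0, 0, 0, 0, 0, 0],
     [0, - 1, 1, 1, 0, - 1, 0, 0, 0, 0, 0, 0, - 1, 1, 0],
     [0, 0, 0, - 1, 1, 0, 0, 0, 0, 0, 0, 0, 0, - 1, 1]] :: int list list)"
definition
  "mutations_5 =
     Mutate 0 13 (Mutate 1 25 (Mutate 2 34 (Mutate 3 9 (Mutate 4 31 (Mutate 5 33 (Mutate 3 27
     (Mutate 0 30 (Mutate 3 35 Stop Stop) (Mutate 5 1 (Mutate 3 15 (Mutate 4 12 Stop Stop) (Mutate 4
     12 Stop Stop)) Stop)) Stop) Stop) (Mutate 5 33 Stop Stop)) (Mutate 5 21 (Mutate 3 33 Stop Stop)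
     Stop)) (Mutate 3 9 (Mutate 4 31 (Mutate 5 33 (Mutate 3 27 (Mutate 0 30 (Mutate 1 22 (Mutate 2
     28 (Mutate 1 34 (Mutate 3 32 (Mutate 0 19 (Mutate 1 24 (Mutate 2 9 (Mutate 5 15 Stop Stop)
     (Mutate 5 18 (Mutate 2 15 Stop Stop) Stop)) (Mutate 2 9 (Mutate 3 13 (Mutate 5 15 Stop Stop)
     (Mutate 5 15 Stop Stop)) (Mutate 3 13 (Mutate 5 18 (Mutate 2 15 Stop Stop) Stop) (Mutate 5 18
     (Mutate 2 15 Stop Stop) Stop)))) (Mutate 1 24 (Mutate 2 35 Stop (Mutate 3 22 (Mutate 2 17
     (Mutate 3 35 Stop Stop) Stop) Stop)) (Mutate 2 35 (Mutate 4 29 (Mutate 1 23 (Mutate 5 16 Stop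
     Stop) (Mutate 5 20 (Mutate 1 16 Stop Stop) Stop)) Stop) (Mutate 4 29 (Mutate 1 23 (Mutate 3 21
     (Mutate 2 6 (Mutate 3 35 (Mutate 4 17 (Mutate 1 25 (Mutate 4 34 (Mutate 5 8 Stop Stop) (Mutate
     5 8 (Mutate 1 16 (Mutate 4 20 (Mutate 1 34 Stop Stop) Stop) Stop) Stop)) (Mutate 5 16 Stop
     Stop)) (Mutate 5 16 Stop Stop)) (Mutate 4 17 (Mutate 1 25 (Mutate 4 34 (Mutate 5 8 Stop Stop)
     (Mutate 5 8 (Mutate 1 16 (Mutate 4 20 (Mutate 1 34 Stop Stop) Stop) Stop) Stop)) (Mutate 5 16
     Stop Stop)) (Mutate 5 16 Stop Stop))) (Mutate 5 16 Stop Stop)) (Mutate 5 16 Stop Stop)) (Mutate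
     3 21 (Mutate 2 6 (Mutate 3 35 (Mutate 5 20 (Mutate 1 16 Stop Stop) Stop) (Mutate 5 20 (Mutate 1
     16 Stop Stop) Stop)) (Mutate 5 20 (Mutate 1 16 Stop Stop) Stop)) (Mutate 5 20 (Mutate 1 16 Stop
     Stop) Stop))) Stop)))) Stop) Stop) Stop) (Mutate 3 35 Stop Stop)) (Mutate 1 22 (Mutate 2 28
     (Mutate 1 34 (Mutate 5 1 (Mutate 3 18 (Mutate 2 15 (Mutate 4 12 Stop Stop) (Mutate 4 12 Stop
     Stop)) (Mutate 4 12 Stop Stop)) Stop) (Mutate 5 1 (Mutate 3 2 (Mutate 4 12 Stop Stop) (Mutate 4
     12 Stop Stop)) Stop)) (Mutate 5 1 (Mutate 3 2 (Mutate 1 15 (Mutate 2 18 (Mutate 1 28 (Mutate 4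
     12 Stop Stop) (Mutate 4 12 Stop Stop)) (Mutate 4 12 Stop Stop)) (Mutate 4 12 Stop Stop))
     (Mutate 4 12 Stop Stop)) Stop)) (Mutate 5 1 (Mutate 3 15 (Mutate 4 12 Stop Stop) (Mutate 4 12
     Stop Stop)) Stop))) Stop) Stop) (Mutate 5 33 Stop Stop)) (Mutate 5 21 (Mutate 3 33 Stop Stop)
     Stop))) (Mutate 3 9 (Mutate 5 33 Stop Stop) (Mutate 5 21 (Mutate 3 33 Stop Stop) Stop)))
     (Mutate 3 7 (Mutate 4 24 (Mutate 5 23 (Mutate 0 33 (Mutate 3 22 (Mutate 2 28 (Mutate 4 21
     (Mutate 3 14 (Mutate 2 11 Stop (Mutate 4 5 (Mutate 1 32 (Mutate 2 7 (Mutate 4 3 (Mutate 1 11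
     (Mutate 2 29 (Mutate 4 21 (Mutate 1 28 (Mutate 4 32 (Mutate 5 34 (Mutate 0 20 (Mutate 5 16 Stop
     Stop) Stop) Stop) (Mutate 5 34 (Mutate 0 20 (Mutate 5 16 Stop Stop) Stop) Stop)) (Mutate 5 34
     (Mutate 0 20 (Mutate 5 16 Stop Stop) Stop) Stop)) (Mutate 5 34 (Mutate 0 20 (Mutate 2 15
     (Mutate 5 16 Stop Stop) (Mutate 5 16 Stop Stop)) Stop) Stop)) (Mutate 5 9 (Mutate 0 15 (Mutate
     2 34 Stop Stop) (Mutate 2 34 Stop Stop)) Stop)) (Mutate 2 29 (Mutate 5 34 (Mutate 0 20 (Mutate
     2 15 (Mutate 4 18 (Mutate 1 12 (Mutate 2 28 (Mutate 5 16 Stop Stop) (Mutate 4 11 (Mutate 2 21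
     (Mutate 4 28 (Mutate 5 16 Stop Stop) (Mutate 5 16 Stop Stop)) (Mutate 5 16 Stop Stop)) (Mutate
     5 16 Stop Stop))) (Mutate 2 28 (Mutate 5 16 Stop Stop) (Mutate 5 16 Stop Stop))) (Mutate 5 16
     Stop Stop)) (Mutate 5 16 Stop Stop)) Stop) Stop) (Mutate 5 9 (Mutate 0 15 (Mutate 2 34 Stop
     Stop) (Mutate 2 34 Stop Stop)) Stop))) (Mutate 5 9 (Mutate 0 15 (Mutate 2 19 Stop Stop) (Mutate
     2 19 (Mutate 5 28 (Mutate 0 18 (Mutate 5 15 Stop Stop) Stop) Stop) Stop)) Stop)) Stop) (Mutate
     2 7 (Mutate 5 9 (Mutate 0 15 (Mutate 2 19 Stop Stop) (Mutate 2 19 (Mutate 5 28 (Mutate 0 18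
     (Mutate 5 15 Stop Stop) Stop) Stop) Stop)) Stop) Stop)) Stop)) Stop) (Mutate 5 0 (Mutate 3 19
     (Mutate 0 18 (Mutate 2 15 (Mutate 4 13 Stop Stop) (Mutate 4 13 Stop Stop)) (Mutate 2 9 (Mutate
     0 15 (Mutate 4 13 Stop Stop) (Mutate 4 13 Stop Stop)) (Mutate 4 13 Stop Stop))) (Mutate 4 13
     Stop Stop)) Stop)) (Mutate 4 21 Stop (Mutate 5 0 (Mutate 3 9 (Mutate 0 15 (Mutate 3 2 (Mutate 0
     22 (Mutate 2 28 (Mutate 4 13 Stop Stop) (Mutate 4 13 Stop Stop)) (Mutate 2 18 (Mutate 0 28
     (Mutate 4 13 Stop Stop) (Mutate 4 13 Stop Stop)) (Mutate 4 13 Stop Stop))) (Mutate 4 13 Stop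
     Stop)) (Mutate 4 13 Stop Stop)) (Mutate 4 13 Stop Stop)) Stop))) (Mutate 5 9 (Mutate 0 15 Stop
     Stop) Stop)) (Mutate 3 22 (Mutate 2 28 (Mutate 4 21 (Mutate 3 14 (Mutate 2 11 (Mutate 5 12
     (Mutate 0 13 (Mutate 1 34 (Mutate 4 15 (Mutate 2 18 (Mutate 4 28 Stop Stop) (Mutate 5 9 (Mutate
     2 19 (Mutate 0 32 (Mutate 4 33 (Mutate 5 28 (Mutate 4 18 (Mutate 5 15 Stop Stop) Stop) Stop)
     Stop) (Mutate 4 33 (Mutate 5 28 (Mutate 4 18 (Mutate 5 15 Stop Stop) Stop) Stop) Stop)) (Mutate
     4 33 Stop Stop)) Stop)) (Mutate 5 33 Stop Stop)) (Mutate 4 15 (Mutate 2 18 (Mutate 4 28 Stop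
     Stop) (Mutate 5 9 (Mutate 2 19 (Mutate 4 33 (Mutate 5 28 (Mutate 4 18 (Mutate 5 15 Stop Stop)
     Stop) Stop) Stop) (Mutate 4 33 Stop Stop)) Stop)) (Mutate 5 33 Stop Stop))) (Mutate 4 15
     (Mutate 2 18 (Mutate 4 28 Stop Stop) (Mutate 5 7 (Mutate 4 23 (Mutate 0 33 (Mutate 4 9 (Mutate
     0 15 Stop Stop) Stop) Stop) Stop) Stop)) Stop)) Stop) (Mutate 4 5 (Mutate 1 32 (Mutate 2 7
     (Mutate 4 3 (Mutate 1 11 (Mutate 2 29 (Mutate 4 21 (Mutate 1 28 (Mutate 4 32 Stop Stop) Stop)
     Stop) (Mutate 5 15 Stop Stop)) (Mutate 2 29 Stop (Mutate 5 15 Stop Stop))) (Mutate 5 15 Stop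
     Stop)) (Mutate 5 18 (Mutate 2 15 Stop Stop) Stop)) (Mutate 2 7 (Mutate 5 15 Stop Stop) (Mutate
     5 18 (Mutate 2 15 Stop Stop) Stop))) (Mutate 5 12 (Mutate 0 13 (Mutate 1 34 (Mutate 5 33 Stop
     Stop) (Mutate 5 33 Stop Stop)) Stop) Stop))) (Mutate 5 12 (Mutate 0 13 (Mutate 1 27 (Mutate 3
     34 (Mutate 5 33 (Mutate 0 30 (Mutate 5 4 (Mutate 0 12 Stop Stop) Stop) Stop) Stop) (Mutate 5 33
     (Mutate 0 30 (Mutate 1 23 (Mutate 4 24 (Mutate 3 32 (Mutate 2 35 (Mutate 0 7 (Mutate 1 9
     (Mutate 0 31 (Mutate 4 34 (Mutate 0 3 (Mutate 3 11 (Mutate 4 7 (Mutate 1 23 (Mutate 4 29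
     (Mutate 1 34 (Mutate 5 20 (Mutate 1 16 (Mutate 4 15 Stop Stop) (Mutate 4 15 Stop Stop)) Stop)
     (Mutate 5 16 Stop Stop)) (Mutate 5 16 (Mutate 1 15 Stop Stop) Stop)) (Mutate 5 15 Stop Stop))
     (Mutate 5 15 Stop Stop)) (Mutate 4 7 (Mutate 1 23 (Mutate 4 29 (Mutate 1 34 (Mutate 5 20
     (Mutate 1 16 (Mutate 4 15 Stop Stop) (Mutate 4 15 Stop Stop)) Stop) (Mutate 5 16 Stop Stop))
     (Mutate 5 16 (Mutate 1 15 Stop Stop) Stop)) (Mutate 5 15 Stop Stop)) (Mutate 5 15 Stop Stop)))
     (Mutate 5 15 Stop Stop)) (Mutate 5 15 Stop Stop)) (Mutate 2 5 (Mutate 0 19 (Mutate 1 28 (Mutate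
     3 10 (Mutate 5 18 (Mutate 1 15 Stop Stop) Stop) (Mutate 5 18 (Mutate 1 15 Stop Stop) Stop))
     (Mutate 3 10 (Mutate 5 15 Stop Stop) (Mutate 5 15 Stop Stop))) (Mutate 3 10 (Mutate 5 15 Stop
     Stop) (Mutate 5 15 Stop Stop))) (Mutate 5 15 Stop Stop))) (Mutate 2 5 (Mutate 0 28 (Mutate 3 10
     (Mutate 5 16 (Mutate 1 18 (Mutate 0 15 Stop Stop) Stop) Stop) (Mutate 5 16 (Mutate 1 18 (Mutate
     0 15 Stop Stop) Stop) Stop)) (Mutate 3 10 (Mutate 5 16 (Mutate 1 15 Stop Stop) Stop) (Mutate 5
     16 (Mutate 1 15 Stop Stop) Stop))) (Mutate 5 16 (Mutate 1 15 (Mutate 0 26 (Mutate 1 30 (Mutate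
     2 28 (Mutate 5 31 (Mutate 4 34 (Mutate 3 27 (Mutate 4 22 (Mutate 2 17 (Mutate 4 25 (Mutate 2 34
     (Mutate 3 35 (Mutate 1 15 (Mutate 3 1 (Mutate 1 27 (Mutate 5 12 Stop Stop) (Mutate 5 12 Stop
     Stop)) Stop) Stop) (Mutate 5 4 (Mutate 1 12 Stop Stop) Stop)) (Mutate 3 35 (Mutate 1 15 (Mutate
     3 1 (Mutate 1 27 (Mutate 4 22 (Mutate 1 2 (Mutate 2 28 (Mutate 5 12 Stop Stop) (Mutate 4 15
     (Mutate 2 18 (Mutate 4 28 (Mutate 5 12 Stop Stop) (Mutate 5 12 Stop Stop)) (Mutate 5 12 Stop
     Stop)) (Mutate 5 12 Stop Stop))) (Mutate 2 28 (Mutate 4 34 (Mutate 1 18 (Mutate 2 15 (Mutate 5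
     12 Stop Stop) (Mutate 5 12 Stop Stop)) (Mutate 5 12 Stop Stop)) (Mutate 5 12 Stop Stop))
     (Mutate 5 12 Stop Stop))) (Mutate 5 12 Stop Stop)) (Mutate 5 12 Stop Stop)) Stop) Stop) (Mutate
     5 4 (Mutate 1 12 Stop Stop) Stop))) (Mutate 5 4 (Mutate 1 12 (Mutate 3 16 (Mutate 4 8 (Mutate 2
     20 (Mutate 3 34 (Mutate 4 28 (Mutate 5 18 (Mutate 1 32 (Mutate 4 15 (Mutate 5 35 (Mutate 4 30
     (Mutate 5 28 Stop Stop) Stop) Stop) Stop) (Mutate 4 15 Stop Stop)) Stop) (Mutate 5 15 (Mutate 1
     35 (Mutate 5 30 Stop Stop) Stop) Stop)) (Mutate 4 28 (Mutate 5 18 (Mutate 1 32 (Mutate 4 15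
     (Mutate 5 35 (Mutate 4 30 (Mutate 5 28 Stop Stop) Stop) Stop) Stop) (Mutate 4 15 Stop Stop))
     Stop) (Mutate 5 15 (Mutate 1 35 (Mutate 5 30 Stop Stop) Stop) Stop))) (Mutate 3 25 (Mutate 2 34
     (Mutate 5 15 (Mutate 1 35 (Mutate 5 30 Stop Stop) Stop) Stop) (Mutate 5 15 (Mutate 1 35 (Mutate
     5 30 Stop Stop) Stop) Stop)) (Mutate 5 15 (Mutate 1 35 (Mutate 5 30 Stop Stop) Stop) Stop)))
     Stop) Stop) (Mutate 3 16 (Mutate 4 8 (Mutate 2 20 (Mutate 3 34 (Mutate 4 28 Stop Stop) (Mutate
     4 28 Stop Stop)) (Mutate 3 25 (Mutate 2 34 Stop Stop) Stop)) Stop) Stop)) Stop)) (Mutate 5 4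
     (Mutate 1 12 (Mutate 3 16 Stop Stop) (Mutate 3 16 Stop Stop)) Stop)) (Mutate 5 4 (Mutate 1 12
     Stop Stop) Stop)) Stop) Stop) Stop) (Mutate 5 31 (Mutate 4 34 Stop Stop) Stop)) (Mutate 2 18
     (Mutate 1 28 (Mutate 5 31 (Mutate 4 34 Stop Stop) Stop) (Mutate 5 31 (Mutate 4 34 Stop Stop)
     Stop)) (Mutate 5 31 (Mutate 4 34 Stop Stop) Stop))) Stop) Stop) Stop))) (Mutate 5 16 Stop
     Stop)) (Mutate 5 16 Stop Stop)) (Mutate 5 16 Stop Stop)) (Mutate 5 16 Stop Stop)) (Mutate 5 4
     (Mutate 0 12 (Mutate 1 16 Stop Stop) (Mutate 1 16 Stop Stop)) Stop)) Stop) Stop)) (Mutate 5 33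
     Stop Stop)) Stop) Stop)) (Mutate 5 2 (Mutate 4 12 (Mutate 0 13 Stop Stop) Stop) Stop)) (Mutate
     4 21 (Mutate 5 12 (Mutate 0 13 (Mutate 1 27 (Mutate 3 25 (Mutate 2 34 (Mutate 5 33 (Mutate 0 30
     (Mutate 5 4 (Mutate 0 12 Stop Stop) Stop) Stop) Stop) (Mutate 5 33 (Mutate 0 30 (Mutate 5 4
     (Mutate 0 12 Stop Stop) Stop) Stop) Stop)) (Mutate 5 33 (Mutate 0 30 (Mutate 1 23 (Mutate 4 24
     (Mutate 3 35 (Mutate 0 7 (Mutate 1 9 (Mutate 0 31 (Mutate 3 0 (Mutate 1 22 (Mutate 2 28 (Mutate
     1 19 (Mutate 2 9 (Mutate 4 13 (Mutate 5 15 Stop Stop) (Mutate 5 15 Stop Stop)) (Mutate 4 13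
     (Mutate 5 18 (Mutate 2 15 Stop Stop) Stop) (Mutate 5 18 (Mutate 2 15 Stop Stop) Stop))) (Mutate
     4 13 Stop Stop)) (Mutate 4 13 Stop Stop)) (Mutate 4 13 (Mutate 5 15 (Mutate 1 2 (Mutate 2 18
     (Mutate 5 28 Stop Stop) (Mutate 5 22 (Mutate 2 28 Stop Stop) Stop)) Stop) Stop) (Mutate 5 15
     (Mutate 1 2 (Mutate 2 18 (Mutate 5 28 Stop Stop) (Mutate 5 22 (Mutate 2 28 Stop Stop) Stop))
     Stop) Stop))) (Mutate 5 15 Stop Stop)) (Mutate 4 11 (Mutate 0 25 (Mutate 1 6 (Mutate 0 23
     (Mutate 2 29 (Mutate 0 34 (Mutate 3 21 (Mutate 5 20 (Mutate 0 16 Stop Stop) Stop) (Mutate 5 20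
     (Mutate 0 16 Stop Stop) Stop)) (Mutate 3 21 (Mutate 5 16 Stop Stop) (Mutate 5 16 Stop Stop)))
     (Mutate 3 21 (Mutate 5 16 Stop Stop) (Mutate 5 16 Stop Stop))) (Mutate 2 34 (Mutate 3 21
     (Mutate 5 8 (Mutate 1 12 (Mutate 3 15 (Mutate 1 35 Stop Stop) Stop) Stop) Stop) (Mutate 5 8
     Stop Stop)) (Mutate 3 21 (Mutate 5 8 (Mutate 0 16 (Mutate 1 12 (Mutate 2 20 (Mutate 0 34
     (Mutate 3 15 (Mutate 1 35 Stop Stop) Stop) (Mutate 3 15 (Mutate 1 35 Stop Stop) Stop)) (Mutate
     3 15 (Mutate 1 35 Stop Stop) Stop)) (Mutate 2 20 (Mutate 0 34 Stop Stop) Stop)) (Mutate 1 12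
     (Mutate 3 15 (Mutate 1 35 Stop Stop) Stop) Stop)) Stop) (Mutate 5 8 (Mutate 0 16 (Mutate 2 20
     (Mutate 0 34 Stop Stop) Stop) Stop) Stop)))) (Mutate 2 34 (Mutate 4 31 (Mutate 5 15 Stop Stop)
     (Mutate 5 15 Stop Stop)) (Mutate 4 31 (Mutate 5 15 Stop Stop) (Mutate 5 15 Stop Stop))))
     (Mutate 5 15 Stop Stop)) (Mutate 5 15 Stop Stop))) (Mutate 4 11 (Mutate 5 16 (Mutate 1 15 Stop
     Stop) Stop) (Mutate 5 16 (Mutate 1 15 (Mutate 0 26 (Mutate 1 30 (Mutate 3 22 (Mutate 1 2
     (Mutate 2 28 (Mutate 4 12 Stop (Mutate 5 31 Stop Stop)) (Mutate 3 15 (Mutate 2 18 (Mutate 3 28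
     (Mutate 4 12 Stop (Mutate 5 31 Stop Stop)) (Mutate 4 12 Stop (Mutate 5 31 Stop Stop))) (Mutate
     4 12 Stop (Mutate 5 31 Stop Stop))) (Mutate 4 12 Stop (Mutate 5 31 Stop Stop)))) (Mutate 2 28
     (Mutate 5 31 Stop Stop) (Mutate 5 31 Stop Stop))) (Mutate 5 31 Stop Stop)) (Mutate 5 31 Stop
     Stop)) Stop) Stop) Stop))) (Mutate 5 16 Stop Stop)) (Mutate 5 16 Stop Stop)) (Mutate 5 16 Stop
     Stop)) (Mutate 5 4 (Mutate 0 12 (Mutate 1 16 (Mutate 3 8 (Mutate 1 25 (Mutate 2 34 Stop Stop)
     (Mutate 2 20 (Mutate 1 34 (Mutate 3 28 Stop Stop) (Mutate 3 28 Stop Stop)) Stop)) Stop) Stop)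
     (Mutate 1 16 (Mutate 3 8 (Mutate 1 25 (Mutate 2 34 Stop Stop) (Mutate 2 20 (Mutate 1 34 (Mutate
     3 28 Stop Stop) (Mutate 3 28 Stop Stop)) Stop)) Stop) Stop)) Stop)) Stop) Stop)) (Mutate 5 33
     Stop Stop)) Stop) Stop) (Mutate 5 2 (Mutate 3 15 (Mutate 2 18 (Mutate 3 28 (Mutate 4 12 (Mutate
     0 13 Stop Stop) Stop) (Mutate 4 12 (Mutate 0 13 Stop Stop) Stop)) (Mutate 4 12 (Mutate 0 13
     Stop Stop) Stop)) (Mutate 4 12 (Mutate 0 13 Stop Stop) Stop)) Stop))) Stop)) Stop) (Mutate 5 23
     (Mutate 0 33 (Mutate 5 9 (Mutate 0 15 Stop Stop) Stop) Stop) Stop)) (Mutate 5 21 (Mutate 3 23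
     (Mutate 0 33 Stop Stop) Stop) Stop))"

lemma represents_initial_seed_3: "represents vertices_3 1 (initial_seed 3) indices_3 weights_3"
  by (rule represents_initial_seed)
    (simp_all add: vertices_3_def indices_3_def weights_3_def Q_edges_iff cluster_poly_simps
      upt_conv_Cons upt_conv_Nil take_Cons' drop_Cons' del: One_nat_def)

lemma represents_initial_seed_4: "represents vertices_4 3 (initial_seed 4) indices_4 weights_4"
  by (rule represents_initial_seed)
    (simp_all add: vertices_4_def indices_4_def weights_4_def Q_edges_iff cluster_poly_simps
      upt_conv_Cons upt_conv_Nil take_Cons' drop_Cons' del: One_nat_def)

lemma represents_initial_seed_5: "represents vertices_5 6 (initial_seed 5) indices_5 weights_5"
  by (rule represents_initial_seed)
    (simp_all add: vertices_5_def indices_5_def weights_5_def Q_edges_iff cluster_poly_simps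
      upt_conv_Cons upt_conv_Nil take_Cons' drop_Cons' del: One_nat_def)

text \<open>
  The number 1 is also the index of a cluster variable, so it must stay a literal: the evaluations
  below run without the rewrite rule \<open>1 = Suc 0\<close>, which the library rules for lists rely on.
\<close>

lemma nat_literal_simps:
  "(x # xs) ! 1 = xs ! 0" "(x # xs)[1 := y] = x # xs[0 := y]"
  "(x # xs)[numeral k := y] = x # xs[pred_numeral k := y]" "1 < Suc n \<longleftrightarrow> 0 < n"
  "(case 1 of 0 \<Rightarrow> a | Suc j \<Rightarrow> g j) = g 0"
  by (simp_all add: numeral_eq_Suc)

lemma upt_45:
  "[0..<45] = [0, 1, 2, 3, 4, 5, 6, 7, 8, 9, 10, 11, 12, 13, 14, 15, 16, 17, 18, 19, 20, 21, 22,
     23, 24, 25, 26, 27, 28, 29, 30, 31, 32, 33, 34, 35, 36, 37, 38, 39, 40, 41, 42, 43, 44]"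
  by (simp add: upt_conv_Cons upt_conv_Nil)

lemmas explore_simps = exchange_any_def exchange_relations mutate_row_def nat_literal_simps

text \<open>\<open>zs\<close> consists of the two mutable variables of type A1. With
  \<open>refl\<close> fixing the candidates, the goals left are the bound on \<open>n\<close>, the
  alphabet of the labels, completeness and the covering.\<close>

lemma D_cone_subset_3: "D_cone 3 \<subseteq> (\<Union>S\<in>seeds 3. seed_cone 3 S)"
  apply (rule D_cone_subset_seed_cones[OF _ represents_initial_seed_3, where t = mutations_3
        and zs = "[13, 16]", OF _ _ refl])
  subgoal by simp
  subgoal by (simp add: indices_3_def mutations_3_def weights_3_def label_simps explore_simps
        del: One_nat_def)
  subgoal by (simp add: indices_3_def straightening_def label_simps take_Cons' drop_Cons' upt_45
        del: One_nat_def)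
  subgoal by (simp add: indices_3_def mutations_3_def weights_3_def straightening_def explore_simps
        take_Cons' del: One_nat_def)
  done

text \<open>\<open>zs\<close> consists of the nine mutable variables of type A3; it includes 10 and
  12, which are frozen for n = 3.\<close>

lemma D_cone_subset_4: "D_cone 4 \<subseteq> (\<Union>S\<in>seeds 4. seed_cone 4 S)"
  apply (rule D_cone_subset_seed_cones[OF _ represents_initial_seed_4, where t = mutations_4
        and zs = "[7, 8, 9, 10, 12, 13, 16, 25, 35]", OF _ _ refl])
  subgoal by simp
  subgoal by (simp add: indices_4_def mutations_4_def weights_4_def label_simps explore_simps
        del: One_nat_def)
  subgoal by (simp add: indices_4_def straightening_def label_simps take_Cons' drop_Cons' upt_45
        del: One_nat_def)
  subgoal by (simp add: indices_4_def mutations_4_def weights_4_def straightening_def explore_simps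
        take_Cons' del: One_nat_def)
  done

text \<open>\<open>zs\<close> consists of all 36 mutable variables of type D6. The alphabet
  condition is settled by its disjunct \<open>n = 5\<close>.\<close>

lemma D_cone_subset_5: "D_cone 5 \<subseteq> (\<Union>S\<in>seeds 5. seed_cone 5 S)"
  apply (rule D_cone_subset_seed_cones[OF _ represents_initial_seed_5, where t = mutations_5
        and zs = "[0, 1, 2, 3, 4, 5, 6, 7, 8, 9, 10, 11, 12, 13, 14, 15, 16, 17, 18,
          19, 20, 21, 22, 23, 24, 25, 26, 27, 28, 29, 30, 31, 32, 33, 34, 35]", OF _ _ refl])
  subgoal by simp
  subgoal by simp
  subgoal by (simp add: indices_5_def straightening_def label_simps take_Cons' drop_Cons' upt_45
        del: One_nat_def)
  subgoal by (simp add: indices_5_def mutations_5_def weights_5_def straightening_def explore_simps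
        take_Cons' del: One_nat_def)
  done

theorem mainTheorem5:
  fixes n :: nat
  assumes "n \<in> {3, 4, 5}"
  shows "(\<Union>S \<in> seeds n. seed_cone n S) = D_cone n"
  using assms seed_cone_subset_D_cone D_cone_subset_3 D_cone_subset_4 D_cone_subset_5 by blast

end
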